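(* Let $(X_n)_{n\ge 0}$ be a real-valued Markov chain satisfying Assumptions A1–A5 (listed in the context), with $f$ its stationary density restricted to $[0,1]$. Let $(S_m)_{m\in\mathcal{M}_n}$ be a collection of models satisfying Assumptions M1–M3 (listed in the context) with constant $r_0$. Then there is a constant $K_0$, depending on the chain and on $r_0$ but not on $n$, such that for every $K>K_0$ the following holds. Set $\mathrm{pen}(m)=K\frac{D_m}{n}$ and $$\tilde f=\hat f_{\hat m},\qquad \hat m=\underset{m\in\mathcal{M}_n}{\arg\min}\,\big[\gamma_n(\hat f_m)+\mathrm{pen}(m)\big].$$ Then there is a constant $C_1$, not depending on $n$, such that $$\mathbb{E}\|\tilde f-f\|^2\le 3\inf_{m\in\mathcal{M}_n}\{d^2(f,S_m)+\mathrm{pen}(m)\}+\frac{C_1}{n}.$$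
   Context: Chain assumptions. $(X_n)_{n\ge 0}$ is a Markov chain on $\mathbb{R}$ with transition kernel $P$, and: A1. $(X_n)$ is irreducible and positive recurrent, with stationary probability measure $\mu$. The measure $\mu$ has a density with respect to Lebesgue measure, and $f$ denotes this density multiplied by $\mathbf 1_{[0,1]}$. A2. $X_0$ has distribution $\mu$ (so the chain is strictly stationary). A3. $\|f\|_\infty=\sup_{x\in[0,1]}|f(x)|<\infty$. A4. There are a function $h:[0,1]\to[0,1]$ (extended by $0$ outside $[0,1]$) with $\int h\,d\mu>0$ and a probability measure $\nu$ such that $P(x,A)\ge h(x)\nu(A)$ for all events $A$ and all $x$. A5. There are a finite function $V>0$ and a constant $\rho\in(0,1)$ such that $\|P^n(x,\cdot)-\mu\|_{TV}\le V(x)\rho^n$ for all $n\ge 1$ and all $x$, where $\|\cdot\|_{TV}$ is the total variation norm. Notation. $L^2([0,1])$ is the set of functions $t:\mathbb{R}\to\mathbb{R}$ supported in $[0,1]$ with $\|t\|^2=\int_0^1 t^2(x)\,dx<\infty$. $\|\cdot\|$ is the $L^2$ norm, $\|\cdot\|_\infty$ the sup norm, and $d(f,S)=\inf_{t\in S}\|f-t\|$. Model assumptions. $D_m$ is the dimension of $S_m$ and $\mathcal{M}_n=\{m: D_m\le\sqrt n\}$. M1. Each $S_m$, $m\in\mathcal M_n$, is a linear subspace of $(L^\infty\cap L^2)([0,1])$ with dimension $D_m\le\sqrt n$. M2. There is a real $r_0$ such that for all $m$, $\phi_m:=\frac{1}{\sqrt{D_m}}\sup_{t\in S_m\setminus\{0\}}\frac{\|t\|_\infty}{\|t\|}\le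 r_0$. M3. The models are nested: $D_m\le D_{m'}\Rightarrow S_m\subset S_{m'}$. Estimators. The data are $X_1,\dots,X_n$. The contrast is $\gamma_n(t)=\frac1n\sum_{i=1}^n[\|t\|^2-2t(X_i)]$, and $\hat f_m=\arg\min_{t\in S_m}\gamma_n(t)$. Equivalently, $\hat f_m=\sum_\lambda\hat\beta_\lambda\varphi_\lambda$ with $\hat\beta_\lambda=\frac1n\sum_{i=1}^n\varphi_\lambda(X_i)$ for an orthonormal basis $(\varphi_\lambda)$ of $S_m$. *)

theory Defs
  imports "HOL-Probability.Probability" "HOL-Library.Function_Algebras"
begin

section \<open>Markov chains on the real line\<close>

definition natural_filtration :: "'a measure \<Rightarrow> (nat \<Rightarrow> 'a \<Rightarrow> real) \<Rightarrow> nat \<Rightarrow> 'a measure" where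
  "natural_filtration M X n =
     sigma (space M) (\<Union>i\<le>n. {X i -` A \<inter> space M | A. A \<in> sets borel})"

definition markov_kernel :: "(real \<Rightarrow> real measure) \<Rightarrow> bool" where
  "markov_kernel P \<longleftrightarrow> P \<in> borel \<rightarrow>\<^sub>M prob_algebra borel"

definition markov_chain ::
    "'a measure \<Rightarrow> (nat \<Rightarrow> 'a \<Rightarrow> real) \<Rightarrow> (real \<Rightarrow> real measure) \<Rightarrow> bool" where
  "markov_chain M X P \<longleftrightarrow>
     prob_space M \<and> markov_kernel P \<and> (\<forall>n. X n \<in> borel_measurable M) \<and>
     (\<forall>n. \<forall>A\<in>sets borel. AE \<omega> in M.
        real_cond_exp M (natural_filtration M X n) (\<lambda>\<omega>. indicator A (X (Suc n) \<omega>)) \<omega>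
          = measure (P (X n \<omega>)) A)"

fun kernel_pow :: "(real \<Rightarrow> real measure) \<Rightarrow> nat \<Rightarrow> real \<Rightarrow> real measure" where
  "kernel_pow P 0 x = return borel x"
| "kernel_pow P (Suc n) x = kernel_pow P n x \<bind> P"

definition irreducibility_measure :: "(real \<Rightarrow> real measure) \<Rightarrow> real measure \<Rightarrow> bool" where
  "irreducibility_measure P \<phi> \<longleftrightarrow>
     sigma_finite_measure \<phi> \<and> sets \<phi> = sets borel \<and> emeasure \<phi> UNIV \<noteq> 0 \<and>
     (\<forall>A\<in>sets borel. emeasure \<phi> A > 0 \<longrightarrow> (\<forall>x. \<exists>n\<ge>1. emeasure (kernel_pow P n x) A > 0))"

definition irreducible_kernel :: "(real \<Rightarrow> real measure) \<Rightarrow> bool" where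
  "irreducible_kernel P \<longleftrightarrow> (\<exists>\<phi>. irreducibility_measure P \<phi>)"

text \<open>
  A set is charged by a maximal irreducibility measure iff it is charged by some irreducibility
  measure. Hence quantifying over all irreducibility measures gives the usual definition: the
  expected number of visits to such a set is infinite from every starting point.
\<close>

definition recurrent_kernel :: "(real \<Rightarrow> real measure) \<Rightarrow> bool" where
  "recurrent_kernel P \<longleftrightarrow> irreducible_kernel P \<and>
     (\<forall>\<phi> A. irreducibility_measure P \<phi> \<and> A \<in> sets borel \<and> emeasure \<phi> A > 0 \<longrightarrow>
        (\<forall>x. (\<Sum>n. emeasure (kernel_pow P (Suc n) x) A) = \<infinity>))"

definition stationary_distribution :: "(real \<Rightarrow> real measure) \<Rightarrow> real measure \<Rightarrow> bool" where
  "stationary_distribution P \<mu> \<longleftrightarrow> prob_space \<mu> \<and> sets \<mu> = sets borel \<and> \<mu> \<bind> P = \<mu>"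

definition positive_recurrent_with :: "(real \<Rightarrow> real measure) \<Rightarrow> real measure \<Rightarrow> bool" where
  "positive_recurrent_with P \<mu> \<longleftrightarrow> recurrent_kernel P \<and> stationary_distribution P \<mu>"

text \<open>The total variation norm of the signed measure \<open>\<mu>1 - \<mu>2\<close>; for probability measures it is at most 2.\<close>

definition tv_norm_diff :: "real measure \<Rightarrow> real measure \<Rightarrow> real" where
  "tv_norm_diff \<mu>1 \<mu>2 =
     (SUP g\<in>{g \<in> borel_measurable borel. \<forall>x. \<bar>g x\<bar> \<le> 1}. \<bar>(LINT x|\<mu>1. g x) - (LINT x|\<mu>2. g x)\<bar>)"

section \<open>Function spaces on the unit interval\<close>

text \<open>
  Elements are functions vanishing outside the unit interval, not equivalence classes, since they
  are evaluated at the observations; accordingly \<open>sup_norm\<close> is the pointwise supremum.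
\<close>

definition L2 :: "(real \<Rightarrow> real) set" where
  "L2 = {t \<in> borel_measurable borel.
           (\<forall>x. x \<notin> {0..1} \<longrightarrow> t x = 0) \<and> set_integrable lborel {0..1} (\<lambda>x. (t x)\<^sup>2)}"

definition Linf :: "(real \<Rightarrow> real) set" where
  "Linf = {t \<in> borel_measurable borel.
           (\<forall>x. x \<notin> {0..1} \<longrightarrow> t x = 0) \<and> bdd_above ((\<lambda>x. \<bar>t x\<bar>) ` {0..1})}"

definition l2_norm :: "(real \<Rightarrow> real) \<Rightarrow> real" where
  "l2_norm t = sqrt (LINT x:{0..1}|lborel. (t x)\<^sup>2)"

definition sup_norm :: "(real \<Rightarrow> real) \<Rightarrow> real" where
  "sup_norm t = (SUP x\<in>{0..1}. \<bar>t x\<bar>)"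

definition l2_dist_set :: "(real \<Rightarrow> real) \<Rightarrow> (real \<Rightarrow> real) set \<Rightarrow> real" where
  "l2_dist_set f S = (INF t\<in>S. l2_norm (\<lambda>x. f x - t x))"

definition fun_scale :: "real \<Rightarrow> (real \<Rightarrow> real) \<Rightarrow> (real \<Rightarrow> real)" where
  "fun_scale c t = (\<lambda>x. c * t x)"

interpretation fun_vs: vector_space fun_scale
  by unfold_locales (auto simp: fun_scale_def fun_eq_iff algebra_simps)

section \<open>Models and penalised estimators\<close>

definition phi :: "(real \<Rightarrow> real) set \<Rightarrow> ereal" where
  "phi S = 1 / ereal (sqrt (real (fun_vs.dim S))) *
             (SUP t\<in>S - {0}. ereal (sup_norm t) / ereal (l2_norm t))"

text \<open>\<open>fun_vs.dim\<close> is 0 on infinite-dimensional spaces, so finite dimensionality is explicit.\<close>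

definition models :: "'m set \<Rightarrow> ('m \<Rightarrow> (real \<Rightarrow> real) set) \<Rightarrow> real \<Rightarrow> bool" where
  "models I S r0 \<longleftrightarrow>
     (\<forall>m\<in>I. fun_vs.subspace (S m) \<and> S m \<subseteq> Linf \<inter> L2 \<and> (\<exists>B. finite B \<and> fun_vs.span B = S m)) \<and>
     (\<forall>m\<in>I. phi (S m) \<le> ereal r0) \<and>
     (\<forall>m\<in>I. \<forall>m'\<in>I. fun_vs.dim (S m) \<le> fun_vs.dim (S m') \<longrightarrow> S m \<subseteq> S m')"

definition models_upto :: "'m set \<Rightarrow> ('m \<Rightarrow> (real \<Rightarrow> real) set) \<Rightarrow> nat \<Rightarrow> 'm set" where
  "models_upto I S n = {m \<in> I. real (fun_vs.dim (S m)) \<le> sqrt (real n)}"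

definition contrast :: "nat \<Rightarrow> (nat \<Rightarrow> real) \<Rightarrow> (real \<Rightarrow> real) \<Rightarrow> real" where
  "contrast n x t = 1 / real n * (\<Sum>i=1..n. (l2_norm t)\<^sup>2 - 2 * t (x i))"

definition min_contrast_est :: "nat \<Rightarrow> (nat \<Rightarrow> real) \<Rightarrow> (real \<Rightarrow> real) set \<Rightarrow> (real \<Rightarrow> real)" where
  "min_contrast_est n x S = arg_min (contrast n x) (\<lambda>t. t \<in> S)"

definition pen :: "real \<Rightarrow> nat \<Rightarrow> (real \<Rightarrow> real) set \<Rightarrow> real" where
  "pen K n S = K * real (fun_vs.dim S) / real n"

text \<open>
  The minimiser need not be unique, so a selection rule is any random variable picking a
  minimiser.
\<close>

definition penalized_selection ::
    "'a measure \<Rightarrow> (nat \<Rightarrow> 'a \<Rightarrow> real) \<Rightarrow> 'm set \<Rightarrow> ('m \<Rightarrow> (real \<Rightarrow> real) set) \<Rightarrow> real \<Rightarrow> nat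
      \<Rightarrow> ('a \<Rightarrow> 'm) \<Rightarrow> bool" where
  "penalized_selection M X I S K n mhat \<longleftrightarrow>
     mhat \<in> M \<rightarrow>\<^sub>M count_space UNIV \<and>
     (\<forall>\<omega>\<in>space M.
        is_arg_min
          (\<lambda>m. contrast n (\<lambda>i. X i \<omega>) (min_contrast_est n (\<lambda>i. X i \<omega>) (S m)) + pen K n (S m))
          (\<lambda>m. m \<in> models_upto I S n) (mhat \<omega>))"

end

theory Submission
  imports Defs "HOL-Complex_Analysis.Complex_Analysis" "HOL-Real_Asymp.Real_Asymp"
begin

text \<open>
Write \<open>\<nu>\<^sub>n(t)\<close> for the mean of \<open>t\<close> over the observations minus \<open>\<integral> t f\<close>, and \<open>W\<^sub>m\<close> for the supremum
of \<open>\<nu>\<^sub>n(t)\<^sup>2\<close> over the \<open>L\<^sup>2\<close> unit ball of \<open>S\<^sub>m\<close>. Since \<open>\<gamma>\<^sub>n(t) = \<parallel>t - f\<parallel>\<^sup>2 - \<parallel>f\<parallel>\<^sup>2 - 2 \<nu>\<^sub>n(t)\<close>,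
comparing the selected estimator with the projection of \<open>f\<close> on an arbitrary model gives an
inequality in which the only random remainder is \<open>8 W\<close> for the larger of the two models
(\<open>oracle_step\<close>). So everything reduces to one probabilistic fact: there is a constant \<open>\<kappa>\<close> such that
\<open>W\<^sub>m\<close> exceeds \<open>2 \<kappa> D\<^sub>m / n\<close>, uniformly in \<open>m\<close>, by at most \<open>O(1/n)\<close> in expectation
(\<open>model_error_le_excess\<close>, \<open>excess_expectation\<close>). As soon as \<open>K \<ge> 16 \<kappa>\<close> the penalty absorbs the rest.

In an orthonormal basis \<open>n\<^sup>2 W\<^sub>m\<close> is the squared length of a sum of \<open>n\<close> centred vectors in \<open>\<real>\<^sup>D\<close>. Its
mean is at most a constant times \<open>n D\<close>, and the variance of a fixed unit direction is at most a
constant times \<open>n D\<^sup>1\<^sup>/\<^sup>4\<close>: far smaller than the trace, because a function in the unit ball is as large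
as \<open>\<surd>D\<close> only on a small set. Hence the squared length has fluctuations of size
\<open>n \<surd>(D D\<^sup>1\<^sup>/\<^sup>4)\<close>, much less than its mean, and a fourth moment (\<open>fourth_moment_bound\<close>) gives an
expected excess over \<open>\<kappa> n D\<close> of order \<open>n / \<surd>D\<close> (\<open>quadratic_excess_bound\<close>). The models are nested, so it
suffices to control the largest model in each dyadic range of dimensions, and \<open>1 / \<surd>D\<close> is summable
over dyadic \<open>D\<close>. The second moment would not do: its contributions are not summable over these
ranges.

The fourth moment is computed for sums over blocks of length \<open>q\<close> with \<open>q\<^sup>6\<close> of order \<open>n\<close>. Blocks of
the same parity are a distance \<open>q\<close> apart, and the chain forgets its past at a geometric rate, so
that conditional first and second moments of a block agree with the stationary ones up to an error
that is negligible against every power of \<open>n\<close>; the recursion for the fourth moment involves the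
conditional law only through these.

The hypothesis on the chain is geometric ergodicity with a rate \<open>V(x)\<close> that need not be
\<open>\<mu>\<close>-integrable, while mixing requires decay of the distance to stationarity averaged over \<open>\<mu>\<close>. This
is where the minorisation enters (\<open>mean_geometric_ergodicity\<close>). It makes the chain regenerate with
law \<open>\<nu>\<close>; after restricting \<open>\<nu>\<close> to a set on which the constant \<open>V\<close> can be replaced by a bound, the
renewal sequence converges geometrically. The tails of the regeneration time are the coefficients of the reciprocal
of a power series with radius of convergence larger than \<open>1\<close>, and therefore decay geometrically too
(\<open>reciprocal_power_series_decay\<close>). Stationarity turns this into geometric tails under \<open>\<mu>\<close>.
\<close>

section \<open>Markov kernels as operators on bounded Borel functions\<close>

definition borel_bounded :: "real \<Rightarrow> (real \<Rightarrow> real) \<Rightarrow> bool" where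
  "borel_bounded c \<phi> \<longleftrightarrow> \<phi> \<in> borel_measurable borel \<and> (\<forall>x. \<bar>\<phi> x\<bar> \<le> c)"

lemma borel_boundedI: "\<phi> \<in> borel_measurable borel \<Longrightarrow> (\<And>x. \<bar>\<phi> x\<bar> \<le> c) \<Longrightarrow> borel_bounded c \<phi>"
  by (simp add: borel_bounded_def)

lemma borel_bounded_measurable: "borel_bounded c \<phi> \<Longrightarrow> \<phi> \<in> borel_measurable borel"
  by (simp add: borel_bounded_def)

lemma borel_bounded_abs_le: "borel_bounded c \<phi> \<Longrightarrow> \<bar>\<phi> x\<bar> \<le> c"
  by (simp add: borel_bounded_def)

lemma borel_bounded_nonneg: "borel_bounded c \<phi> \<Longrightarrow> 0 \<le> c"
  using borel_bounded_abs_le[of c \<phi> 0] by linarith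

lemma borel_bounded_mono: "borel_bounded c \<phi> \<Longrightarrow> c \<le> d \<Longrightarrow> borel_bounded d \<phi>"
  by (auto simp: borel_bounded_def intro: order_trans)

lemma borel_bounded_const: "borel_bounded \<bar>c\<bar> (\<lambda>_. c)"
  by (simp add: borel_bounded_def)

lemma borel_bounded_add: "borel_bounded c \<phi> \<Longrightarrow> borel_bounded d \<psi> \<Longrightarrow> borel_bounded (c + d) (\<lambda>x. \<phi> x + \<psi> x)"
  unfolding borel_bounded_def by (auto intro!: order_trans[OF abs_triangle_ineq] add_mono)

lemma borel_bounded_diff: "borel_bounded c \<phi> \<Longrightarrow> borel_bounded d \<psi> \<Longrightarrow> borel_bounded (c + d) (\<lambda>x. \<phi> x - \<psi> x)"
  unfolding borel_bounded_def by (auto intro!: order_trans[OF abs_triangle_ineq4] add_mono)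

lemma borel_bounded_mult: "borel_bounded c \<phi> \<Longrightarrow> borel_bounded d \<psi> \<Longrightarrow> borel_bounded (c * d) (\<lambda>x. \<phi> x * \<psi> x)"
  unfolding borel_bounded_def abs_mult
  by (auto intro!: mult_mono simp: order_trans[OF abs_ge_zero])

lemma borel_bounded_cmult: "borel_bounded c \<phi> \<Longrightarrow> borel_bounded (\<bar>a\<bar> * c) (\<lambda>x. a * \<phi> x)"
  using borel_bounded_mult[OF borel_bounded_const] .

lemma borel_bounded_sum:
  "(\<And>j. j \<in> J \<Longrightarrow> borel_bounded (c j) (\<phi> j)) \<Longrightarrow> borel_bounded (\<Sum>j\<in>J. c j) (\<lambda>x. \<Sum>j\<in>J. \<phi> j x)"
proof (induction J rule: infinite_finite_induct)
  case (insert j J)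
  then show ?case using borel_bounded_add[of "c j" "\<phi> j"] by auto
qed (use borel_bounded_const[of 0] in auto)

lemma integrable_borel_bounded:
  assumes "prob_space N" "sets N = sets borel" "borel_bounded c \<phi>"
  shows "integrable N \<phi>"
proof -
  interpret prob_space N by fact
  have "\<phi> \<in> borel_measurable N"
    using assms by (simp add: borel_bounded_def measurable_cong_sets[OF assms(2) refl])
  then show ?thesis
    by (intro integrable_const_bound[where B=c]) (use assms in \<open>auto simp: borel_bounded_def\<close>)
qed

lemma abs_integral_borel_bounded:
  assumes "prob_space N" "sets N = sets borel" "borel_bounded c \<phi>"
  shows "\<bar>LINT x|N. \<phi> x\<bar> \<le> c"
proof -
  interpret prob_space N by fact
  have "\<bar>LINT x|N. \<phi> x\<bar> \<le> (LINT x|N. \<bar>\<phi> x\<bar>)"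
    using integral_norm_bound[of N \<phi>] by simp
  also have "\<dots> \<le> (LINT x|N. c)"
    using integrable_borel_bounded[OF assms] borel_bounded_abs_le[OF assms(3)]
    by (intro integral_mono) auto
  also have "\<dots> = c" by (simp add: prob_space)
  finally show ?thesis .
qed

definition kernel_op :: "(real \<Rightarrow> real measure) \<Rightarrow> (real \<Rightarrow> real) \<Rightarrow> real \<Rightarrow> real" where
  "kernel_op P \<phi> x = (LINT y|P x. \<phi> y)"

context
  fixes P :: "real \<Rightarrow> real measure"
  assumes P: "markov_kernel P"
begin

lemma kernel_measurable: "P \<in> borel \<rightarrow>\<^sub>M subprob_algebra borel"
  using P unfolding markov_kernel_def by (rule measurable_prob_algebraD)

lemma kernel_prob: "prob_space (P x)" and kernel_sets: "sets (P x) = sets borel"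
  using measurable_space[OF P[unfolded markov_kernel_def], of x] by (auto simp: space_prob_algebra)

lemma kernel_op_bounded: "borel_bounded c \<phi> \<Longrightarrow> borel_bounded c (kernel_op P \<phi>)"
proof (rule borel_boundedI)
  assume \<phi>: "borel_bounded c \<phi>"
  show "kernel_op P \<phi> \<in> borel_measurable borel"
    unfolding kernel_op_def
    using measurable_compose[OF kernel_measurable integral_measurable_subprob_algebra]
      borel_bounded_measurable[OF \<phi>] by blast
  show "\<bar>kernel_op P \<phi> x\<bar> \<le> c" for x
    unfolding kernel_op_def by (rule abs_integral_borel_bounded[OF kernel_prob kernel_sets \<phi>])
qed

lemma kernel_op_pow_bounded: "borel_bounded c \<phi> \<Longrightarrow> borel_bounded c ((kernel_op P ^^ n) \<phi>)"
  by (induction n) (auto intro: kernel_op_bounded)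

lemma kernel_op_const: "kernel_op P (\<lambda>_. c) = (\<lambda>_. c)"
  using prob_space.prob_space[OF kernel_prob] by (simp add: kernel_op_def fun_eq_iff)

lemma kernel_op_pow_const: "(kernel_op P ^^ n) (\<lambda>_. c) = (\<lambda>_. c)"
  by (induction n) (simp_all add: kernel_op_const)

lemma kernel_op_add:
  "borel_bounded c \<phi> \<Longrightarrow> borel_bounded d \<psi> \<Longrightarrow>
    kernel_op P (\<lambda>x. \<phi> x + \<psi> x) = (\<lambda>x. kernel_op P \<phi> x + kernel_op P \<psi> x)"
  unfolding kernel_op_def fun_eq_iff
  using integrable_borel_bounded[OF kernel_prob kernel_sets] by (metis Bochner_Integration.integral_add)

lemma kernel_op_cmult: "kernel_op P (\<lambda>x. a * \<phi> x) = (\<lambda>x. a * kernel_op P \<phi> x)"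
  unfolding kernel_op_def by simp

lemma kernel_op_sum:
  "(\<And>j. j \<in> J \<Longrightarrow> borel_bounded (c j) (\<phi> j)) \<Longrightarrow>
    kernel_op P (\<lambda>x. \<Sum>j\<in>J. \<phi> j x) = (\<lambda>x. \<Sum>j\<in>J. kernel_op P (\<phi> j) x)"
  unfolding kernel_op_def fun_eq_iff
  using integrable_borel_bounded[OF kernel_prob kernel_sets]
  by (intro allI Bochner_Integration.integral_sum) blast

lemma kernel_op_pow_sum:
  "(\<And>j. j \<in> J \<Longrightarrow> borel_bounded (c j) (\<phi> j)) \<Longrightarrow>
    (kernel_op P ^^ n) (\<lambda>x. \<Sum>j\<in>J. a j * \<phi> j x) = (\<lambda>x. \<Sum>j\<in>J. a j * (kernel_op P ^^ n) (\<phi> j) x)"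
proof (induction n)
  case (Suc n)
  have "(kernel_op P ^^ Suc n) (\<lambda>x. \<Sum>j\<in>J. a j * \<phi> j x)
      = kernel_op P (\<lambda>x. \<Sum>j\<in>J. a j * (kernel_op P ^^ n) (\<phi> j) x)"
    using Suc by simp
  also have "\<dots> = (\<lambda>x. \<Sum>j\<in>J. kernel_op P (\<lambda>x. a j * (kernel_op P ^^ n) (\<phi> j) x) x)"
    by (rule kernel_op_sum[where c="\<lambda>j. \<bar>a j\<bar> * c j"])
       (rule borel_bounded_cmult, rule kernel_op_pow_bounded, rule Suc)
  finally show ?case by (simp add: kernel_op_cmult)
qed simp

lemma integral_bind_kernel:
  assumes N: "prob_space N" "sets N = sets borel" and \<phi>: "borel_bounded c \<phi>"
  shows "(LINT y|(N \<bind> P). \<phi> y) = (LINT x|N. kernel_op P \<phi> x)"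
proof -
  interpret prob_space N by fact
  note \<phi>m = borel_bounded_measurable[OF \<phi>]
  have PN: "P \<in> N \<rightarrow>\<^sub>M subprob_algebra borel"
    using kernel_measurable by (simp add: measurable_cong_sets[OF N(2) refl])
  have "0 \<le> c" using borel_bounded_nonneg[OF \<phi>] .
  show ?thesis
    unfolding kernel_op_def
    by (rule integral_bind[where K=borel and B=c and B'=1])
       (use \<phi> \<phi>m PN kernel_prob in \<open>auto simp: borel_bounded_def prob_space.emeasure_space_1 intro!: finite_measure_axioms\<close>)
qed

lemma prob_kernel_pow: "prob_space (kernel_pow P n x) \<and> sets (kernel_pow P n x) = sets borel"
proof (induction n)
  case 0
  then show ?case by (auto intro: prob_space_return)
next
  case (Suc n)
  then have "kernel_pow P n x \<in> space (prob_algebra borel)" by (simp add: space_prob_algebra)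
  then show ?case
    using prob_space_bind'[OF _ P[unfolded markov_kernel_def]] sets_bind'[OF _ P[unfolded markov_kernel_def]]
    by simp
qed

lemma integral_kernel_pow:
  "borel_bounded c \<phi> \<Longrightarrow> (LINT y|kernel_pow P n x. \<phi> y) = (kernel_op P ^^ n) \<phi> x"
proof (induction n arbitrary: \<phi>)
  case 0
  then show ?case by (simp add: integral_return borel_bounded_measurable)
next
  case (Suc n)
  then show ?case
    using integral_bind_kernel[OF conjunct1[OF prob_kernel_pow] conjunct2[OF prob_kernel_pow], of c \<phi> n x]
      Suc.IH[OF kernel_op_bounded] by (simp add: funpow_swap1)
qed

end

section \<open>Reciprocals of power series with nonnegative coefficients\<close>

text \<open>
Convolving two sequences of order \<open>r\<^sup>n\<close> costs a factor \<open>n\<close>, which a slightly larger rate absorbs.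
\<close>

lemma geometric_convolution_bound:
  fixes r :: real
  assumes "0 < r" "r < 1"
  obtains C s where "0 \<le> C" "r < s" "s < 1" "\<And>n. real (Suc n) * r ^ n \<le> C * s ^ n"
proof -
  define s where "s = (1 + r) / 2"
  have s: "r < s" "s < 1" "0 < s" using assms by (auto simp: s_def)
  have "(\<lambda>n. real n * (r / s) ^ n) \<longlonglongrightarrow> 0"
    using s assms by (intro powser_times_n_limit_0) auto
  moreover have "(\<lambda>n. (r / s) ^ n) \<longlonglongrightarrow> 0"
    using s assms by (intro LIMSEQ_realpow_zero) auto
  ultimately have "(\<lambda>n. real n * (r / s) ^ n + (r / s) ^ n) \<longlonglongrightarrow> 0 + 0"
    by (rule tendsto_add)
  then have "Bseq (\<lambda>n. real n * (r / s) ^ n + (r / s) ^ n)"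
    by (rule convergent_imp_Bseq[OF convergentI])
  then obtain C where C: "\<And>n. norm (real n * (r / s) ^ n + (r / s) ^ n) \<le> C"
    unfolding Bseq_def by blast
  have "real (Suc n) * r ^ n \<le> C * s ^ n" for n
  proof -
    have "real (Suc n) * r ^ n = (real n * (r / s) ^ n + (r / s) ^ n) * s ^ n"
      using s by (simp add: power_divide field_simps)
    also have "\<dots> \<le> C * s ^ n"
      using C[of n] s by (intro mult_right_mono) auto
    finally show ?thesis .
  qed
  moreover have "0 \<le> C" using C[of 0] norm_ge_zero order_trans by blast
  ultimately show ?thesis using that s by blast
qed

lemma geometric_convolution_le:
  fixes a b :: "nat \<Rightarrow> real"
  assumes "\<And>k. \<bar>a k\<bar> \<le> A * r ^ k" "\<And>k. \<bar>b k\<bar> \<le> B * r ^ k"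
  shows "\<bar>\<Sum>k\<le>n. a k * b (n - k)\<bar> \<le> A * B * (real (Suc n) * r ^ n)"
proof -
  have "\<bar>\<Sum>k\<le>n. a k * b (n - k)\<bar> \<le> (\<Sum>k\<le>n. \<bar>a k\<bar> * \<bar>b (n - k)\<bar>)"
    by (rule order_trans[OF sum_abs]) (simp add: abs_mult)
  also have "\<dots> \<le> (\<Sum>k\<le>n. (A * r ^ k) * (B * r ^ (n - k)))"
  proof (rule sum_mono)
    fix k assume "k \<in> {..n}"
    show "\<bar>a k\<bar> * \<bar>b (n - k)\<bar> \<le> (A * r ^ k) * (B * r ^ (n - k))"
      by (rule mult_mono[OF assms(1) assms(2) order_trans[OF abs_ge_zero assms(1)]]) simp
  qed
  also have "\<dots> = (\<Sum>k\<le>n. A * B * r ^ n)"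
    by (intro sum.cong) (auto simp: power_add[symmetric] mult_ac)
  finally show ?thesis by (simp add: mult_ac)
qed

lemma geometric_tail_sums:
  fixes r :: real assumes "0 \<le> r" "r < 1"
  shows "(\<lambda>i. C * r ^ (i + n)) sums (C * r ^ n / (1 - r))"
  using sums_mult[OF geometric_sums[of r], of "C * r ^ n"] assms by (simp add: power_add mult_ac)

text \<open>
Kendall's renewal theorem in the language of power series. The series of \<open>g\<close> is analytic on a disc of
radius larger than \<open>1\<close>, and it has no zero on the closed unit disc, since there it is the reciprocal
of the absolutely convergent series of \<open>T\<close>. By compactness it has no zero on a slightly larger disc,
so its reciprocal is analytic there, and the coefficients \<open>T n\<close> decay geometrically.
\<close>

lemma reciprocal_power_series_decay:
  fixes T g :: "nat \<Rightarrow> real"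
  assumes T0: "\<And>n. 0 \<le> T n" and T: "summable T"
    and g: "\<And>n. \<bar>g n\<bar> \<le> c * \<rho> ^ n" and \<rho>: "0 < \<rho>" "\<rho> < 1"
    and conv: "\<And>n. (\<Sum>k\<le>n. g k * T (n - k)) = (if n = 0 then 1 else 0)"
  obtains C r where "0 < r" "r < 1" "\<And>n. T n \<le> C * r ^ n"
proof -
  define G where "G = Abs_fps (\<lambda>n. complex_of_real (g n))"
  define F where "F = Abs_fps (\<lambda>n. complex_of_real (T n))"
  have GF: "G * F = 1"
  proof (rule fps_ext)
    fix n
    have "fps_nth (G * F) n = complex_of_real (\<Sum>k\<le>n. g k * T (n - k))"
      by (simp add: fps_mult_nth G_def F_def atLeast0AtMost)
    then show "fps_nth (G * F) n = fps_nth 1 n" by (simp add: conv)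
  qed
  then have F_eq: "F = inverse G"
    by (metis fps_inverse_unique)
  have radG: "fps_conv_radius G \<ge> ereal (1 / \<rho>)"
  proof -
    have "summable (\<lambda>n. fps_nth G n * of_real x ^ n)" if x: "0 < x" "x < 1 / \<rho>" for x
    proof (rule summable_comparison_test'[of "\<lambda>n. c * (\<rho> * x) ^ n" 0])
      show "summable (\<lambda>n. c * (\<rho> * x) ^ n)"
        using x \<rho> by (intro summable_mult summable_geometric) (auto simp: field_simps abs_mult)
      fix n
      have "norm (fps_nth G n * of_real x ^ n) = \<bar>g n\<bar> * x ^ n"
        using x by (simp add: G_def norm_mult norm_power)
      also have "\<dots> \<le> (c * \<rho> ^ n) * x ^ n" using g x by (intro mult_right_mono) auto
      finally show "norm (fps_nth G n * of_real x ^ n) \<le> c * (\<rho> * x) ^ n"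
        by (simp add: power_mult_distrib)
    qed
    then show ?thesis unfolding fps_conv_radius_def
      by (intro conv_radius_geI_ex') auto
  qed
  have \<rho>1: "1 < 1 / \<rho>" using \<rho> by simp
  \<comment> \<open>No zero of \<open>G\<close> on the closed unit disc, because both series converge absolutely there.\<close>
  have nz: "eval_fps G z \<noteq> 0" if z: "norm z \<le> 1" for z
  proof -
    have sF: "summable (\<lambda>n. norm (fps_nth F n * z ^ n))"
    proof (rule summable_comparison_test'[OF T, of 0])
      fix n show "norm (norm (fps_nth F n * z ^ n)) \<le> T n"
        using z T0[of n] by (simp add: F_def norm_mult norm_power mult_left_le power_le_one)
    qed
    have "z \<in> eball 0 (fps_conv_radius G)"
    proof -
      have "ereal (norm z) < ereal (1 / \<rho>)" using z \<rho>1 by simp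
      also have "\<dots> \<le> fps_conv_radius G" by (rule radG)
      finally show ?thesis by (simp add: in_eball_iff)
    qed
    then have sG: "summable (\<lambda>n. norm (fps_nth G n * z ^ n))"
      unfolding fps_conv_radius_def by (intro abs_summable_in_conv_radius) (simp add: in_eball_iff)
    have "eval_fps G z * eval_fps F z = (\<Sum>n. \<Sum>i\<le>n. (fps_nth G i * z ^ i) * (fps_nth F (n - i) * z ^ (n - i)))"
      unfolding eval_fps_def by (rule Cauchy_product[OF sG sF])
    also have "\<dots> = (\<Sum>n. fps_nth (G * F) n * z ^ n)"
    proof (rule suminf_cong)
      fix n
      have "(\<Sum>i\<le>n. (fps_nth G i * z ^ i) * (fps_nth F (n - i) * z ^ (n - i)))
          = (\<Sum>i\<le>n. fps_nth G i * fps_nth F (n - i) * z ^ n)"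
        by (intro sum.cong) (auto simp: power_add[symmetric] mult_ac)
      then show "(\<Sum>i\<le>n. (fps_nth G i * z ^ i) * (fps_nth F (n - i) * z ^ (n - i))) = fps_nth (G * F) n * z ^ n"
        by (simp add: fps_mult_nth sum_distrib_right atLeast0AtMost)
    qed
    also have "\<dots> = 1"
      unfolding GF using powser_sums_if[of 0 z] by (simp add: sums_iff if_distrib if_distribR cong: if_cong)
    finally show ?thesis by auto
  qed
  obtain R where R: "1 < R" "R < 1 / \<rho>" "\<And>z. norm z < R \<Longrightarrow> eval_fps G z \<noteq> 0"
  proof -
    define U where "U = ball 0 (1 / \<rho>) \<inter> eval_fps G -` (- {0 :: complex})"
    have "ereal (dist 0 z) < fps_conv_radius G" if "dist 0 z < 1 / \<rho>" for z :: complex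
      by (rule less_le_trans[of _ "ereal (1 / \<rho>)"]) (use that radG in auto)
    then have "ball (0 :: complex) (1 / \<rho>) \<subseteq> eball 0 (fps_conv_radius G)"
      by (auto simp: in_eball_iff)
    then have "continuous_on (ball 0 (1 / \<rho>)) (eval_fps G)"
      by (rule continuous_on_subset[OF continuous_on_eval_fps])
    then have "open U" unfolding U_def
      by (intro continuous_open_preimage) auto
    moreover have "cball 0 1 \<subseteq> U"
      using nz \<rho>1 unfolding U_def by (auto simp: in_eball_iff)
    ultimately obtain e where e: "e > 0" "(\<Union>x\<in>cball 0 1. ball x e) \<subseteq> U"
      using compact_subset_open_imp_ball_epsilon_subset[of "cball 0 1" U] by auto
    define R where "R = min (1 + e / 2) ((1 + 1 / \<rho>) / 2)"
    have "1 < R" "R < 1 / \<rho>" using e \<rho>1 by (auto simp: R_def min_def field_simps)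
    moreover have "eval_fps G z \<noteq> 0" if "norm z < R" for z
    proof (cases "norm z \<le> 1")
      case False
      have "z \<in> ball (z / of_real (norm z)) e"
      proof -
        have "complex_of_real (norm z) \<noteq> 0" using False by auto
        then have "z - z / of_real (norm z) = (z / of_real (norm z)) * of_real (norm z - 1)"
          by (simp add: field_simps)
        then have "norm (z - z / of_real (norm z)) = norm z - 1"
          using False \<open>complex_of_real (norm z) \<noteq> 0\<close> by (simp add: norm_mult norm_divide del: of_real_diff)
        then show ?thesis using that e(1) unfolding R_def by (simp add: dist_norm norm_minus_commute)
      qed
      moreover have "z / of_real (norm z) \<in> cball 0 1" using False by (simp add: norm_divide)
      ultimately have "z \<in> U" using e(2) by blast
      then show ?thesis by (simp add: U_def)
    qed (use nz in auto)
    ultimately show thesis using that by blast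
  qed
  have "fps_conv_radius (inverse G) \<ge> min (ereal R) (fps_conv_radius G)"
    by (rule fps_conv_radius_inverse) (use R(3) in auto)
  moreover have "min (ereal R) (fps_conv_radius G) \<ge> ereal R"
    using R(2) radG by (simp add: min_def) (metis ereal_less_eq(3) less_imp_le order_trans)
  ultimately have radF: "fps_conv_radius F \<ge> ereal R" unfolding F_eq by (rule order_trans[rotated])
  define s where "s = (1 + R) / 2"
  have s: "1 < s" "s < R" using R by (auto simp: s_def)
  have "summable (\<lambda>n. fps_nth F n * of_real s ^ n)"
    using radF s unfolding fps_conv_radius_def
    by (intro summable_in_conv_radius) (auto intro: less_le_trans[of _ "ereal R"])
  then have "(\<lambda>n. fps_nth F n * of_real s ^ n) \<longlonglongrightarrow> 0" by (rule summable_LIMSEQ_zero)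
  then have "Bseq (\<lambda>n. fps_nth F n * of_real s ^ n)" by (rule convergent_imp_Bseq[OF convergentI])
  then obtain C where C: "\<And>n. norm (fps_nth F n * of_real s ^ n) \<le> C" unfolding Bseq_def by blast
  have "T n \<le> C * (1 / s) ^ n" for n
  proof -
    have "T n * s ^ n \<le> C"
      using C[of n] T0[of n] s by (simp add: F_def norm_mult norm_power)
    then show ?thesis using s by (simp add: field_simps power_divide)
  qed
  then show thesis using that[of "1 / s" C] s by auto
qed

section \<open>Regeneration and geometric ergodicity in mean\<close>

text \<open>
Splitting \<open>P = Q + h \<otimes> \<nu>\<close> lets the chain forget its state: at each step it regenerates with
probability \<open>h(x)\<close>, that is, it restarts from \<open>\<nu>\<close>. All quantities of renewal theory can be written with
the positive operator \<open>Q\<close>, so the regeneration times never appear as random variables.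
\<close>

locale minorised_kernel =
  fixes P :: "real \<Rightarrow> real measure" and \<nu> \<mu> :: "real measure" and h :: "real \<Rightarrow> real"
  assumes P: "markov_kernel P"
    and \<nu>: "prob_space \<nu>" "sets \<nu> = sets borel"
    and \<mu>: "prob_space \<mu>" "sets \<mu> = sets borel"
    and h_measurable: "h \<in> borel_measurable borel" and h01: "\<And>x. 0 \<le> h x" "\<And>x. h x \<le> 1"
    and minorisation: "\<And>c \<phi> x. borel_bounded c \<phi> \<Longrightarrow> (\<And>y. 0 \<le> \<phi> y) \<Longrightarrow>
      h x * (LINT y|\<nu>. \<phi> y) \<le> kernel_op P \<phi> x"
    and stationary: "\<And>c \<phi>. borel_bounded c \<phi> \<Longrightarrow> (LINT x|\<mu>. kernel_op P \<phi> x) = (LINT x|\<mu>. \<phi> x)"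
begin

text \<open>
The operator \<open>Q\<close>: one step of the chain on the event that it does not regenerate.
\<close>

definition residual :: "(real \<Rightarrow> real) \<Rightarrow> real \<Rightarrow> real" where
  "residual \<phi> x = kernel_op P \<phi> x - h x * (LINT y|\<nu>. \<phi> y)"

text \<open>
The probability, from the state \<open>x\<close>, that no regeneration happens in the first \<open>n\<close> steps;
\<open>tail n\<close> is this probability just after a regeneration, and \<open>renewal n\<close> is the probability of a
regeneration exactly \<open>n\<close> steps after another one.
\<close>

definition survival :: "nat \<Rightarrow> real \<Rightarrow> real" where
  "survival n = (residual ^^ n) (\<lambda>_. 1)"

definition tail :: "nat \<Rightarrow> real" where
  "tail n = (LINT x|\<nu>. survival n x)"

definition renewal :: "nat \<Rightarrow> real" where
  "renewal n = (case n of 0 \<Rightarrow> 1 | Suc k \<Rightarrow> (LINT x|\<nu>. (kernel_op P ^^ k) h x))"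

lemmas nu_integrable = integrable_borel_bounded[OF \<nu>]
lemmas mu_integrable = integrable_borel_bounded[OF \<mu>]
lemmas P_bounded = kernel_op_bounded[OF P]
lemmas P_pow_bounded = kernel_op_pow_bounded[OF P]

lemma h_bounded: "borel_bounded 1 h"
  by (rule borel_boundedI) (use h_measurable h01 in \<open>auto simp: abs_le_iff intro: order_trans[of _ 0]\<close>)

text \<open>
Minorisation applied to the nonnegative functions \<open>c - \<phi>\<close> and \<open>c + \<phi>\<close>.
\<close>

lemma residual_abs_le: assumes "borel_bounded c \<phi>" shows "\<bar>residual \<phi> x\<bar> \<le> c * (1 - h x)"
proof -
  have c: "borel_bounded \<bar>c\<bar> (\<lambda>_. c)" by (rule borel_bounded_const)
  have 1: "h x * (LINT y|\<nu>. c - \<phi> y) \<le> kernel_op P (\<lambda>y. c - \<phi> y) x"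
    by (rule minorisation[OF borel_bounded_diff[OF c assms]])
       (use borel_bounded_abs_le[OF assms] in \<open>auto simp: abs_le_iff\<close>)
  have 2: "h x * (LINT y|\<nu>. c + \<phi> y) \<le> kernel_op P (\<lambda>y. c + \<phi> y) x"
    by (rule minorisation[OF borel_bounded_add[OF c assms]])
       (metis borel_bounded_abs_le[OF assms] abs_le_iff add.commute neg_le_iff_le add_increasing2 diff_ge_0_iff_ge diff_minus_eq_add minus_minus uminus_add_conv_diff)
  have "(LINT y|\<nu>. c - \<phi> y) = c - (LINT y|\<nu>. \<phi> y)" "(LINT y|\<nu>. c + \<phi> y) = c + (LINT y|\<nu>. \<phi> y)"
    using nu_integrable[OF assms] prob_space.prob_space[OF \<nu>(1)] prob_space.finite_measure[OF \<nu>(1)]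
    by (simp_all add: finite_measure.integrable_const)
  moreover have "kernel_op P (\<lambda>y. c - \<phi> y) x = c - kernel_op P \<phi> x"
    "kernel_op P (\<lambda>y. c + \<phi> y) x = c + kernel_op P \<phi> x"
    using integrable_borel_bounded[OF kernel_prob[OF P] kernel_sets[OF P] assms]
      prob_space.prob_space[OF kernel_prob[OF P]] prob_space.finite_measure[OF kernel_prob[OF P]]
    unfolding kernel_op_def by (simp_all add: finite_measure.integrable_const)
  ultimately have "h x * (c - (LINT y|\<nu>. \<phi> y)) \<le> c - kernel_op P \<phi> x"
    "h x * (c + (LINT y|\<nu>. \<phi> y)) \<le> c + kernel_op P \<phi> x"
    using 1 2 by metis+
  then show ?thesis unfolding residual_def by (auto simp: algebra_simps abs_le_iff)
qed

lemma residual_bounded: assumes "borel_bounded c \<phi>" shows "borel_bounded c (residual \<phi>)"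
proof (rule borel_boundedI)
  show "residual \<phi> \<in> borel_measurable borel"
    unfolding residual_def using borel_bounded_measurable[OF P_bounded[OF assms]] h_measurable by measurable
  show "\<bar>residual \<phi> x\<bar> \<le> c" for x
    by (rule order_trans[OF residual_abs_le[OF assms]])
       (use borel_bounded_nonneg[OF assms] h01[of x] in \<open>simp add: mult_left_le\<close>)
qed

lemma residual_pow_bounded: "borel_bounded c \<phi> \<Longrightarrow> borel_bounded c ((residual ^^ n) \<phi>)"
  by (induction n) (auto intro: residual_bounded)

lemma residual_sum:
  assumes "\<And>j. j \<in> J \<Longrightarrow> borel_bounded (c j) (\<phi> j)"
  shows "residual (\<lambda>x. \<Sum>j\<in>J. a j * \<phi> j x) x = (\<Sum>j\<in>J. a j * residual (\<phi> j) x)"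
proof -
  have "(LINT y|\<nu>. (\<Sum>j\<in>J. a j * \<phi> j y)) = (\<Sum>j\<in>J. a j * (LINT y|\<nu>. \<phi> j y))"
    by (subst Bochner_Integration.integral_sum) (use nu_integrable[OF assms] in auto)
  then show ?thesis
    using kernel_op_pow_sum[OF P, of J c \<phi> 1 a] assms
    by (simp add: residual_def sum_subtractf right_diff_distrib sum_distrib_left mult_ac)
qed

lemma residual_add:
  assumes "borel_bounded c \<phi>" "borel_bounded d \<psi>"
  shows "residual (\<lambda>x. \<phi> x + \<psi> x) x = residual \<phi> x + residual \<psi> x"
  using kernel_op_add[OF P assms] nu_integrable[OF assms(1)] nu_integrable[OF assms(2)]
  by (simp add: residual_def algebra_simps)

lemma residual_nonneg: "borel_bounded c \<phi> \<Longrightarrow> (\<And>y. 0 \<le> \<phi> y) \<Longrightarrow> 0 \<le> residual \<phi> x"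
  using minorisation by (simp add: residual_def)

lemma residual_mono:
  assumes "borel_bounded c \<phi>" "borel_bounded d \<psi>" "\<And>y. \<phi> y \<le> \<psi> y"
  shows "residual \<phi> x \<le> residual \<psi> x"
proof -
  have b: "borel_bounded (d + c) (\<lambda>x. \<psi> x - \<phi> x)" by (rule borel_bounded_diff[OF assms(2,1)])
  have "residual (\<lambda>y. \<phi> y + (\<psi> y - \<phi> y)) x = residual \<phi> x + residual (\<lambda>y. \<psi> y - \<phi> y) x"
    by (rule residual_add[OF assms(1) b])
  moreover have "0 \<le> residual (\<lambda>y. \<psi> y - \<phi> y) x" by (rule residual_nonneg[OF b]) (use assms in auto)
  ultimately show ?thesis by simp
qed

lemma residual_cmult: "residual (\<lambda>x. a * \<phi> x) x = a * residual \<phi> x"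
  by (simp add: residual_def kernel_op_cmult[OF P] algebra_simps)

lemma survival_bounded: "borel_bounded 1 (survival n)"
  unfolding survival_def by (rule residual_pow_bounded) (use borel_bounded_const[of 1] in simp)

lemma survival_Suc: "survival (Suc n) = residual (survival n)"
  by (simp add: survival_def)

lemma survival_nonneg: "0 \<le> survival n x"
proof (induction n arbitrary: x)
  case (Suc n)
  then show ?case unfolding survival_Suc by (intro residual_nonneg[OF survival_bounded])
qed (simp add: survival_def)

lemma residual_pow_abs_le:
  assumes "borel_bounded c \<phi>" shows "\<bar>(residual ^^ n) \<phi> x\<bar> \<le> c * survival n x"
proof (induction n arbitrary: x)
  case 0
  then show ?case using borel_bounded_abs_le[OF assms] by (simp add: survival_def)
next
  case (Suc n)
  note b = residual_pow_bounded[OF assms, of n] and s = borel_bounded_cmult[OF survival_bounded, of c n]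
  have "residual ((residual ^^ n) \<phi>) x \<le> residual (\<lambda>x. c * survival n x) x"
    by (rule residual_mono[OF b s]) (use Suc abs_le_iff in blast)
  moreover have "residual (\<lambda>x. (- 1) * (residual ^^ n) \<phi> x) x \<le> residual (\<lambda>x. c * survival n x) x"
    by (rule residual_mono[OF borel_bounded_cmult[OF b] s]) (use Suc abs_le_iff in auto)
  ultimately show ?case unfolding residual_cmult by (simp add: survival_Suc abs_le_iff)
qed

text \<open>
Decomposition of the path at its first regeneration, at time \<open>j + 1\<close>; up to then the chain moves
by \<open>Q\<close>, and afterwards it is a fresh chain started from \<open>\<nu>\<close>.
\<close>

lemma first_regeneration:
  assumes \<phi>: "borel_bounded c \<phi>"
  shows "(kernel_op P ^^ n) \<phi> x =
    (residual ^^ n) \<phi> x + (\<Sum>j<n. (LINT y|\<nu>. (kernel_op P ^^ (n - 1 - j)) \<phi> y) * (residual ^^ j) h x)"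
proof (induction n arbitrary: x)
  case (Suc n)
  define a where "a = (\<lambda>k. LINT y|\<nu>. (kernel_op P ^^ k) \<phi> y)"
  have b: "borel_bounded (\<Sum>j<n. \<bar>a (n - 1 - j)\<bar> * 1) (\<lambda>x. \<Sum>j<n. a (n - 1 - j) * (residual ^^ j) h x)"
    by (intro borel_bounded_sum borel_bounded_cmult residual_pow_bounded h_bounded)
  have "(kernel_op P ^^ Suc n) \<phi> x = residual ((kernel_op P ^^ n) \<phi>) x + a n * h x"
    by (simp add: residual_def a_def)
  also have "(kernel_op P ^^ n) \<phi> = (\<lambda>x. (residual ^^ n) \<phi> x + (\<Sum>j<n. a (n - 1 - j) * (residual ^^ j) h x))"
    using Suc by (simp add: a_def fun_eq_iff)
  also have "residual \<dots> x = (residual ^^ Suc n) \<phi> x + (\<Sum>j<n. a (n - 1 - j) * (residual ^^ Suc j) h x)"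
    by (subst residual_add[OF residual_pow_bounded[OF \<phi>] b])
       (simp add: residual_sum[OF residual_pow_bounded[OF h_bounded]])
  also have "\<dots> + a n * h x = (residual ^^ Suc n) \<phi> x + (\<Sum>j<Suc n. a (Suc n - 1 - j) * (residual ^^ j) h x)"
    by (subst sum.lessThan_Suc_shift) simp
  finally show ?case by (simp add: a_def)
qed simp

text \<open>
Decomposition at the last regeneration before time \<open>n\<close>. Integrating it against \<open>\<nu>\<close> gives the
renewal equation.
\<close>

lemma last_regeneration:
  assumes \<phi>: "borel_bounded c \<phi>"
  shows "(kernel_op P ^^ n) \<phi> x =
    (residual ^^ n) \<phi> x + (\<Sum>j<n. (LINT y|\<nu>. (residual ^^ (n - 1 - j)) \<phi> y) * (kernel_op P ^^ j) h x)"
proof (induction n arbitrary: x)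
  case (Suc n)
  define a where "a = (\<lambda>k. LINT y|\<nu>. (residual ^^ k) \<phi> y)"
  note bP = kernel_op_pow_bounded[OF P h_bounded]
  have b: "borel_bounded (\<Sum>j<n. \<bar>a (n - 1 - j)\<bar> * 1) (\<lambda>x. \<Sum>j<n. a (n - 1 - j) * (kernel_op P ^^ j) h x)"
    by (intro borel_bounded_sum borel_bounded_cmult bP)
  have "(kernel_op P ^^ n) \<phi> = (\<lambda>x. (residual ^^ n) \<phi> x + (\<Sum>j<n. a (n - 1 - j) * (kernel_op P ^^ j) h x))"
    using Suc by (simp add: a_def fun_eq_iff)
  then have "(kernel_op P ^^ Suc n) \<phi> x
      = kernel_op P (\<lambda>x. (residual ^^ n) \<phi> x + (\<Sum>j<n. a (n - 1 - j) * (kernel_op P ^^ j) h x)) x"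
    by simp
  also have "\<dots> = kernel_op P ((residual ^^ n) \<phi>) x + (\<Sum>j<n. a (n - 1 - j) * (kernel_op P ^^ Suc j) h x)"
    using kernel_op_add[OF P residual_pow_bounded[OF \<phi>, of n] b]
      kernel_op_pow_sum[OF P, where J="{..<n}" and c="\<lambda>_. 1" and \<phi>="\<lambda>j. (kernel_op P ^^ j) h"
        and a="\<lambda>j. a (n - 1 - j)" and n=1] bP by simp
  also have "kernel_op P ((residual ^^ n) \<phi>) x = (residual ^^ Suc n) \<phi> x + a n * h x"
    by (simp add: residual_def a_def)
  also have "(residual ^^ Suc n) \<phi> x + a n * h x + (\<Sum>j<n. a (n - 1 - j) * (kernel_op P ^^ Suc j) h x)
      = (residual ^^ Suc n) \<phi> x + (\<Sum>j<Suc n. a (Suc n - 1 - j) * (kernel_op P ^^ j) h x)"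
    by (subst sum.lessThan_Suc_shift) simp
  finally show ?case by (simp add: a_def)
qed simp

lemma nu_kernel_pow:
  assumes \<phi>: "borel_bounded c \<phi>"
  shows "(LINT x|\<nu>. (kernel_op P ^^ n) \<phi> x) = (\<Sum>k\<le>n. renewal k * (LINT x|\<nu>. (residual ^^ (n - k)) \<phi> x))"
proof -
  have "(LINT x|\<nu>. (kernel_op P ^^ n) \<phi> x) = (LINT x|\<nu>. (residual ^^ n) \<phi> x)
      + (\<Sum>j<n. (LINT x|\<nu>. (residual ^^ (n - 1 - j)) \<phi> x) * (LINT x|\<nu>. (kernel_op P ^^ j) h x))"
    unfolding last_regeneration[OF \<phi>, abs_def]
    using nu_integrable[OF residual_pow_bounded[OF \<phi>]] nu_integrable[OF P_pow_bounded[OF h_bounded]]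
    by (subst Bochner_Integration.integral_add) (auto intro!: Bochner_Integration.integral_sum simp: Bochner_Integration.integral_sum)
  also have "\<dots> = (\<Sum>k<Suc n. renewal k * (LINT x|\<nu>. (residual ^^ (n - k)) \<phi> x))"
    by (subst sum.lessThan_Suc_shift) (simp add: renewal_def mult.commute)
  finally show ?thesis by (simp add: lessThan_Suc_atMost)
qed

lemma renewal_equation: "(\<Sum>k\<le>n. renewal k * tail (n - k)) = 1"
  using nu_kernel_pow[of 1 "\<lambda>_. 1" n] borel_bounded_const[of 1] prob_space.prob_space[OF \<nu>(1)]
  by (simp add: kernel_op_pow_const[OF P] tail_def survival_def)

lemma tail_nonneg: "0 \<le> tail n"
  unfolding tail_def by (rule Bochner_Integration.integral_nonneg) (rule survival_nonneg)

text \<open>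
Stationarity reads \<open>\<mu> = \<mu>Q + \<mu>(h) \<nu>\<close>. Iterating it expresses \<open>\<mu>\<close> through the excursions
between regenerations.
\<close>

lemma mu_split:
  assumes \<phi>: "borel_bounded c \<phi>"
  shows "(LINT x|\<mu>. \<phi> x) = (LINT x|\<mu>. residual \<phi> x) + (LINT x|\<mu>. h x) * (LINT x|\<nu>. \<phi> x)"
  unfolding residual_def
  using mu_integrable[OF P_bounded[OF \<phi>]] mu_integrable[OF h_bounded] by (simp add: stationary[OF \<phi>])

lemma mu_residual_pow:
  assumes \<phi>: "borel_bounded c \<phi>"
  shows "(LINT x|\<mu>. \<phi> x) = (LINT x|\<mu>. (residual ^^ n) \<phi> x)
    + (LINT x|\<mu>. h x) * (\<Sum>i<n. (LINT x|\<nu>. (residual ^^ i) \<phi> x))"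
proof (induction n)
  case (Suc n)
  then show ?case using mu_split[OF residual_pow_bounded[OF \<phi>, of n]] by (simp add: algebra_simps)
qed simp


lemma nu_residual_pow_abs_le:
  assumes "borel_bounded B \<phi>" shows "\<bar>LINT x|\<nu>. (residual ^^ n) \<phi> x\<bar> \<le> B * tail n"
proof -
  have "\<bar>LINT x|\<nu>. (residual ^^ n) \<phi> x\<bar> \<le> (LINT x|\<nu>. \<bar>(residual ^^ n) \<phi> x\<bar>)"
    using integral_norm_bound[of \<nu> "(residual ^^ n) \<phi>"] by simp
  also have "\<dots> \<le> (LINT x|\<nu>. B * survival n x)"
    using nu_integrable[OF residual_pow_bounded[OF assms]] nu_integrable[OF survival_bounded]
      residual_pow_abs_le[OF assms] by (intro integral_mono) auto
  finally show ?thesis by (simp add: tail_def)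
qed

lemma mu_residual_pow_abs_le:
  assumes "borel_bounded B \<phi>" shows "\<bar>LINT x|\<mu>. (residual ^^ n) \<phi> x\<bar> \<le> B * (LINT x|\<mu>. survival n x)"
proof -
  have "\<bar>LINT x|\<mu>. (residual ^^ n) \<phi> x\<bar> \<le> (LINT x|\<mu>. \<bar>(residual ^^ n) \<phi> x\<bar>)"
    using integral_norm_bound[of \<mu> "(residual ^^ n) \<phi>"] by simp
  also have "\<dots> \<le> (LINT x|\<mu>. B * survival n x)"
    using mu_integrable[OF residual_pow_bounded[OF assms]] mu_integrable[OF survival_bounded]
      residual_pow_abs_le[OF assms] by (intro integral_mono) auto
  finally show ?thesis by simp
qed

lemma mu_survival_eq:
  "(LINT x|\<mu>. survival n x) = 1 - (LINT x|\<mu>. h x) * (\<Sum>i<n. tail i)"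
  using mu_residual_pow[of 1 "\<lambda>_. 1" n] borel_bounded_const[of 1]
    prob_space.prob_space[OF \<mu>(1)]
  by (simp add: tail_def survival_def)

context
  fixes c \<rho> :: real
  assumes charged: "0 < (LINT x|\<mu>. h x)"
    and \<rho>: "0 < \<rho>" "\<rho> < 1"
    and hits_converge: "\<And>n. \<bar>(LINT x|\<nu>. (kernel_op P ^^ n) h x) - (LINT x|\<mu>. h x)\<bar> \<le> c * \<rho> ^ n"
begin

text \<open>
The correction of the constant accounts for \<open>renewal 0 = 1\<close> and for the shift by one step between
the renewal sequence and the powers of \<open>P\<close>.
\<close>

lemma renewal_limit: "\<exists>A\<ge>0. \<forall>n. \<bar>renewal n - (LINT x|\<mu>. h x)\<bar> \<le> A * \<rho> ^ n"
proof (intro exI[of _ "1 + c / \<rho>"] conjI allI)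
  have c: "0 \<le> c" using hits_converge[of 0] by simp
  then show "0 \<le> 1 + c / \<rho>" using \<rho> by simp
  fix n
  have "0 \<le> (LINT x|\<mu>. h x)" "(LINT x|\<mu>. h x) \<le> 1"
    using charged abs_integral_borel_bounded[OF \<mu> h_bounded] by auto
  then show "\<bar>renewal n - (LINT x|\<mu>. h x)\<bar> \<le> (1 + c / \<rho>) * \<rho> ^ n"
  proof (cases n)
    case 0
    moreover have "0 \<le> c / \<rho>" using c \<rho> by simp
    ultimately show ?thesis using \<open>0 \<le> (LINT x|\<mu>. h x)\<close> \<open>(LINT x|\<mu>. h x) \<le> 1\<close>
      by (simp add: renewal_def abs_le_iff)
  next
    case (Suc k)
    then show ?thesis using hits_converge[of k] \<rho>
      by (auto simp: renewal_def algebra_simps intro: add_increasing)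
  qed
qed

lemma tail_summable: "summable tail"
proof (rule summableI_nonneg_bounded[where x="1 / (LINT x|\<mu>. h x)"])
  show "0 \<le> tail n" for n by (rule tail_nonneg)
  show "(\<Sum>i<n. tail i) \<le> 1 / (LINT x|\<mu>. h x)" for n
  proof -
    have "0 \<le> (LINT x|\<mu>. survival n x)" by (rule Bochner_Integration.integral_nonneg) (rule survival_nonneg)
    then have "(LINT x|\<mu>. h x) * (\<Sum>i<n. tail i) \<le> 1" using mu_survival_eq[of n] by linarith
    then show ?thesis using charged by (simp add: field_simps)
  qed
qed

text \<open>
The generating function of \<open>tail\<close> is the reciprocal of that of the increments of \<open>renewal\<close>, which
are geometrically small. Evaluating both at \<open>1\<close> gives \<open>\<mu>(h) \<Sum> tail = 1\<close>: excursions carry the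
whole mass of \<open>\<mu>\<close>. So the mass under \<open>\<mu>\<close> of a long excursion is the tail of a geometric series.
\<close>

lemma survival_decay:
  obtains A r where "0 \<le> A" "\<rho> \<le> r" "r < 1" "\<And>n. tail n \<le> A * r ^ n"
    "\<And>n. (LINT x|\<mu>. survival n x) \<le> A * r ^ n" "\<And>n. \<bar>renewal n - (LINT x|\<mu>. h x)\<bar> \<le> A * r ^ n"
proof -
  define u where "u = (LINT x|\<mu>. h x)"
  have u: "0 < u" using charged by (simp add: u_def)
  obtain A0 where A0: "0 \<le> A0" "\<And>n. \<bar>renewal n - u\<bar> \<le> A0 * \<rho> ^ n"
    using renewal_limit unfolding u_def by blast
  \<comment> \<open>The coefficients of \<open>(1 - z) U(z)\<close>, where \<open>U\<close> is the generating function of \<open>renewal\<close>; the renewal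
    equation says that \<open>(1 - z) U(z)\<close> times the generating function of \<open>tail\<close> is \<open>1\<close>.\<close>
  define g where "g = (\<lambda>n. case n of 0 \<Rightarrow> 1 | Suc k \<Rightarrow> renewal (Suc k) - renewal k)"
  define c' where "c' = 1 + A0 * (1 + 1 / \<rho>)"
  have g_bound: "\<bar>g n\<bar> \<le> c' * \<rho> ^ n" for n
  proof (cases n)
    case 0
    then show ?thesis using A0 \<rho> by (simp add: g_def c'_def)
  next
    case (Suc k)
    have "\<bar>g n\<bar> \<le> A0 * \<rho> ^ Suc k + A0 * \<rho> ^ k"
      using A0(2)[of "Suc k"] A0(2)[of k] unfolding Suc g_def by (simp add: abs_le_iff)
    also have "\<dots> = A0 * (1 + 1 / \<rho>) * \<rho> ^ n" using \<rho> Suc by (simp add: field_simps)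
    also have "\<dots> \<le> c' * \<rho> ^ n" using \<rho> by (simp add: c'_def)
    finally show ?thesis .
  qed
  have conv: "(\<Sum>k\<le>n. g k * tail (n - k)) = (if n = 0 then 1 else 0)" for n
  proof (cases n)
    case 0
    then show ?thesis using renewal_equation[of 0] by (simp add: g_def renewal_def)
  next
    case (Suc m)
    have "(\<Sum>k\<le>Suc m. g k * tail (Suc m - k))
        = tail (Suc m) + (\<Sum>k\<le>m. (renewal (Suc k) - renewal k) * tail (m - k))"
      by (subst sum.atMost_Suc_shift) (simp add: g_def)
    also have "\<dots> = (tail (Suc m) + (\<Sum>k\<le>m. renewal (Suc k) * tail (m - k))) - (\<Sum>k\<le>m. renewal k * tail (m - k))"
      by (simp add: sum_subtractf left_diff_distrib)
    also have "tail (Suc m) + (\<Sum>k\<le>m. renewal (Suc k) * tail (m - k)) = (\<Sum>k\<le>Suc m. renewal k * tail (Suc m - k))"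
      by (subst sum.atMost_Suc_shift) (simp add: renewal_def)
    finally show ?thesis using Suc by (simp only: renewal_equation) simp
  qed
  obtain C r where r: "0 < r" "r < 1" "\<And>n. tail n \<le> C * r ^ n"
    using reciprocal_power_series_decay[OF tail_nonneg tail_summable g_bound \<rho> conv] by blast
  have C: "0 \<le> C" using r(3)[of 0] tail_nonneg[of 0] by simp
  have "(\<Sum>n. tail n) * u = 1"
  proof -
    have g_sum: "g sums u"
    proof -
      have "(\<Sum>i<Suc n. g i) = renewal n" for n
        by (induction n) (simp_all add: g_def renewal_def)
      moreover have "renewal \<longlonglongrightarrow> u"
      proof (rule LIM_zero_cancel, rule Lim_null_comparison)
        show "\<forall>\<^sub>F n in sequentially. norm (renewal n - u) \<le> A0 * \<rho> ^ n" using A0 by simp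
        show "(\<lambda>n. A0 * \<rho> ^ n) \<longlonglongrightarrow> 0"
          using \<rho> by (intro tendsto_mult_right_zero LIMSEQ_realpow_zero) auto
      qed
      ultimately have "(\<lambda>n. \<Sum>i<Suc n. g i) \<longlonglongrightarrow> u" by simp
      then show ?thesis unfolding sums_def by (rule LIMSEQ_imp_Suc)
    qed
    have "summable (\<lambda>n. norm (g n))"
      by (rule summable_comparison_test'[of "\<lambda>n. c' * \<rho> ^ n" 0])
         (use g_bound \<rho> in \<open>auto intro!: summable_mult summable_geometric\<close>)
    moreover have "summable (\<lambda>n. norm (tail n))" using tail_summable tail_nonneg by simp
    ultimately have "(\<Sum>n. g n) * (\<Sum>n. tail n) = (\<Sum>n. \<Sum>k\<le>n. g k * tail (n - k))"
      by (rule Cauchy_product)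
    also have "\<dots> = 1" unfolding conv using sums_single[of 0 "\<lambda>_. 1 :: real"] by (simp add: sums_iff)
    finally show ?thesis using g_sum by (simp add: sums_iff mult.commute)
  qed
  then have mu_surv: "(LINT x|\<mu>. survival n x) \<le> u * C / (1 - r) * r ^ n" for n
  proof -
    have "(LINT x|\<mu>. survival n x) = u * (\<Sum>i. tail (i + n))"
      using mu_survival_eq[of n] \<open>(\<Sum>n. tail n) * u = 1\<close> suminf_minus_initial_segment[OF tail_summable, of n]
      unfolding u_def by (simp add: right_diff_distrib mult.commute)
    also have "(\<Sum>i. tail (i + n)) \<le> C * r ^ n / (1 - r)"
    proof -
      have sums: "(\<lambda>i. C * r ^ (i + n)) sums (C * r ^ n / (1 - r))"
        using r by (intro geometric_tail_sums) auto
      have "(\<Sum>i. tail (i + n)) \<le> (\<Sum>i. C * r ^ (i + n))"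
        by (rule suminf_le) (use r sums tail_summable in \<open>auto simp: sums_iff summable_iff_shift\<close>)
      then show ?thesis using sums by (simp add: sums_iff)
    qed
    finally show ?thesis using u by (simp add: field_simps)
  qed
  define s where "s = max r \<rho>"
  define A where "A = C + u * C / (1 - r) + A0"
  have pos: "0 \<le> u * C / (1 - r)" using u C r by simp
  have s: "\<rho> \<le> s" "r \<le> s" "s < 1" "0 < s" using r \<rho> by (auto simp: s_def)
  have pow: "r ^ n \<le> s ^ n" "\<rho> ^ n \<le> s ^ n" for n using s r \<rho> by (auto intro!: power_mono)
  have le: "B * q ^ n \<le> A * s ^ n" if "0 \<le> B" "B \<le> A" "q ^ n \<le> s ^ n" "0 \<le> q" for B q n
    using that s by (intro mult_mono) auto
  show thesis
  proof (rule that[of A s])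
    show "tail n \<le> A * s ^ n" for n
      by (rule order_trans[OF r(3) le]) (use pos C A0 pow r in \<open>auto simp: A_def\<close>)
    show "(LINT x|\<mu>. survival n x) \<le> A * s ^ n" for n
      by (rule order_trans[OF mu_surv le]) (use pos C A0 pow r in \<open>auto simp: A_def\<close>)
    show "\<bar>renewal n - (LINT x|\<mu>. h x)\<bar> \<le> A * s ^ n" for n
      unfolding u_def[symmetric]
      by (rule order_trans[OF A0(2) le]) (use pos C A0 pow \<rho> in \<open>auto simp: A_def\<close>)
  qed (use pos C A0 s in \<open>auto simp: A_def\<close>)
qed

text \<open>
Both \<open>\<nu>P\<^sup>n\<close> and \<open>\<mu>\<close> are mixtures of excursion laws, with weights \<open>renewal k\<close> and \<open>\<mu>(h)\<close>. Their
difference is a convolution of two geometrically small sequences plus an excursion longer than \<open>n\<close>.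
\<close>

lemma nu_kernel_pow_convergence:
  obtains A r where "0 \<le> A" "0 < r" "r < 1"
    "\<And>n. (LINT x|\<mu>. survival n x) \<le> A * r ^ n"
    "\<And>B \<phi> n. borel_bounded B \<phi> \<Longrightarrow> \<bar>(LINT x|\<nu>. (kernel_op P ^^ n) \<phi> x) - (LINT x|\<mu>. \<phi> x)\<bar> \<le> B * (A * r ^ n)"
proof -
  define u where "u = (LINT x|\<mu>. h x)"
  obtain A0 r where r: "0 \<le> A0" "\<rho> \<le> r" "r < 1" "\<And>n. tail n \<le> A0 * r ^ n"
    "\<And>n. (LINT x|\<mu>. survival n x) \<le> A0 * r ^ n" "\<And>n. \<bar>renewal n - u\<bar> \<le> A0 * r ^ n"
    using survival_decay unfolding u_def by blast
  have r0: "0 < r" using r \<rho> by auto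
  obtain C s where s: "0 \<le> C" "r < s" "s < 1" "\<And>n. real (Suc n) * r ^ n \<le> C * s ^ n"
    using geometric_convolution_bound[OF r0 r(3)] by blast
  define A where "A = A0 * A0 * C + A0"
  have rs: "r ^ n \<le> s ^ n" for n using r0 s by (intro power_mono) auto
  show thesis
  proof (rule that[of A s])
    show "0 \<le> A" using r s by (simp add: A_def)
    show "0 < s" "s < 1" using s r0 by auto
    fix n
    have "(LINT x|\<mu>. survival n x) \<le> A0 * s ^ n"
      using r(5)[of n] mult_left_mono[OF rs r(1), of n] by linarith
    also have "\<dots> \<le> A * s ^ n" using r s r0 by (intro mult_right_mono) (auto simp: A_def)
    finally show "(LINT x|\<mu>. survival n x) \<le> A * s ^ n" .
    fix B \<phi> assume \<phi>: "borel_bounded B \<phi>"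
    have B: "0 \<le> B" using borel_bounded_nonneg[OF \<phi>] .
    define q where "q = (\<lambda>i. LINT x|\<nu>. (residual ^^ i) \<phi> x)"
    have q: "\<bar>q i\<bar> \<le> (B * A0) * r ^ i" for i
      using nu_residual_pow_abs_le[OF \<phi>, of i] mult_left_mono[OF r(4) B, of i] by (simp add: q_def mult.assoc)
    have "(LINT x|\<nu>. (kernel_op P ^^ n) \<phi> x) - (LINT x|\<mu>. \<phi> x)
        = (\<Sum>k\<le>n. (renewal k - u) * q (n - k)) - (LINT x|\<mu>. (residual ^^ Suc n) \<phi> x)"
    proof -
      have "(\<Sum>k\<le>n. q (n - k)) = (\<Sum>i<Suc n. q i)"
        using sum.nat_diff_reindex[of q "Suc n"] by (simp only: lessThan_Suc_atMost diff_Suc_Suc)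
      then have "(\<Sum>k\<le>n. u * q (n - k)) = u * (\<Sum>i<Suc n. q i)"
        by (simp only: sum_distrib_left[symmetric])
      then show ?thesis
        unfolding nu_kernel_pow[OF \<phi>] mu_residual_pow[OF \<phi>, of "Suc n"]
        by (simp add: left_diff_distrib sum_subtractf q_def u_def del: sum.lessThan_Suc)
    qed
    also have "\<bar>\<dots>\<bar> \<le> A0 * (B * A0) * (real (Suc n) * r ^ n) + B * (A0 * r ^ Suc n)"
      using geometric_convolution_le[OF r(6) q, of n] mu_residual_pow_abs_le[OF \<phi>, of "Suc n"]
        mult_left_mono[OF r(5)[of "Suc n"] B] by linarith
    also have "\<dots> \<le> A0 * (B * A0) * (C * s ^ n) + B * (A0 * s ^ n)"
    proof -
      have "r ^ Suc n \<le> s ^ n" using mult_left_le_one_le[of "r ^ n" r] r0 r(3)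
        by (intro order_trans[OF _ rs[of n]]) auto
      then show ?thesis using s(4)[of n] r(1) B by (intro add_mono mult_left_mono) auto
    qed
    also have "\<dots> = B * (A * s ^ n)" by (simp add: A_def algebra_simps)
    finally show "\<bar>(LINT x|\<nu>. (kernel_op P ^^ n) \<phi> x) - (LINT x|\<mu>. \<phi> x)\<bar> \<le> B * (A * s ^ n)" .
  qed
qed

text \<open>
Until its first regeneration the chain is uncontrolled, but this costs at most \<open>survival\<close>; from then on
it converges at a rate that does not depend on the starting point. The function \<open>b k\<close> collects the
two contributions. A pointwise bound by a function with small mean is what is required later, where
the test function may itself depend on the state \<open>x\<close>.
\<close>

theorem mean_geometric_ergodicity:
  obtains b A r where "0 \<le> A" "0 < r" "r < 1"
    "\<And>k. \<exists>c. borel_bounded c (b k)" "\<And>k x. 0 \<le> b k x" "\<And>k. (LINT x|\<mu>. b k x) \<le> A * r ^ k"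
    "\<And>B \<phi> k x. borel_bounded B \<phi> \<Longrightarrow> \<bar>(kernel_op P ^^ k) \<phi> x - (LINT x|\<mu>. \<phi> x)\<bar> \<le> B * b k x"
proof -
  obtain A0 r where r: "0 \<le> A0" "0 < r" "r < 1" "\<And>n. (LINT x|\<mu>. survival n x) \<le> A0 * r ^ n"
    "\<And>B \<phi> n. borel_bounded B \<phi> \<Longrightarrow> \<bar>(LINT x|\<nu>. (kernel_op P ^^ n) \<phi> x) - (LINT x|\<mu>. \<phi> x)\<bar> \<le> B * (A0 * r ^ n)"
    using nu_kernel_pow_convergence by blast
  obtain C s where s: "0 \<le> C" "r < s" "s < 1" "\<And>n. real (Suc n) * r ^ n \<le> C * s ^ n"
    using geometric_convolution_bound[OF r(2,3)] by blast
  have rs: "r ^ n \<le> s ^ n" for n using r s by (intro power_mono) auto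
  define b where "b = (\<lambda>k x. 2 * survival k x + (\<Sum>j<k. (A0 * r ^ (k - 1 - j)) * survival j x))"
  define A where "A = 2 * A0 + A0 * A0 * (C / r)"
  show thesis
  proof (rule that[of A s b])
    show "0 \<le> A" "0 < s" "s < 1" using r s by (auto simp: A_def)
    fix k
    have b: "borel_bounded (\<bar>2\<bar> * 1 + (\<Sum>j<k. \<bar>A0 * r ^ (k - 1 - j)\<bar> * 1)) (b k)"
      unfolding b_def by (intro borel_bounded_add borel_bounded_sum borel_bounded_cmult survival_bounded)
    then show "\<exists>c. borel_bounded c (b k)" by blast
    show "0 \<le> b k x" for x
      unfolding b_def using survival_nonneg r by (intro add_nonneg_nonneg sum_nonneg mult_nonneg_nonneg) auto
    have "(LINT x|\<mu>. b k x) = 2 * (LINT x|\<mu>. survival k x) + (\<Sum>j<k. (A0 * r ^ (k - 1 - j)) * (LINT x|\<mu>. survival j x))"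
      unfolding b_def using mu_integrable[OF survival_bounded]
      by (subst Bochner_Integration.integral_add) auto
    also have "\<dots> \<le> 2 * (A0 * r ^ k) + (\<Sum>j<k. (A0 * r ^ (k - 1 - j)) * (A0 * r ^ j))"
      using r by (intro add_mono mult_left_mono sum_mono) auto
    also have "(\<Sum>j<k. (A0 * r ^ (k - 1 - j)) * (A0 * r ^ j)) = (\<Sum>j<k. A0 * A0 / r * r ^ k)"
    proof (rule sum.cong[OF refl])
      fix j assume "j \<in> {..<k}"
      then have "k = Suc (k - 1 - j + j)" by auto
      then have "r ^ k = r * (r ^ (k - 1 - j) * r ^ j)" by (metis power_Suc power_add)
      then show "(A0 * r ^ (k - 1 - j)) * (A0 * r ^ j) = A0 * A0 / r * r ^ k" using r by simp
    qed
    also have "\<dots> \<le> A0 * A0 / r * (C * s ^ k)"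
    proof -
      have "real k * r ^ k \<le> C * s ^ k"
      proof -
        have "0 \<le> r ^ k" "real (Suc k) * r ^ k = r ^ k + real k * r ^ k" using r by (auto simp: algebra_simps)
        then show ?thesis using s(4)[of k] by linarith
      qed
      then have "A0 * A0 / r * (real k * r ^ k) \<le> A0 * A0 / r * (C * s ^ k)" 
        using r by (intro mult_left_mono) auto
      then show ?thesis by (simp add: mult_ac)
    qed
    also have "2 * (A0 * r ^ k) \<le> 2 * (A0 * s ^ k)" using rs r by (intro mult_left_mono) auto
    finally show "(LINT x|\<mu>. b k x) \<le> A * s ^ k" by (simp add: A_def algebra_simps)
    fix B \<phi> x assume \<phi>: "borel_bounded B \<phi>"
    have B: "0 \<le> B" using borel_bounded_nonneg[OF \<phi>] .
    define m where "m = (LINT x|\<mu>. \<phi> x)"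
    define d where "d = (\<lambda>i. (LINT y|\<nu>. (kernel_op P ^^ i) \<phi> y) - m)"
    have m: "\<bar>m\<bar> \<le> B" unfolding m_def by (rule abs_integral_borel_bounded[OF \<mu> \<phi>])
    \<comment> \<open>The constant \<open>m\<close> is decomposed along the first regeneration as well, to be subtracted term by term.\<close>
    have one: "1 = survival k x + (\<Sum>j<k. (residual ^^ j) h x)"
      using first_regeneration[of 1 "\<lambda>_. 1" k x] borel_bounded_const[of 1] prob_space.prob_space[OF \<nu>(1)]
      by (simp add: kernel_op_pow_const[OF P] survival_def)
    have "m = m * survival k x + (\<Sum>j<k. m * (residual ^^ j) h x)"
      using arg_cong[OF one, of "(*) m"] by (simp add: distrib_left sum_distrib_left)
    moreover have "(\<Sum>j<k. d (k - 1 - j) * (residual ^^ j) h x)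
        = (\<Sum>j<k. (LINT y|\<nu>. (kernel_op P ^^ (k - 1 - j)) \<phi> y) * (residual ^^ j) h x) - (\<Sum>j<k. m * (residual ^^ j) h x)"
      by (simp add: d_def left_diff_distrib sum_subtractf)
    ultimately have eq: "(kernel_op P ^^ k) \<phi> x - m
        = ((residual ^^ k) \<phi> x - m * survival k x) + (\<Sum>j<k. d (k - 1 - j) * (residual ^^ j) h x)"
      using first_regeneration[OF \<phi>, of k x] by linarith
    have "\<bar>((residual ^^ k) \<phi> x - m * survival k x) + (\<Sum>j<k. d (k - 1 - j) * (residual ^^ j) h x)\<bar>
        \<le> (B * survival k x + B * survival k x) + (\<Sum>j<k. (B * (A0 * r ^ (k - 1 - j))) * survival j x)"
    proof (rule order_trans[OF abs_triangle_ineq add_mono])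
      have "\<bar>m * survival k x\<bar> \<le> B * survival k x"
        using m survival_nonneg[of k x] by (simp add: abs_mult mult_right_mono)
      then show "\<bar>(residual ^^ k) \<phi> x - m * survival k x\<bar> \<le> B * survival k x + B * survival k x"
        using residual_pow_abs_le[OF \<phi>, of k x] by linarith
      show "\<bar>\<Sum>j<k. d (k - 1 - j) * (residual ^^ j) h x\<bar> \<le> (\<Sum>j<k. (B * (A0 * r ^ (k - 1 - j))) * survival j x)"
      proof (rule order_trans[OF sum_abs sum_mono])
        fix j
        show "\<bar>d (k - 1 - j) * (residual ^^ j) h x\<bar> \<le> (B * (A0 * r ^ (k - 1 - j))) * survival j x"
          unfolding abs_mult
          using r(5)[OF \<phi>, of "k - 1 - j"] residual_pow_abs_le[OF h_bounded, of j x]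
          by (intro mult_mono) (auto simp: d_def m_def intro: order_trans[OF abs_ge_zero])
      qed
    qed
    also have "\<dots> = B * b k x"
    proof -
      define S where "S = (\<Sum>j<k. (A0 * r ^ (k - 1 - j)) * survival j x)"
      have "(\<Sum>j<k. (B * (A0 * r ^ (k - 1 - j))) * survival j x) = B * S"
        unfolding S_def sum_distrib_left by (rule sum.cong) (simp_all only: mult.assoc)
      moreover have "b k x = 2 * survival k x + S" by (simp only: b_def S_def)
      ultimately show ?thesis by (simp only: distrib_left mult_2)
    qed
    finally show "\<bar>(kernel_op P ^^ k) \<phi> x - (LINT x|\<mu>. \<phi> x)\<bar> \<le> B * b k x" unfolding m_def[symmetric] eq .
  qed
qed

end

end

text \<open>
From sets to functions, by comparing the measures \<open>a \<nu>\<close> and \<open>P x\<close>.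
\<close>

lemma kernel_minorisation_integral:
  assumes P: "markov_kernel P" and \<nu>: "prob_space \<nu>" "sets \<nu> = sets borel" and a: "0 \<le> a"
    and minor: "\<And>A. A \<in> sets borel \<Longrightarrow> a * measure \<nu> A \<le> measure (P x) A"
    and \<phi>: "borel_bounded c \<phi>" "\<And>y. 0 \<le> \<phi> y"
  shows "a * (LINT y|\<nu>. \<phi> y) \<le> kernel_op P \<phi> x"
proof -
  interpret \<nu>: prob_space \<nu> by fact
  interpret Px: prob_space "P x" by (rule kernel_prob[OF P])
  have le: "scale_measure (ennreal a) \<nu> \<le> P x"
    using minor a \<nu>(2) kernel_sets[OF P, of x]
    by (subst le_measure) (auto simp: \<nu>.emeasure_eq_measure Px.emeasure_eq_measure ennreal_mult[symmetric])
  have "ennreal (a * (LINT y|\<nu>. \<phi> y)) = ennreal a * (\<integral>\<^sup>+y. ennreal (\<phi> y) \<partial>\<nu>)"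
    using \<phi> a by (subst nn_integral_eq_integral[OF integrable_borel_bounded[OF \<nu> \<phi>(1)]])
      (auto simp: ennreal_mult Bochner_Integration.integral_nonneg)
  also have "\<dots> = (\<integral>\<^sup>+y. ennreal (\<phi> y) \<partial>scale_measure (ennreal a) \<nu>)"
    using borel_bounded_measurable[OF \<phi>(1)]
    by (subst nn_integral_scale_measure) (simp_all add: measurable_cong_sets[OF \<nu>(2) refl])
  also have "\<dots> \<le> (\<integral>\<^sup>+y. ennreal (\<phi> y) \<partial>P x)"
    by (rule nn_integral_mono_measure[OF _ le]) (simp add: \<nu>(2) kernel_sets[OF P])
  also have "\<dots> = ennreal (kernel_op P \<phi> x)"
    unfolding kernel_op_def using \<phi>
    by (subst nn_integral_eq_integral[OF integrable_borel_bounded[OF kernel_prob[OF P] kernel_sets[OF P] \<phi>(1)]]) auto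
  finally show ?thesis
    using \<phi> by (simp add: ennreal_le_iff2 kernel_op_def Bochner_Integration.integral_nonneg)
      (meson Bochner_Integration.integral_nonneg order_trans)
qed

lemma tv_norm_diff_upper:
  assumes P: "prob_space N1" "sets N1 = sets borel" and Q: "prob_space N2" "sets N2 = sets borel"
    and \<phi>: "borel_bounded 1 \<phi>"
  shows "\<bar>(LINT x|N1. \<phi> x) - (LINT x|N2. \<phi> x)\<bar> \<le> tv_norm_diff N1 N2"
  unfolding tv_norm_diff_def
proof (rule cSUP_upper)
  show "\<phi> \<in> {g \<in> borel_measurable borel. \<forall>x. \<bar>g x\<bar> \<le> 1}"
    using \<phi> by (auto simp: borel_bounded_def)
  have le_2: "\<bar>(LINT x|N1. g x) - (LINT x|N2. g x)\<bar> \<le> 2" if "borel_bounded 1 g" for g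
    using abs_integral_borel_bounded[OF P that] abs_integral_borel_bounded[OF Q that] by linarith
  show "bdd_above ((\<lambda>g :: real \<Rightarrow> real. \<bar>(LINT x|N1. g x) - (LINT x|N2. g x)\<bar>) ` {g \<in> borel_measurable borel. \<forall>x. \<bar>g x\<bar> \<le> 1})"
  proof (rule bdd_aboveI2)
    fix g assume "g \<in> {g \<in> borel_measurable borel. \<forall>x::real. \<bar>g x\<bar> \<le> (1 :: real)}"
    then show "\<bar>(LINT x|N1. g x) - (LINT x|N2. g x)\<bar> \<le> 2"
      by (intro le_2) (auto simp: borel_bounded_def)
  qed
qed

text \<open>
The function \<open>V\<close> is neither measurable nor \<open>\<nu>\<close>-integrable in general. But the set \<open>C c\<close> on which
\<open>P\<^sup>nh\<close> converges at the rate \<open>c \<rho>\<^sup>n\<close> is measurable, and these sets exhaust the line. Conditioning \<open>\<nu>\<close>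
on one of positive mass, and multiplying \<open>h\<close> by this mass, preserves the minorisation and makes the
hitting probabilities from the new regeneration law converge geometrically.
\<close>

lemma geometrically_ergodic_imp_mean_geometric:
  fixes P :: "real \<Rightarrow> real measure" and \<mu> \<nu> :: "real measure" and h V :: "real \<Rightarrow> real"
  assumes P: "markov_kernel P"
    and \<mu>: "stationary_distribution P \<mu>"
    and h: "h \<in> borel_measurable borel" "\<And>x. 0 \<le> h x" "\<And>x. h x \<le> 1" "(LINT x|\<mu>. h x) > 0"
    and \<nu>: "prob_space \<nu>" "sets \<nu> = sets borel"
    and minor: "\<And>x A. A \<in> sets borel \<Longrightarrow> h x * measure \<nu> A \<le> measure (P x) A"
    and \<rho>: "0 < \<rho>" "\<rho> < 1"
    and tv: "\<And>n x. n \<ge> 1 \<Longrightarrow> tv_norm_diff (kernel_pow P n x) \<mu> \<le> V x * \<rho> ^ n"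
  obtains b A r where "0 \<le> A" "0 < r" "r < 1"
    "\<And>k. \<exists>c. borel_bounded c (b k)" "\<And>k x. 0 \<le> b k x" "\<And>k. (LINT x|\<mu>. b k x) \<le> A * r ^ k"
    "\<And>B \<phi> k x. borel_bounded B \<phi> \<Longrightarrow> \<bar>(kernel_op P ^^ k) \<phi> x - (LINT x|\<mu>. \<phi> x)\<bar> \<le> B * b k x"
proof -
  have \<mu>p: "prob_space \<mu>" "sets \<mu> = sets borel" "\<mu> \<bind> P = \<mu>"
    using \<mu> by (auto simp: stationary_distribution_def)
  interpret \<nu>: prob_space \<nu> by fact
  define u where "u = (LINT x|\<mu>. h x)"
  have hb: "borel_bounded 1 h" using h by (intro borel_boundedI) (auto intro: abs_leI order_trans[of _ 0])
  note hP = kernel_op_pow_bounded[OF P hb]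
  have [measurable]: "(kernel_op P ^^ n) h \<in> borel_measurable borel" for n
    using borel_bounded_measurable[OF hP] .
  define C where "C = (\<lambda>c::nat. {x. \<forall>n. \<bar>(kernel_op P ^^ Suc n) h x - u\<bar> \<le> real c * \<rho> ^ Suc n})"
  have C_sets [measurable]: "C c \<in> sets borel" for c unfolding C_def by measurable
  have "(\<Union>c. C c) = UNIV"
  proof safe
    fix x
    obtain c :: nat where c: "V x \<le> real c" using real_arch_simple by blast
    have "\<bar>(kernel_op P ^^ Suc n) h x - u\<bar> \<le> real c * \<rho> ^ Suc n" for n
    proof -
      have "\<bar>(kernel_op P ^^ Suc n) h x - u\<bar> \<le> tv_norm_diff (kernel_pow P (Suc n) x) \<mu>"
        using tv_norm_diff_upper[OF conjunct1[OF prob_kernel_pow[OF P]] conjunct2[OF prob_kernel_pow[OF P]] \<mu>p(1,2) hb]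
        unfolding integral_kernel_pow[OF P hb] u_def .
      also have "\<dots> \<le> V x * \<rho> ^ Suc n" by (rule tv) simp
      also have "\<dots> \<le> real c * \<rho> ^ Suc n" using c \<rho> by (intro mult_right_mono) auto
      finally show ?thesis .
    qed
    then show "x \<in> (\<Union>c. C c)" unfolding C_def by blast
  qed simp
  moreover have "incseq C"
  proof (rule incseq_SucI, rule subsetI)
    fix c x assume "x \<in> C c"
    then have x: "\<bar>(kernel_op P ^^ Suc n) h x - u\<bar> \<le> real c * \<rho> ^ Suc n" for n unfolding C_def by blast
    have "real c * \<rho> ^ Suc n \<le> real (Suc c) * \<rho> ^ Suc n" for n
      using \<rho> by (intro mult_right_mono) auto
    then show "x \<in> C (Suc c)" using x unfolding C_def by (blast intro: order_trans)
  qed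
  moreover have "space \<nu> = UNIV" using sets_eq_imp_space_eq[OF \<nu>(2)] by simp
  ultimately have "(\<lambda>c. measure \<nu> (C c)) \<longlonglongrightarrow> 1"
    using \<nu>.finite_Lim_measure_incseq[of C] C_sets \<nu>(2) \<nu>.prob_space by (auto simp: image_subset_iff)
  then have "\<forall>\<^sub>F c in sequentially. measure \<nu> (C c) > 0"
    by (rule order_tendstoD) simp
  then obtain c where c: "measure \<nu> (C c) > 0" by (auto simp: eventually_sequentially)
  define p where "p = measure \<nu> (C c)"
  have p: "0 < p" "p \<le> 1" using c by (auto simp: p_def)
  define \<nu>' where "\<nu>' = uniform_measure \<nu> (C c)"
  have C\<nu>: "emeasure \<nu> (C c) \<noteq> 0" "emeasure \<nu> (C c) \<noteq> \<infinity>" "C c \<in> sets \<nu>"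
    using c C_sets \<nu>(2) by (auto simp: \<nu>.emeasure_eq_measure)
  have \<nu>': "prob_space \<nu>'" "sets \<nu>' = sets borel"
    using prob_space_uniform_measure[OF C\<nu>(1,2)] \<nu>(2) by (auto simp: \<nu>'_def)
  have \<nu>'_C: "AE x in \<nu>'. x \<in> C c"
    unfolding \<nu>'_def using C\<nu> by (intro AE_uniform_measureI) auto
  have meas': "measure \<nu>' A * p \<le> measure \<nu> A" if "A \<in> sets borel" for A
  proof -
    have "measure \<nu>' A = measure \<nu> (C c \<inter> A) / p"
      unfolding \<nu>'_def p_def using C\<nu> that \<nu>(2) by (subst measure_uniform_measure) auto
    moreover have "measure \<nu> (C c \<inter> A) \<le> measure \<nu> A"
      using that \<nu>(2) by (intro \<nu>.finite_measure_mono) auto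
    ultimately show ?thesis using p by simp
  qed
  define h' where "h' = (\<lambda>x. p * h x)"
  have powh': "(kernel_op P ^^ n) h' = (\<lambda>x. p * (kernel_op P ^^ n) h x)" for n
    unfolding h'_def by (induction n) (simp_all add: kernel_op_cmult[OF P])
  interpret minorised_kernel P \<nu>' \<mu> h'
  proof (rule minorised_kernel.intro)
    show "h' \<in> borel_measurable borel" unfolding h'_def using h by measurable
    show "0 \<le> h' x" "h' x \<le> 1" for x
      unfolding h'_def using h p by (auto intro: mult_le_one)
    show "(LINT x|\<mu>. kernel_op P \<phi> x) = (LINT x|\<mu>. \<phi> x)" if "borel_bounded c \<phi>" for c \<phi>
      using integral_bind_kernel[OF P \<mu>p(1,2) that] \<mu>p(3) by simp
    show "h' x * (LINT y|\<nu>'. \<phi> y) \<le> kernel_op P \<phi> x" if "borel_bounded c \<phi>" "\<And>y. 0 \<le> \<phi> y" for c \<phi> x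
    proof (rule kernel_minorisation_integral[OF P \<nu>' _ _ that])
      show "0 \<le> h' x" using h p by (simp add: h'_def)
      fix A :: "real set" assume A: "A \<in> sets borel"
      have "h' x * measure \<nu>' A = h x * (measure \<nu>' A * p)" by (simp add: h'_def)
      also have "\<dots> \<le> h x * measure \<nu> A" using meas'[OF A] h by (intro mult_left_mono) auto
      also have "\<dots> \<le> measure (P x) A" by (rule minor[OF A])
      finally show "h' x * measure \<nu>' A \<le> measure (P x) A" .
    qed
  qed (rule P \<nu>' \<mu>p(1,2))+
  have \<mu>h': "(LINT x|\<mu>. h' x) = p * u" by (simp add: h'_def u_def)
  have conv: "\<bar>(LINT x|\<nu>'. (kernel_op P ^^ n) h' x) - (LINT x|\<mu>. h' x)\<bar> \<le> (1 + real c) * \<rho> ^ n" for n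
  proof (cases n)
    case 0
    have "0 \<le> (LINT x|\<nu>'. h' x)" "(LINT x|\<nu>'. h' x) \<le> 1" "0 \<le> (LINT x|\<mu>. h' x)" "(LINT x|\<mu>. h' x) \<le> 1"
      using abs_integral_borel_bounded[OF \<nu>' h_bounded] abs_integral_borel_bounded[OF \<mu>p(1,2) h_bounded] h01
      by (auto intro!: Bochner_Integration.integral_nonneg)
    then show ?thesis using 0 by (simp add: abs_le_iff)
  next
    case (Suc k)
    interpret \<nu>': prob_space \<nu>' by fact
    note int = integrable_borel_bounded[OF \<nu>' hP]
    have "(LINT x|\<nu>'. (kernel_op P ^^ n) h' x) - (LINT x|\<mu>. h' x) = p * (LINT x|\<nu>'. (kernel_op P ^^ n) h x - u)"
      unfolding powh' \<mu>h' using int by (simp add: \<nu>'.prob_space right_diff_distrib)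
    also have "\<bar>\<dots>\<bar> \<le> 1 * (LINT x|\<nu>'. \<bar>(kernel_op P ^^ n) h x - u\<bar>)"
      unfolding abs_mult using p integral_norm_bound[of \<nu>' "\<lambda>x. (kernel_op P ^^ n) h x - u"]
      by (intro mult_mono) auto
    also have "(LINT x|\<nu>'. \<bar>(kernel_op P ^^ n) h x - u\<bar>) \<le> (LINT x|\<nu>'. real c * \<rho> ^ n)"
    proof (rule integral_mono_AE)
      show "AE x in \<nu>'. \<bar>(kernel_op P ^^ n) h x - u\<bar> \<le> real c * \<rho> ^ n"
        using \<nu>'_C unfolding C_def Suc by (auto elim!: eventually_mono)
    qed (use int in auto)
    also have "\<dots> \<le> (1 + real c) * \<rho> ^ n" using \<rho> by (simp add: \<nu>'.prob_space algebra_simps)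
    finally show ?thesis by simp
  qed
  have charged: "0 < (LINT x|\<mu>. h' x)" unfolding \<mu>h' using p h(4) by (simp add: u_def)
  show thesis
    by (rule mean_geometric_ergodicity[OF charged \<rho> conv]) (rule that; assumption)
qed


section \<open>Fourth moments of sums of weakly dependent vectors\<close>

lemma (in finite_measure) integrable_bounded_function:
  fixes w :: "'a \<Rightarrow> real"
  shows "w \<in> borel_measurable M \<Longrightarrow> (\<And>\<omega>. \<bar>w \<omega>\<bar> \<le> c) \<Longrightarrow> integrable M w"
  by (rule integrable_const_bound[where B=c]) auto

text \<open>
The difference of the two sides is \<open>2 (d (a - d))\<^sup>2\<close>. The term linear in \<open>d\<close> must be kept exactly,
because it vanishes in the mean; the others only need upper bounds involving \<open>d\<^sup>2\<close>.
\<close>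

lemma pow4_increment_le:
  fixes a d :: real
  shows "(a + d) ^ 4 \<le> a ^ 4 + 4 * (a ^ 3 * d) + 8 * a\<^sup>2 * d\<^sup>2 + 3 * (d\<^sup>2 * d\<^sup>2)"
proof -
  have "a ^ 4 + 4 * (a ^ 3 * d) + 8 * a\<^sup>2 * d\<^sup>2 + 3 * (d\<^sup>2 * d\<^sup>2) - (a + d) ^ 4 = 2 * (d * (a - d))\<^sup>2"
    by algebra
  then show ?thesis using zero_le_power2[of "d * (a - d)"] by linarith
qed

text \<open>
Every power \<open>y\<^sup>i\<close> with \<open>i \<le> 4\<close> is at most \<open>1 + y\<^sup>4\<close>, for \<open>y = x / L\<close>.
\<close>

lemma quadratic_times_linear_le:
  fixes x L \<alpha> \<beta> :: real
  assumes "0 \<le> x" "0 < L" "0 \<le> \<alpha>" "0 \<le> \<beta>"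
  shows "(8 * x\<^sup>2 + 3 * (x * L + L\<^sup>2)) * (\<alpha> * x + \<beta>) \<le> 14 * ((\<alpha> * L + \<beta>) / L\<^sup>2) * (x ^ 4 + L ^ 4)"
proof -
  define y where "y = x / L"
  have x: "x = y * L" and y: "0 \<le> y" using assms by (simp_all add: y_def)
  have p: "y \<le> 1 + y ^ 4" "y\<^sup>2 \<le> 1 + y ^ 4" "y ^ 3 \<le> 1 + y ^ 4"
  proof -
    show "y \<le> 1 + y ^ 4"
      using y self_le_power[of y 4] zero_le_power[of y 4] by (cases "1 \<le> y") (force, linarith)
    show "y\<^sup>2 \<le> 1 + y ^ 4"
      using y power_increasing[of 2 4 y] power_le_one[of y 2] zero_le_power[of y 4] by (cases "1 \<le> y") (force, linarith)
    show "y ^ 3 \<le> 1 + y ^ 4"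
      using y power_increasing[of 3 4 y] power_le_one[of y 3] zero_le_power[of y 4] by (cases "1 \<le> y") (force, linarith)
  qed
  have "(8 * x\<^sup>2 + 3 * (x * L + L\<^sup>2)) * (\<alpha> * x + \<beta>)
      = L\<^sup>2 * (\<alpha> * L * (8 * y ^ 3 + 3 * y\<^sup>2 + 3 * y) + \<beta> * (8 * y\<^sup>2 + 3 * y + 3))"
    unfolding x by algebra
  also have "\<dots> \<le> L\<^sup>2 * (\<alpha> * L * (14 * (1 + y ^ 4)) + \<beta> * (14 * (1 + y ^ 4)))"
  proof -
    have "8 * y ^ 3 + 3 * y\<^sup>2 + 3 * y \<le> 8 * (1 + y ^ 4) + 3 * (1 + y ^ 4) + 3 * (1 + y ^ 4)"
      using p by (intro add_mono mult_left_mono) auto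
    then have "8 * y ^ 3 + 3 * y\<^sup>2 + 3 * y \<le> 14 * (1 + y ^ 4)" by simp
    moreover have "8 * y\<^sup>2 + 3 * y + 3 \<le> 8 * (1 + y ^ 4) + 3 * (1 + y ^ 4) + 3 * (1 + y ^ 4)"
      using p y by (intro add_mono mult_left_mono) auto
    then have "8 * y\<^sup>2 + 3 * y + 3 \<le> 14 * (1 + y ^ 4)" by simp
    ultimately have "8 * y ^ 3 + 3 * y\<^sup>2 + 3 * y \<le> 14 * (1 + y ^ 4)" "8 * y\<^sup>2 + 3 * y + 3 \<le> 14 * (1 + y ^ 4)" .
    then show ?thesis using assms by (intro mult_left_mono add_mono) auto
  qed
  also have "\<dots> = 14 * ((\<alpha> * L + \<beta>) / L\<^sup>2) * (x ^ 4 + L ^ 4)"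
    unfolding x using assms(2) by (simp add: field_simps power2_eq_square power4_eq_xxxx)
  finally show ?thesis .
qed

text \<open>
Random vectors \<open>S j\<close> with coordinates in \<open>J\<close>, such that the conditional mean of \<open>S j\<close> given \<open>F j\<close> is
nearly \<open>0\<close> and its conditional second moments are nearly constant, up to \<open>\<epsilon>\<close>. The bound \<open>m\<close> is for
the squared length of a vector and \<open>\<eta>\<close> for the operator norm of its covariance matrix, which is what
makes the result better than a bound through the trace.
\<close>

locale weakly_dependent_vectors = prob_space M for M :: "'a measure" +
  fixes F :: "nat \<Rightarrow> 'a measure" and S :: "nat \<Rightarrow> 'i \<Rightarrow> 'a \<Rightarrow> real" and J :: "'i set"
    and m \<epsilon> \<eta> :: real
  assumes F: "\<And>j. subalgebra M (F j)"
    and J: "finite J"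
    and S_past: "\<And>i j k. i < j \<Longrightarrow> k \<in> J \<Longrightarrow> S i k \<in> borel_measurable (F j)"
    and S_bound: "\<And>j \<omega>. (\<Sum>k\<in>J. (S j k \<omega>)\<^sup>2) \<le> m"
    and nonneg: "0 \<le> m" "0 \<le> \<epsilon>" "0 \<le> \<eta>"
    and centred: "\<And>j w k. k \<in> J \<Longrightarrow> w \<in> borel_measurable (F j) \<Longrightarrow> (\<And>\<omega>. \<bar>w \<omega>\<bar> \<le> 1) \<Longrightarrow>
      \<bar>LINT \<omega>|M. w \<omega> * S j k \<omega>\<bar> \<le> \<epsilon>"
    and covariance: "\<And>j w k k'. k \<in> J \<Longrightarrow> k' \<in> J \<Longrightarrow> w \<in> borel_measurable (F j) \<Longrightarrow> (\<And>\<omega>. \<bar>w \<omega>\<bar> \<le> 1) \<Longrightarrow>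
      \<bar>(LINT \<omega>|M. w \<omega> * (S j k \<omega> * S j k' \<omega>)) - (LINT \<omega>|M. w \<omega>) * (LINT \<omega>|M. S j k \<omega> * S j k' \<omega>)\<bar> \<le> \<epsilon>"
    and operator_norm: "\<And>j c. (\<Sum>k\<in>J. \<Sum>k'\<in>J. c k * c k' * (LINT \<omega>|M. S j k \<omega> * S j k' \<omega>)) \<le> \<eta> * (\<Sum>k\<in>J. (c k)\<^sup>2)"
begin

text \<open>
The partial sum \<open>T\<close>, its squared length \<open>Y\<close>, and the deviation of \<open>Y\<close> from its approximate mean, which
is nearly a martingale with increments \<open>increment\<close>.
\<close>

definition T :: "nat \<Rightarrow> 'i \<Rightarrow> 'a \<Rightarrow> real" where "T j k \<omega> = (\<Sum>i<j. S i k \<omega>)"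
definition Y :: "nat \<Rightarrow> 'a \<Rightarrow> real" where "Y j \<omega> = (\<Sum>k\<in>J. (T j k \<omega>)\<^sup>2)"
definition trace :: "nat \<Rightarrow> real" where "trace j = (\<Sum>k\<in>J. (LINT \<omega>|M. S j k \<omega> * S j k \<omega>))"
definition deviation :: "nat \<Rightarrow> 'a \<Rightarrow> real" where "deviation j \<omega> = Y j \<omega> - (\<Sum>i<j. trace i)"
definition increment :: "nat \<Rightarrow> 'a \<Rightarrow> real" where
  "increment j \<omega> = 2 * (\<Sum>k\<in>J. S j k \<omega> * T j k \<omega>) + (\<Sum>k\<in>J. S j k \<omega> * S j k \<omega>) - trace j"

lemma S_measurable: "k \<in> J \<Longrightarrow> S j k \<in> borel_measurable M"
  using measurable_from_subalg[OF F S_past[of j "Suc j"]] by simp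

lemma T_past: "k \<in> J \<Longrightarrow> T j k \<in> borel_measurable (F j)"
  unfolding T_def by (intro borel_measurable_sum S_past) auto

lemma Y_past: "Y j \<in> borel_measurable (F j)"
  unfolding Y_def by (intro borel_measurable_sum borel_measurable_power T_past)

lemma deviation_past: "deviation j \<in> borel_measurable (F j)"
  unfolding deviation_def using Y_past by measurable

lemma past_measurable: "w \<in> borel_measurable (F j) \<Longrightarrow> w \<in> borel_measurable M"
  by (rule measurable_from_subalg[OF F])

lemma increment_measurable: "increment j \<in> borel_measurable M"
  unfolding increment_def
  by (intro borel_measurable_add borel_measurable_diff borel_measurable_sum borel_measurable_times
      borel_measurable_const S_measurable past_measurable[OF T_past])

lemma S_sq_le: "k \<in> J \<Longrightarrow> (S j k \<omega>)\<^sup>2 \<le> m"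
  using member_le_sum[OF _ _ J, of k "\<lambda>k. (S j k \<omega>)\<^sup>2"] S_bound[of j \<omega>] by simp

lemma S_abs_le: "k \<in> J \<Longrightarrow> \<bar>S j k \<omega>\<bar> \<le> sqrt m"
  using S_sq_le by (intro real_le_rsqrt) simp

lemma SS_abs_le: "k \<in> J \<Longrightarrow> k' \<in> J \<Longrightarrow> \<bar>S j k \<omega> * S j k' \<omega>\<bar> \<le> m"
  using mult_mono[OF S_abs_le S_abs_le, of k k' j \<omega> j \<omega>] nonneg by (simp add: abs_mult)

lemma deviation_Suc: "deviation (Suc j) \<omega> = deviation j \<omega> + increment j \<omega>"
proof -
  have "Y (Suc j) \<omega> = Y j \<omega> + 2 * (\<Sum>k\<in>J. S j k \<omega> * T j k \<omega>) + (\<Sum>k\<in>J. S j k \<omega> * S j k \<omega>)"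
    unfolding Y_def T_def
    by (simp add: power2_sum power2_eq_square sum.distrib sum_distrib_left algebra_simps)
  then show ?thesis by (simp add: deviation_def increment_def)
qed

lemma trace_bounds: "0 \<le> trace j" "trace j \<le> m"
proof -
  show "0 \<le> trace j" unfolding trace_def by (intro sum_nonneg Bochner_Integration.integral_nonneg) simp
  have int: "integrable M (\<lambda>\<omega>. S j k \<omega> * S j k \<omega>)" if "k \<in> J" for k
    using S_measurable[OF that] SS_abs_le[OF that that] by (intro integrable_bounded_function[where c=m]) auto
  then have "trace j = (LINT \<omega>|M. (\<Sum>k\<in>J. S j k \<omega> * S j k \<omega>))" by (simp add: trace_def)
  also have "\<dots> \<le> (LINT \<omega>|M. m)"
    using int S_bound by (intro integral_mono) (auto simp: power2_eq_square)
  finally show "trace j \<le> m" by (simp add: prob_space)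
qed

lemma centred_scaled:
  assumes "k \<in> J" "w \<in> borel_measurable (F j)" "\<And>\<omega>. \<bar>w \<omega>\<bar> \<le> W"
  shows "\<bar>LINT \<omega>|M. w \<omega> * S j k \<omega>\<bar> \<le> W * \<epsilon>"
proof (cases "W = 0")
  case True
  then show ?thesis using assms(3) by simp
next
  case False
  then have W: "0 < W" using assms(3)[of undefined] by linarith
  have "\<bar>LINT \<omega>|M. (w \<omega> / W) * S j k \<omega>\<bar> \<le> \<epsilon>"
    using assms W by (intro centred) auto
  moreover have "(LINT \<omega>|M. (w \<omega> / W) * S j k \<omega>) = (LINT \<omega>|M. w \<omega> * S j k \<omega>) / W" by simp
  ultimately show ?thesis using W by (simp add: field_simps)
qed

lemma covariance_scaled:
  assumes "k \<in> J" "k' \<in> J" "w \<in> borel_measurable (F j)" "\<And>\<omega>. \<bar>w \<omega>\<bar> \<le> W"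
  shows "\<bar>(LINT \<omega>|M. w \<omega> * (S j k \<omega> * S j k' \<omega>)) - (LINT \<omega>|M. w \<omega>) * (LINT \<omega>|M. S j k \<omega> * S j k' \<omega>)\<bar> \<le> W * \<epsilon>"
proof (cases "W = 0")
  case True
  then show ?thesis using assms(4) by simp
next
  case False
  then have W: "0 < W" using assms(4)[of undefined] by linarith
  define I1 I2 I3 where "I1 = (LINT \<omega>|M. w \<omega> * (S j k \<omega> * S j k' \<omega>))"
    and "I2 = (LINT \<omega>|M. w \<omega>)" and "I3 = (LINT \<omega>|M. S j k \<omega> * S j k' \<omega>)"
  have "\<bar>(LINT \<omega>|M. (w \<omega> / W) * (S j k \<omega> * S j k' \<omega>)) - (LINT \<omega>|M. w \<omega> / W) * (LINT \<omega>|M. S j k \<omega> * S j k' \<omega>)\<bar> \<le> \<epsilon>"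
    using assms W by (intro covariance) auto
  then have "\<bar>I1 / W - I2 / W * I3\<bar> \<le> \<epsilon>" by (simp add: I1_def I2_def I3_def)
  moreover have "I1 / W - I2 / W * I3 = (I1 - I2 * I3) / W" by (simp add: diff_divide_distrib)
  ultimately have "\<bar>I1 - I2 * I3\<bar> \<le> W * \<epsilon>" using W by (simp add: field_simps)
  then show ?thesis by (simp add: I1_def I2_def I3_def)
qed

text \<open>
The one place where the operator norm enters: given the past, \<open>\<langle>S j, T j\<rangle>\<^sup>2\<close> has mean
\<open>T j\<^sup>t G (T j)\<close> with \<open>G\<close> the covariance matrix of \<open>S j\<close>. Expanding in coordinates keeps the weight
\<open>w\<close> and the past factors together, so that the covariance hypothesis applies entry by entry.
\<close>

lemma cross_term_le:
  assumes w: "w \<in> borel_measurable (F j)" "\<And>\<omega>. 0 \<le> w \<omega>" "\<And>\<omega>. w \<omega> \<le> W"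
    and T: "\<And>k \<omega>. k \<in> J \<Longrightarrow> \<bar>T j k \<omega>\<bar> \<le> B"
  shows "(LINT \<omega>|M. w \<omega> * (\<Sum>k\<in>J. S j k \<omega> * T j k \<omega>)\<^sup>2)
    \<le> \<eta> * (LINT \<omega>|M. w \<omega> * Y j \<omega>) + real (card J) * real (card J) * (W * (B * B) * \<epsilon>)"
proof -
  have W: "0 \<le> W" using w(2,3)[of undefined] by linarith
  define v where "v = (\<lambda>k k' \<omega>. w \<omega> * (T j k \<omega> * T j k' \<omega>))"
  define G where "G = (\<lambda>k k'. LINT \<omega>|M. S j k \<omega> * S j k' \<omega>)"
  have v_past: "v k k' \<in> borel_measurable (F j)" if "k \<in> J" "k' \<in> J" for k k'
    unfolding v_def using that w T_past by (intro borel_measurable_times) auto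
  have v_bound: "\<bar>v k k' \<omega>\<bar> \<le> W * (B * B)" if "k \<in> J" "k' \<in> J" for k k' \<omega>
    unfolding v_def abs_mult using T[OF that(1), of \<omega>] T[OF that(2), of \<omega>] w(2,3)[of \<omega>] W
    by (intro mult_mono) auto
  have int_v: "integrable M (v k k')" if "k \<in> J" "k' \<in> J" for k k'
    by (rule integrable_bounded_function[OF past_measurable[OF v_past[OF that]] v_bound[OF that]])
  have int_vS: "integrable M (\<lambda>\<omega>. v k k' \<omega> * (S j k \<omega> * S j k' \<omega>))" if "k \<in> J" "k' \<in> J" for k k'
  proof (rule integrable_bounded_function[where c="W * (B * B) * m"])
    show "(\<lambda>\<omega>. v k k' \<omega> * (S j k \<omega> * S j k' \<omega>)) \<in> borel_measurable M"
      using past_measurable[OF v_past] S_measurable that by auto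
    show "\<bar>v k k' \<omega> * (S j k \<omega> * S j k' \<omega>)\<bar> \<le> W * (B * B) * m" for \<omega>
      unfolding abs_mult[of "v k k' \<omega>"] using v_bound SS_abs_le that W nonneg
      by (intro mult_mono) auto
  qed
  have "(LINT \<omega>|M. w \<omega> * (\<Sum>k\<in>J. S j k \<omega> * T j k \<omega>)\<^sup>2)
      = (LINT \<omega>|M. (\<Sum>k\<in>J. \<Sum>k'\<in>J. v k k' \<omega> * (S j k \<omega> * S j k' \<omega>)))"
    by (intro Bochner_Integration.integral_cong refl)
       (simp add: power2_eq_square sum_product sum_distrib_left v_def mult_ac)
  also have "\<dots> = (\<Sum>k\<in>J. \<Sum>k'\<in>J. (LINT \<omega>|M. v k k' \<omega> * (S j k \<omega> * S j k' \<omega>)))"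
    using int_vS by (simp add: Bochner_Integration.integral_sum)
  also have "\<dots> \<le> (\<Sum>k\<in>J. \<Sum>k'\<in>J. (LINT \<omega>|M. v k k' \<omega>) * G k k' + W * (B * B) * \<epsilon>)"
  proof (intro sum_mono)
    fix k k' assume l: "k \<in> J" "k' \<in> J"
    show "(LINT \<omega>|M. v k k' \<omega> * (S j k \<omega> * S j k' \<omega>)) \<le> (LINT \<omega>|M. v k k' \<omega>) * G k k' + W * (B * B) * \<epsilon>"
      using covariance_scaled[OF l v_past[OF l] v_bound[OF l]] by (simp add: G_def abs_le_iff)
  qed
  also have "\<dots> = (\<Sum>k\<in>J. \<Sum>k'\<in>J. (LINT \<omega>|M. v k k' \<omega>) * G k k') + real (card J) * real (card J) * (W * (B * B) * \<epsilon>)"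
    by (simp add: sum.distrib)
  also have "(\<Sum>k\<in>J. \<Sum>k'\<in>J. (LINT \<omega>|M. v k k' \<omega>) * G k k') = (LINT \<omega>|M. (\<Sum>k\<in>J. \<Sum>k'\<in>J. v k k' \<omega> * G k k'))"
    using int_v by (simp add: Bochner_Integration.integral_sum)
  also have "\<dots> \<le> (LINT \<omega>|M. \<eta> * (w \<omega> * Y j \<omega>))"
  proof (rule integral_mono)
    show "integrable M (\<lambda>\<omega>. \<Sum>k\<in>J. \<Sum>k'\<in>J. v k k' \<omega> * G k k')"
      using int_v by (intro Bochner_Integration.integrable_sum) auto
    have "w \<omega> * Y j \<omega> = (\<Sum>k\<in>J. v k k \<omega>)" for \<omega>
      by (simp add: Y_def v_def sum_distrib_left power2_eq_square)
    then show "integrable M (\<lambda>\<omega>. \<eta> * (w \<omega> * Y j \<omega>))" using int_v by simp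
    fix \<omega>
    have "(\<Sum>k\<in>J. \<Sum>k'\<in>J. v k k' \<omega> * G k k') = w \<omega> * (\<Sum>k\<in>J. \<Sum>k'\<in>J. T j k \<omega> * T j k' \<omega> * G k k')"
      by (simp add: v_def sum_distrib_left mult_ac)
    also have "\<dots> \<le> w \<omega> * (\<eta> * Y j \<omega>)"
      unfolding Y_def G_def using w(2) operator_norm by (intro mult_left_mono) auto
    finally show "(\<Sum>k\<in>J. \<Sum>k'\<in>J. v k k' \<omega> * G k k') \<le> \<eta> * (w \<omega> * Y j \<omega>)" by (simp add: mult_ac)
  qed
  finally show ?thesis by simp
qed

lemma increment_sq_le:
  "(increment j \<omega>)\<^sup>2 \<le> 8 * (\<Sum>k\<in>J. S j k \<omega> * T j k \<omega>)\<^sup>2 + 2 * m\<^sup>2"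
  "(increment j \<omega>)\<^sup>2 \<le> 8 * m * Y j \<omega> + 2 * m\<^sup>2"
proof -
  define x z where "x = (\<Sum>k\<in>J. S j k \<omega> * T j k \<omega>)" and "z = (\<Sum>k\<in>J. S j k \<omega> * S j k \<omega>) - trace j"
  have "0 \<le> (\<Sum>k\<in>J. S j k \<omega> * S j k \<omega>)" "(\<Sum>k\<in>J. S j k \<omega> * S j k \<omega>) \<le> m"
    using S_bound[of j \<omega>] by (auto simp: power2_eq_square intro: sum_nonneg)
  then have "\<bar>z\<bar> \<le> m" using trace_bounds[of j] by (simp add: z_def abs_le_iff)
  then have "z\<^sup>2 \<le> m\<^sup>2" by (metis abs_ge_zero power2_abs power_mono)
  moreover have "(increment j \<omega>)\<^sup>2 + (2 * x - z)\<^sup>2 = 8 * x\<^sup>2 + 2 * z\<^sup>2"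
  proof -
    have "increment j \<omega> = 2 * x + z" by (simp add: increment_def x_def z_def)
    then show ?thesis by (simp add: power2_eq_square algebra_simps)
  qed
  ultimately show 1: "(increment j \<omega>)\<^sup>2 \<le> 8 * x\<^sup>2 + 2 * m\<^sup>2" using zero_le_power2[of "2 * x - z"] by linarith
  have "x\<^sup>2 \<le> (\<Sum>k\<in>J. (S j k \<omega>)\<^sup>2) * Y j \<omega>"
    unfolding x_def Y_def by (rule Cauchy_Schwarz_ineq_sum)
  also have "\<dots> \<le> m * Y j \<omega>" using S_bound by (intro mult_right_mono) (auto simp: Y_def sum_nonneg)
  finally show "(increment j \<omega>)\<^sup>2 \<le> 8 * m * Y j \<omega> + 2 * m\<^sup>2" using 1 by linarith
qed

text \<open>
The quantity \<open>E deviation\<^sup>4 + L\<^sup>4\<close> grows at each step by a factor of at most \<open>1 + 15/N\<close>. Indeed the linear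
term of the expansion is negligible, and the conditional mean of \<open>increment\<^sup>2\<close> is at most
\<open>8 \<eta> (\<bar>deviation\<bar> + s) + 2 m\<^sup>2\<close>, of order \<open>L\<^sup>2/N\<close> when the deviation has its expected size \<open>L\<close>. The number
\<open>H\<close> is a crude bound for everything in sight; it is only ever multiplied by the tiny \<open>\<epsilon>\<close>.
\<close>

theorem fourth_moment_bound:
  assumes N: "0 < N" and H: "1 \<le> H" "real N \<le> H" "real (card J) \<le> H" "m \<le> H"
    and s: "(\<Sum>j<N. trace j) \<le> s"
    and L: "0 < L" "8 * m \<le> L" "8 * m * s + 2 * m\<^sup>2 \<le> L\<^sup>2"
      "real N * (8 * \<eta> * L + (8 * \<eta> * s + 2 * m\<^sup>2)) \<le> L\<^sup>2" "real N * (316 * H ^ 18 * \<epsilon>) \<le> L ^ 4"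
  shows "integrable M (\<lambda>\<omega>. (deviation N \<omega>) ^ 4)" "(LINT \<omega>|M. (deviation N \<omega>) ^ 4) \<le> exp 15 * L ^ 4"
proof -
  have partial: "(\<Sum>i<j. trace i) \<le> s" "0 \<le> (\<Sum>i<j. trace i)" if "j \<le> N" for j
    using sum_mono2[of "{..<N}" "{..<j}" trace] that trace_bounds s by (auto intro: sum_nonneg order_trans)
  have s0: "0 \<le> s" using partial[of 0] by simp
  have H_pow: "H ^ i \<le> H ^ k" if "i \<le> k" for i k using H that by (intro power_increasing) auto
  have sqrt_m: "sqrt m \<le> H"
  proof -
    have "m \<le> H\<^sup>2" using H(1,4) H_pow[of 1 2] by simp
    then show ?thesis using H by (intro real_le_lsqrt) (auto simp: nonneg)
  qed
  have T_bound: "\<bar>T j k \<omega>\<bar> \<le> H\<^sup>2" if "j \<le> N" "k \<in> J" for j k \<omega>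
  proof -
    have "\<bar>T j k \<omega>\<bar> \<le> (\<Sum>i<j. \<bar>S i k \<omega>\<bar>)" unfolding T_def by (rule sum_abs)
    also have "\<dots> \<le> (\<Sum>i<j. H)" using S_abs_le[OF that(2)] sqrt_m by (intro sum_mono) (meson order_trans)
    also have "\<dots> = real j * H" by simp
    also have "\<dots> \<le> H * H" using that H by (intro mult_right_mono) auto
    finally show ?thesis by (simp add: power2_eq_square)
  qed
  have Y_bound: "0 \<le> Y j \<omega>" "Y j \<omega> \<le> H ^ 5" if "j \<le> N" for j \<omega>
  proof -
    show "0 \<le> Y j \<omega>" by (simp add: Y_def sum_nonneg)
    have "Y j \<omega> \<le> (\<Sum>k\<in>J. (H\<^sup>2)\<^sup>2)"
      unfolding Y_def using T_bound[OF that] by (intro sum_mono) (metis abs_ge_zero power2_abs power_mono)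
    also have "\<dots> = real (card J) * H ^ 4" by simp
    also have "\<dots> \<le> H * H ^ 4" using H by (intro mult_right_mono) auto
    finally show "Y j \<omega> \<le> H ^ 5" by (simp add: eval_nat_numeral)
  qed
  have deviation_bound: "\<bar>deviation j \<omega>\<bar> \<le> H ^ 5" if "j \<le> N" for j \<omega>
  proof -
    have "(\<Sum>i<j. trace i) \<le> (\<Sum>i<j. m)" using trace_bounds by (intro sum_mono)
    also have "\<dots> = real j * m" by simp
    also have "\<dots> \<le> H * H" using that H nonneg by (intro mult_mono) auto
    also have "\<dots> \<le> H ^ 5" using H_pow[of 2 5] by (simp add: power2_eq_square)
    finally show ?thesis using Y_bound[OF that, of \<omega>] partial(2)[OF that] unfolding deviation_def by linarith
  qed
  have int_dev: "integrable M (\<lambda>\<omega>. (deviation j \<omega>) ^ 4)" if "j \<le> N" for j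
    using past_measurable[OF deviation_past] power_mono[OF deviation_bound[OF that] abs_ge_zero, of _ 4]
    by (intro integrable_bounded_function[where c="(H ^ 5) ^ 4"]) (auto simp: power_abs)
  define \<Theta> where "\<Theta> = (\<lambda>j. (LINT \<omega>|M. (deviation j \<omega>) ^ 4) + L ^ 4)"
  define q where "q = (8 * \<eta> * L + (8 * \<eta> * s + 2 * m\<^sup>2)) / L\<^sup>2"
  have q: "real N * q \<le> 1" unfolding q_def using L(1,4) by (simp add: field_simps)
  have step: "\<Theta> (Suc j) \<le> (1 + 15 / real N) * \<Theta> j" if "j < N" for j
  proof -
    have jN: "j \<le> N" "Suc j \<le> N" using that by auto
    note dp = deviation_past[of j] and dM [measurable] = past_measurable[OF deviation_past[of j]]
      and YM [measurable] = past_measurable[OF Y_past[of j]] and iM [measurable] = increment_measurable[of j]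
    note db = deviation_bound[OF jN(1)]
    have increment_bound: "(increment j \<omega>)\<^sup>2 \<le> 10 * H ^ 6" for \<omega>
    proof -
      have "8 * m * Y j \<omega> \<le> 8 * H * H ^ 5"
        using Y_bound[OF jN(1)] H nonneg by (intro mult_mono) auto
      moreover have "m\<^sup>2 \<le> H ^ 6" using power_mono[OF H(4) nonneg(1), of 2] H_pow[of 2 6] by simp
      moreover have "8 * H * H ^ 5 = 8 * H ^ 6" by (simp add: eval_nat_numeral)
      ultimately show ?thesis using increment_sq_le(2)[of j \<omega>] by linarith
    qed
    have increment_abs: "\<bar>increment j \<omega>\<bar> \<le> 10 * H ^ 6" for \<omega>
    proof -
      have "1 \<le> H ^ 6" using H by simp
      then have "10 * H ^ 6 \<le> (10 * H ^ 6)\<^sup>2" using self_le_power[of "10 * H ^ 6" 2] by simp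
      then have "(increment j \<omega>)\<^sup>2 \<le> (10 * H ^ 6)\<^sup>2" using increment_bound[of \<omega>] by linarith
      then show ?thesis using H by (subst (asm) abs_le_square_iff[symmetric]) auto
    qed
    \<comment> \<open>The conditional mean of the increment is \<open>0\<close> up to \<open>\<epsilon>\<close>, so this term would vanish for a martingale.\<close>
    have cube_bound: "\<bar>deviation j \<omega> ^ 3\<bar> \<le> H ^ 15" for \<omega>
      using power_mono[OF db abs_ge_zero, of \<omega> 3] by (simp add: power_abs power_mult[symmetric])
    have cube_past: "(\<lambda>\<omega>. deviation j \<omega> ^ 3) \<in> borel_measurable (F j)" using dp by measurable
    have int_cube: "integrable M (\<lambda>\<omega>. deviation j \<omega> ^ 3)"
      by (rule integrable_bounded_function[OF past_measurable[OF cube_past] cube_bound])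
    have int_S: "integrable M (\<lambda>\<omega>. (deviation j \<omega> ^ 3 * T j k \<omega>) * S j k \<omega>)"
      "integrable M (\<lambda>\<omega>. deviation j \<omega> ^ 3 * (S j k \<omega> * S j k \<omega>))" if "k \<in> J" for k
    proof -
      note [measurable] = S_measurable[OF that] past_measurable[OF T_past[OF that]]
      show "integrable M (\<lambda>\<omega>. (deviation j \<omega> ^ 3 * T j k \<omega>) * S j k \<omega>)"
      proof (rule integrable_bounded_function[where c="(H ^ 15 * H\<^sup>2) * H"])
        show "\<bar>(deviation j \<omega> ^ 3 * T j k \<omega>) * S j k \<omega>\<bar> \<le> (H ^ 15 * H\<^sup>2) * H" for \<omega>
          unfolding abs_mult using cube_bound[of \<omega>] T_bound[OF jN(1) that, of \<omega>] order_trans[OF S_abs_le[OF that] sqrt_m] H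
          by (intro mult_mono) auto
      qed measurable
      show "integrable M (\<lambda>\<omega>. deviation j \<omega> ^ 3 * (S j k \<omega> * S j k \<omega>))"
      proof (rule integrable_bounded_function[where c="H ^ 15 * m"])
        show "\<bar>deviation j \<omega> ^ 3 * (S j k \<omega> * S j k \<omega>)\<bar> \<le> H ^ 15 * m" for \<omega>
          unfolding abs_mult[of "deviation j \<omega> ^ 3"] using cube_bound[of \<omega>] SS_abs_le[OF that that] H nonneg
          by (intro mult_mono) auto
      qed measurable
    qed
    have lin: "(LINT \<omega>|M. deviation j \<omega> ^ 3 * increment j \<omega>) \<le> 3 * H ^ 18 * \<epsilon>"
    proof -
      have "(LINT \<omega>|M. deviation j \<omega> ^ 3 * increment j \<omega>)
        = (LINT \<omega>|M. ((\<Sum>k\<in>J. 2 * ((deviation j \<omega> ^ 3 * T j k \<omega>) * S j k \<omega>) + deviation j \<omega> ^ 3 * (S j k \<omega> * S j k \<omega>)) - deviation j \<omega> ^ 3 * trace j))"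
        by (intro Bochner_Integration.integral_cong refl)
           (simp add: increment_def sum.distrib sum_distrib_left algebra_simps)
      also have "\<dots> = (\<Sum>k\<in>J. 2 * (LINT \<omega>|M. (deviation j \<omega> ^ 3 * T j k \<omega>) * S j k \<omega>) + (LINT \<omega>|M. deviation j \<omega> ^ 3 * (S j k \<omega> * S j k \<omega>)))
          - (LINT \<omega>|M. deviation j \<omega> ^ 3) * trace j"
        using int_S int_cube by (subst Bochner_Integration.integral_diff) (auto simp: Bochner_Integration.integral_sum)
      also have "\<dots> = (\<Sum>k\<in>J. 2 * (LINT \<omega>|M. (deviation j \<omega> ^ 3 * T j k \<omega>) * S j k \<omega>)
          + ((LINT \<omega>|M. deviation j \<omega> ^ 3 * (S j k \<omega> * S j k \<omega>)) - (LINT \<omega>|M. deviation j \<omega> ^ 3) * (LINT \<omega>|M. S j k \<omega> * S j k \<omega>)))"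
        by (simp add: trace_def sum.distrib sum_subtractf sum_distrib_left)
      also have "\<dots> \<le> (\<Sum>k\<in>J. 2 * (H ^ 17 * \<epsilon>) + H ^ 15 * \<epsilon>)"
      proof (intro sum_mono add_mono mult_left_mono)
        fix k assume l: "k \<in> J"
        have "\<bar>LINT \<omega>|M. (deviation j \<omega> ^ 3 * T j k \<omega>) * S j k \<omega>\<bar> \<le> (H ^ 15 * H\<^sup>2) * \<epsilon>"
        proof (rule centred_scaled[OF l])
          show "(\<lambda>\<omega>. deviation j \<omega> ^ 3 * T j k \<omega>) \<in> borel_measurable (F j)" using dp T_past[OF l] by measurable
          show "\<bar>deviation j \<omega> ^ 3 * T j k \<omega>\<bar> \<le> H ^ 15 * H\<^sup>2" for \<omega>
            unfolding abs_mult using cube_bound[of \<omega>] T_bound[OF jN(1) l, of \<omega>] H by (intro mult_mono) auto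
        qed
        then show "(LINT \<omega>|M. (deviation j \<omega> ^ 3 * T j k \<omega>) * S j k \<omega>) \<le> H ^ 17 * \<epsilon>"
          by (simp add: power_add[symmetric] abs_le_iff)
        show "(LINT \<omega>|M. deviation j \<omega> ^ 3 * (S j k \<omega> * S j k \<omega>)) - (LINT \<omega>|M. deviation j \<omega> ^ 3) * (LINT \<omega>|M. S j k \<omega> * S j k \<omega>) \<le> H ^ 15 * \<epsilon>"
          using covariance_scaled[OF l l cube_past cube_bound] by (simp add: abs_le_iff)
      qed simp
      also have "\<dots> \<le> (\<Sum>k\<in>J. 3 * H ^ 17 * \<epsilon>)"
      proof (rule sum_mono)
        show "2 * (H ^ 17 * \<epsilon>) + H ^ 15 * \<epsilon> \<le> 3 * H ^ 17 * \<epsilon>"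
          using mult_right_mono[OF H_pow[of 15 17] nonneg(2)] by (simp add: mult.commute)
      qed
      also have "\<dots> = real (card J) * (3 * H ^ 17 * \<epsilon>)" by simp
      also have "\<dots> \<le> H * (3 * H ^ 17 * \<epsilon>)" using H nonneg by (intro mult_right_mono) auto
      finally show ?thesis by (simp add: eval_nat_numeral)
    qed
    \<comment> \<open>The terms of degree two to four in the increment are merged into one, with a weight from the past.\<close>
    define w where "w = (\<lambda>\<omega>. 8 * (deviation j \<omega>)\<^sup>2 + 3 * (8 * m * Y j \<omega> + 2 * m\<^sup>2))"
    have w_past: "w \<in> borel_measurable (F j)" unfolding w_def using dp Y_past[of j] by measurable
    have w0: "0 \<le> w \<omega>" for \<omega> unfolding w_def using Y_bound(1)[OF jN(1)] nonneg by simp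
    have w_bound: "w \<omega> \<le> 38 * H ^ 10" for \<omega>
    proof -
      have "(deviation j \<omega>)\<^sup>2 \<le> H ^ 10" using power_mono[OF db abs_ge_zero, of \<omega> 2] by simp
      moreover have "8 * m * Y j \<omega> \<le> 8 * H ^ 10"
      proof -
        have "m * Y j \<omega> \<le> H * H ^ 5" using Y_bound[OF jN(1)] H nonneg by (intro mult_mono) auto
        also have "\<dots> \<le> H ^ 10" using H_pow[of 6 10] by (simp add: eval_nat_numeral)
        finally show ?thesis by simp
      qed
      moreover have "m\<^sup>2 \<le> H ^ 10"
        using power_mono[OF H(4) nonneg(1), of 2] H_pow[of 2 10] by auto
      ultimately have "w \<omega> \<le> 8 * H ^ 10 + 3 * (8 * H ^ 10 + 2 * H ^ 10)"
        unfolding w_def by (intro add_mono mult_left_mono) auto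
      then show ?thesis by simp
    qed
    note wM [measurable] = past_measurable[OF w_past]
    define R where "R = (\<lambda>\<omega>. (\<Sum>k\<in>J. S j k \<omega> * T j k \<omega>)\<^sup>2)"
    have R_meas [measurable]: "R \<in> borel_measurable M"
      unfolding R_def using S_measurable past_measurable[OF T_past]
      by (intro borel_measurable_power borel_measurable_sum borel_measurable_times) auto
    have R_bound: "\<bar>R \<omega>\<bar> \<le> H ^ 6" for \<omega>
    proof -
      have "R \<omega> \<le> (\<Sum>k\<in>J. (S j k \<omega>)\<^sup>2) * Y j \<omega>" unfolding R_def Y_def by (rule Cauchy_Schwarz_ineq_sum)
      also have "\<dots> \<le> H * H ^ 5"
        using Y_bound[OF jN(1)] H S_bound[of j \<omega>] by (intro mult_mono) auto
      finally show ?thesis by (simp add: R_def eval_nat_numeral)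
    qed
    have int_wR: "integrable M (\<lambda>\<omega>. w \<omega> * R \<omega>)"
    proof (rule integrable_bounded_function[where c="38 * H ^ 10 * H ^ 6"])
      show "\<bar>w \<omega> * R \<omega>\<bar> \<le> 38 * H ^ 10 * H ^ 6" for \<omega>
        unfolding abs_mult using w0 w_bound R_bound[of \<omega>] H by (intro mult_mono) auto
    qed measurable
    have int_w: "integrable M w"
      by (rule integrable_bounded_function[OF wM, where c="38 * H ^ 10"]) (use w0 w_bound in auto)
    have int_wY: "integrable M (\<lambda>\<omega>. w \<omega> * Y j \<omega>)"
    proof (rule integrable_bounded_function[where c="38 * H ^ 10 * H ^ 5"])
      show "\<bar>w \<omega> * Y j \<omega>\<bar> \<le> 38 * H ^ 10 * H ^ 5" for \<omega>
        unfolding abs_mult using w0 w_bound Y_bound[OF jN(1), of \<omega>] H by (intro mult_mono) auto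
    qed measurable
    have int_winc: "integrable M (\<lambda>\<omega>. w \<omega> * (increment j \<omega>)\<^sup>2)"
    proof (rule integrable_bounded_function[where c="38 * H ^ 10 * (10 * H ^ 6)"])
      show "\<bar>w \<omega> * (increment j \<omega>)\<^sup>2\<bar> \<le> 38 * H ^ 10 * (10 * H ^ 6)" for \<omega>
        unfolding abs_mult using w0 w_bound increment_bound[of \<omega>] H by (intro mult_mono) auto
    qed measurable
    have quad: "(LINT \<omega>|M. w \<omega> * (increment j \<omega>)\<^sup>2) \<le> 14 * q * \<Theta> j + 304 * H ^ 18 * \<epsilon>"
    proof -
      have "(LINT \<omega>|M. w \<omega> * (increment j \<omega>)\<^sup>2) \<le> (LINT \<omega>|M. 8 * (w \<omega> * R \<omega>) + 2 * m\<^sup>2 * w \<omega>)"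
      proof (rule integral_mono)
        fix \<omega>
        show "w \<omega> * (increment j \<omega>)\<^sup>2 \<le> 8 * (w \<omega> * R \<omega>) + 2 * m\<^sup>2 * w \<omega>"
          using mult_left_mono[OF increment_sq_le(1)[of j \<omega>] w0[of \<omega>]] by (simp add: R_def algebra_simps)
      qed (use int_winc int_wR int_w in auto)
      also have "\<dots> = 8 * (LINT \<omega>|M. w \<omega> * R \<omega>) + 2 * m\<^sup>2 * (LINT \<omega>|M. w \<omega>)"
        using int_wR int_w by simp
      also have "(LINT \<omega>|M. w \<omega> * R \<omega>) \<le> \<eta> * (LINT \<omega>|M. w \<omega> * Y j \<omega>)
          + real (card J) * real (card J) * (38 * H ^ 10 * (H\<^sup>2 * H\<^sup>2) * \<epsilon>)"
        unfolding R_def by (rule cross_term_le[OF w_past w0 w_bound T_bound[OF jN(1)]])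
      also have "real (card J) * real (card J) * (38 * H ^ 10 * (H\<^sup>2 * H\<^sup>2) * \<epsilon>) \<le> H * H * (38 * H ^ 10 * (H\<^sup>2 * H\<^sup>2) * \<epsilon>)"
        using H nonneg by (intro mult_mono) auto
      also have "H * H * (38 * H ^ 10 * (H\<^sup>2 * H\<^sup>2) * \<epsilon>) = 38 * H ^ 16 * \<epsilon>" by (simp add: eval_nat_numeral)
      also have "38 * H ^ 16 * \<epsilon> \<le> 38 * H ^ 18 * \<epsilon>" using H_pow[of 16 18] nonneg by (intro mult_right_mono) auto
      also have "8 * (\<eta> * (LINT \<omega>|M. w \<omega> * Y j \<omega>) + 38 * H ^ 18 * \<epsilon>) + 2 * m\<^sup>2 * (LINT \<omega>|M. w \<omega>)
          = (LINT \<omega>|M. w \<omega> * (8 * \<eta> * Y j \<omega> + 2 * m\<^sup>2)) + 304 * H ^ 18 * \<epsilon>"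
      proof -
        have "(LINT \<omega>|M. w \<omega> * (8 * \<eta> * Y j \<omega> + 2 * m\<^sup>2)) = (LINT \<omega>|M. 8 * \<eta> * (w \<omega> * Y j \<omega>) + 2 * m\<^sup>2 * w \<omega>)"
          by (intro Bochner_Integration.integral_cong refl) (simp add: algebra_simps)
        also have "\<dots> = 8 * \<eta> * (LINT \<omega>|M. w \<omega> * Y j \<omega>) + 2 * m\<^sup>2 * (LINT \<omega>|M. w \<omega>)"
          using int_wY int_w by simp
        finally show ?thesis by simp
      qed
      also have "(LINT \<omega>|M. w \<omega> * (8 * \<eta> * Y j \<omega> + 2 * m\<^sup>2)) \<le> (LINT \<omega>|M. 14 * q * ((deviation j \<omega>) ^ 4 + L ^ 4))"
      proof (rule integral_mono)
        have "integrable M (\<lambda>\<omega>. 8 * \<eta> * (w \<omega> * Y j \<omega>) + 2 * m\<^sup>2 * w \<omega>)" using int_wY int_w by simp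
        then show "integrable M (\<lambda>\<omega>. w \<omega> * (8 * \<eta> * Y j \<omega> + 2 * m\<^sup>2))" by (simp add: algebra_simps)
        show "integrable M (\<lambda>\<omega>. 14 * q * ((deviation j \<omega>) ^ 4 + L ^ 4))" using int_dev[OF jN(1)] by simp
        fix \<omega>
        define x where "x = \<bar>deviation j \<omega>\<bar>"
        have Yx: "Y j \<omega> \<le> x + s" using partial[OF jN(1)] by (auto simp: x_def deviation_def)
        have "8 * m * Y j \<omega> \<le> 8 * m * (x + s)" using Yx nonneg by (intro mult_left_mono) auto
        moreover have "8 * m * x \<le> x * L" using mult_right_mono[OF L(2), of x] by (simp add: x_def mult.commute)
        ultimately have "8 * m * Y j \<omega> + 2 * m\<^sup>2 \<le> x * L + L\<^sup>2" using L(3) by (simp add: algebra_simps)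
        then have "w \<omega> \<le> 8 * x\<^sup>2 + 3 * (x * L + L\<^sup>2)" unfolding w_def x_def by simp
        moreover have "8 * \<eta> * Y j \<omega> + 2 * m\<^sup>2 \<le> (8 * \<eta>) * x + (8 * \<eta> * s + 2 * m\<^sup>2)"
          using mult_left_mono[OF Yx, of "8 * \<eta>"] nonneg by (simp add: algebra_simps)
        ultimately have "w \<omega> * (8 * \<eta> * Y j \<omega> + 2 * m\<^sup>2)
            \<le> (8 * x\<^sup>2 + 3 * (x * L + L\<^sup>2)) * ((8 * \<eta>) * x + (8 * \<eta> * s + 2 * m\<^sup>2))"
          using w0[of \<omega>] Y_bound(1)[OF jN(1), of \<omega>] nonneg L(1) by (intro mult_mono) (auto simp: x_def)
        also have "\<dots> \<le> 14 * q * (x ^ 4 + L ^ 4)"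
          unfolding q_def using L(1) nonneg s0 by (intro quadratic_times_linear_le) (auto simp: x_def)
        finally show "w \<omega> * (8 * \<eta> * Y j \<omega> + 2 * m\<^sup>2) \<le> 14 * q * ((deviation j \<omega>) ^ 4 + L ^ 4)"
          by (simp add: x_def)
      qed
      also have "\<dots> = 14 * q * \<Theta> j" using int_dev[OF jN(1)] by (simp add: \<Theta>_def prob_space)
      finally show ?thesis by simp
    qed
    have "(LINT \<omega>|M. (deviation (Suc j) \<omega>) ^ 4) \<le> (LINT \<omega>|M. (deviation j \<omega>) ^ 4 + 4 * (deviation j \<omega> ^ 3 * increment j \<omega>) + w \<omega> * (increment j \<omega>)\<^sup>2)"
    proof (rule integral_mono)
      have "integrable M (\<lambda>\<omega>. deviation j \<omega> ^ 3 * increment j \<omega>)"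
      proof (rule integrable_bounded_function[where c="H ^ 15 * (10 * H ^ 6)"])
        show "\<bar>deviation j \<omega> ^ 3 * increment j \<omega>\<bar> \<le> H ^ 15 * (10 * H ^ 6)" for \<omega>
          unfolding abs_mult using cube_bound[of \<omega>] increment_abs[of \<omega>] H by (intro mult_mono) auto
      qed measurable
      then show "integrable M (\<lambda>\<omega>. (deviation j \<omega>) ^ 4 + 4 * (deviation j \<omega> ^ 3 * increment j \<omega>) + w \<omega> * (increment j \<omega>)\<^sup>2)"
        using int_dev[OF jN(1)] int_winc by simp
      fix \<omega>
      have "(increment j \<omega>)\<^sup>2 * (increment j \<omega>)\<^sup>2 \<le> (8 * m * Y j \<omega> + 2 * m\<^sup>2) * (increment j \<omega>)\<^sup>2"
        by (rule mult_right_mono[OF increment_sq_le(2)]) simp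
      then show "(deviation (Suc j) \<omega>) ^ 4 \<le> (deviation j \<omega>) ^ 4 + 4 * (deviation j \<omega> ^ 3 * increment j \<omega>) + w \<omega> * (increment j \<omega>)\<^sup>2"
        using pow4_increment_le[of "deviation j \<omega>" "increment j \<omega>"] unfolding deviation_Suc w_def by (simp add: algebra_simps)
    qed (rule int_dev[OF jN(2)])
    also have "\<dots> = (LINT \<omega>|M. (deviation j \<omega>) ^ 4) + 4 * (LINT \<omega>|M. deviation j \<omega> ^ 3 * increment j \<omega>) + (LINT \<omega>|M. w \<omega> * (increment j \<omega>)\<^sup>2)"
    proof -
      have "integrable M (\<lambda>\<omega>. deviation j \<omega> ^ 3 * increment j \<omega>)"
      proof (rule integrable_bounded_function[where c="H ^ 15 * (10 * H ^ 6)"])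
        show "\<bar>deviation j \<omega> ^ 3 * increment j \<omega>\<bar> \<le> H ^ 15 * (10 * H ^ 6)" for \<omega>
          unfolding abs_mult using cube_bound[of \<omega>] increment_abs[of \<omega>] H by (intro mult_mono) auto
      qed measurable
      then show ?thesis using int_dev[OF jN(1)] int_winc by simp
    qed
    also have "\<dots> \<le> (LINT \<omega>|M. (deviation j \<omega>) ^ 4) + 4 * (3 * H ^ 18 * \<epsilon>) + (14 * q * \<Theta> j + 304 * H ^ 18 * \<epsilon>)"
      using lin quad by (intro add_mono mult_left_mono) auto
    finally have "\<Theta> (Suc j) \<le> \<Theta> j + 14 * q * \<Theta> j + 316 * H ^ 18 * \<epsilon>" by (simp add: \<Theta>_def mult_ac)
    moreover have \<Theta>L: "L ^ 4 \<le> \<Theta> j" by (simp add: \<Theta>_def Bochner_Integration.integral_nonneg)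
    have "q \<le> 1 / real N" using q N by (simp add: field_simps)
    then have "14 * q * \<Theta> j \<le> 14 * (1 / real N) * \<Theta> j"
      using \<Theta>L L(1) by (intro mult_right_mono mult_left_mono) (auto intro: order_trans[of _ "L ^ 4"])
    moreover have "316 * H ^ 18 * \<epsilon> \<le> 1 / real N * \<Theta> j"
      using L(5) \<Theta>L N by (simp add: field_simps)
    ultimately have "\<Theta> (Suc j) \<le> \<Theta> j + 14 * (1 / real N) * \<Theta> j + 1 / real N * \<Theta> j" by linarith
    also have "\<dots> = (1 + 15 / real N) * \<Theta> j" by (simp add: algebra_simps)
    finally show ?thesis .
  qed
  have "\<Theta> j \<le> (1 + 15 / real N) ^ j * L ^ 4" if "j \<le> N" for j
    using that
  proof (induction j)
    case 0
    then show ?case by (simp add: \<Theta>_def deviation_def Y_def T_def)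
  next
    case (Suc j)
    have "\<Theta> (Suc j) \<le> (1 + 15 / real N) * \<Theta> j" using Suc by (intro step) auto
    also have "\<dots> \<le> (1 + 15 / real N) * ((1 + 15 / real N) ^ j * L ^ 4)"
      using Suc by (intro mult_left_mono) auto
    finally show ?case by (simp add: mult.assoc)
  qed
  from this[of N] have "\<Theta> N \<le> (1 + 15 / real N) ^ N * L ^ 4" by simp
  also have "(1 + 15 / real N) ^ N \<le> exp (15 / real N) ^ N"
    by (intro power_mono exp_ge_add_one_self) auto
  also have "exp (15 / real N) ^ N = exp 15" using N by (simp add: exp_of_nat_mult[symmetric])
  finally have "\<Theta> N \<le> exp 15 * L ^ 4" using L(1) by (simp add: mult_right_mono)
  moreover have "(LINT \<omega>|M. (deviation N \<omega>) ^ 4) \<le> \<Theta> N" using L(1) by (simp add: \<Theta>_def)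
  ultimately show "(LINT \<omega>|M. (deviation N \<omega>) ^ 4) \<le> exp 15 * L ^ 4" by linarith
  show "integrable M (\<lambda>\<omega>. (deviation N \<omega>) ^ 4)" by (rule int_dev) simp
qed

corollary excess_bound:
  assumes "0 < N" "1 \<le> H" "real N \<le> H" "real (card J) \<le> H" "m \<le> H"
    "(\<Sum>j<N. trace j) \<le> s"
    "0 < L" "8 * m \<le> L" "8 * m * s + 2 * m\<^sup>2 \<le> L\<^sup>2"
      "real N * (8 * \<eta> * L + (8 * \<eta> * s + 2 * m\<^sup>2)) \<le> L\<^sup>2" "real N * (316 * H ^ 18 * \<epsilon>) \<le> L ^ 4"
    and a: "0 < a"
  shows "integrable M (\<lambda>\<omega>. max 0 (Y N \<omega> - s - a))"
    "(LINT \<omega>|M. max 0 (Y N \<omega> - s - a)) \<le> exp 15 * L ^ 4 / a ^ 3"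
proof -
  note four = fourth_moment_bound[OF assms(1-11)]
  have le: "max 0 (Y N \<omega> - s - a) \<le> deviation N \<omega> ^ 4 / a ^ 3" for \<omega>
  proof (cases "Y N \<omega> - s - a \<le> 0")
    case True
    then show ?thesis using a by (simp add: zero_le_even_power)
  next
    case False
    define d where "d = deviation N \<omega>"
    have "Y N \<omega> - s \<le> d" using assms(6) by (simp add: d_def deviation_def)
    then have d: "a < d" "Y N \<omega> - s - a \<le> d" using False a by auto
    have "d * a ^ 3 \<le> d * d ^ 3" using d a by (intro mult_left_mono power_mono) auto
    then have "d \<le> d ^ 4 / a ^ 3" using a by (simp add: field_simps eval_nat_numeral)
    then show ?thesis using False d by (simp add: d_def)
  qed
  have [measurable]: "Y N \<in> borel_measurable M" by (rule past_measurable[OF Y_past])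
  show int: "integrable M (\<lambda>\<omega>. max 0 (Y N \<omega> - s - a))"
    by (rule Bochner_Integration.integrable_bound[where f="\<lambda>\<omega>. deviation N \<omega> ^ 4 / a ^ 3"])
       (use le four(1) a in \<open>auto intro: order_trans\<close>)
  have "(LINT \<omega>|M. max 0 (Y N \<omega> - s - a)) \<le> (LINT \<omega>|M. deviation N \<omega> ^ 4 / a ^ 3)"
    using int four(1) le by (intro integral_mono) auto
  also have "\<dots> \<le> exp 15 * L ^ 4 / a ^ 3" using four(2) a by (simp add: divide_right_mono)
  finally show "(LINT \<omega>|M. max 0 (Y N \<omega> - s - a)) \<le> exp 15 * L ^ 4 / a ^ 3" .
qed

end

section \<open>The Markov property and mixing\<close>

text \<open>
A stationary chain that forgets its initial state at a geometric rate on average; \<open>b k x\<close> bounds the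
distance between \<open>P\<^sup>k(x, \<cdot>)\<close> and \<open>\<mu>\<close>.
\<close>

locale mean_ergodic_chain =
  fixes M :: "'a measure" and X :: "nat \<Rightarrow> 'a \<Rightarrow> real" and P :: "real \<Rightarrow> real measure"
    and \<mu> :: "real measure" and b :: "nat \<Rightarrow> real \<Rightarrow> real" and A r :: real
  assumes chain: "markov_chain M X P"
    and stationary: "stationary_distribution P \<mu>"
    and initial: "distr M borel (X 0) = \<mu>"
    and A: "0 \<le> A" and r: "0 < r" "r < 1"
    and b_bounded: "\<And>k. \<exists>c. borel_bounded c (b k)"
    and b_nonneg: "\<And>k x. 0 \<le> b k x" and b_mean: "\<And>k. (LINT x|\<mu>. b k x) \<le> A * r ^ k"
    and ergodic: "\<And>B \<phi> k x. borel_bounded B \<phi> \<Longrightarrow>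
      \<bar>(kernel_op P ^^ k) \<phi> x - (LINT x|\<mu>. \<phi> x)\<bar> \<le> B * b k x"
begin

lemma P: "markov_kernel P" and X [measurable]: "X n \<in> borel_measurable M"
  using chain by (auto simp: markov_chain_def)

sublocale prob_space M using chain by (simp add: markov_chain_def)

lemma mu_prob: "prob_space \<mu>" "sets \<mu> = sets borel" "\<mu> \<bind> P = \<mu>"
  using stationary by (auto simp: stationary_distribution_def)

abbreviation "F \<equiv> natural_filtration M X"

lemma sets_F: "sets (F n) = sigma_sets (space M) (\<Union>i\<le>n. {X i -` A \<inter> space M | A. A \<in> sets borel})"
  unfolding natural_filtration_def by (rule sets_measure_of) auto

lemma space_F: "space (F n) = space M"
  unfolding natural_filtration_def by (rule space_measure_of) auto

lemma F_subalgebra: "subalgebra M (F n)"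
  unfolding subalgebra_def space_F sets_F
  by (auto intro!: sets.sigma_sets_subset measurable_sets[OF X])

lemma F_mono: "m \<le> n \<Longrightarrow> subalgebra (F n) (F m)"
  unfolding subalgebra_def space_F sets_F by (intro conjI refl sigma_sets_mono' UN_mono) auto

lemma X_F: "i \<le> n \<Longrightarrow> X i \<in> borel_measurable (F n)"
proof (rule measurableI)
  fix A :: "real set" assume "A \<in> sets borel" "i \<le> n"
  then show "X i -` A \<inter> space (F n) \<in> sets (F n)" unfolding space_F sets_F by blast
qed (simp add: space_F)

lemma F_measurable_M: "w \<in> borel_measurable (F n) \<Longrightarrow> w \<in> borel_measurable M"
  using measurable_from_subalg[OF F_subalgebra] .

lemma F_measurable_mono: "m \<le> n \<Longrightarrow> w \<in> borel_measurable (F m) \<Longrightarrow> w \<in> borel_measurable (F n)"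
  using measurable_from_subalg[OF F_mono] .

text \<open>
The defining property of the chain concerns indicators of sets. For a nonnegative past weight \<open>w\<close> it
says that two finite measures on the line agree, so that all bounded integrals agree.
\<close>

lemma markov_one_step_nonneg:
  assumes w: "w \<in> borel_measurable (F l)" "\<And>\<omega>. 0 \<le> w \<omega>" "\<And>\<omega>. w \<omega> \<le> c" and \<phi>: "borel_bounded B \<phi>"
  shows "(LINT \<omega>|M. w \<omega> * \<phi> (X (Suc l) \<omega>)) = (LINT \<omega>|M. w \<omega> * kernel_op P \<phi> (X l \<omega>))"
proof -
  note [measurable] = F_measurable_M[OF w(1)] borel_bounded_measurable[OF \<phi>]
    borel_bounded_measurable[OF kernel_op_bounded[OF P \<phi>]] kernel_measurable[OF P]
  have c: "0 \<le> c" using w(2,3)[of undefined] by linarith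
  interpret S: sigma_finite_subalgebra M "F l"
    by (intro finite_measure_subalgebra_is_sigma_finite finite_measure_subalgebra.intro
        finite_measure_axioms finite_measure_subalgebra_axioms.intro F_subalgebra)
  define N where "N = density M (\<lambda>\<omega>. ennreal (w \<omega>))"
  have wi: "integrable M w" by (rule integrable_bounded_function[where c=c]) (use w in auto)
  have N: "finite_measure N"
  proof (rule finite_measureI)
    have "emeasure N (space N) = (\<integral>\<^sup>+\<omega>. ennreal (w \<omega>) \<partial>M)"
      unfolding N_def by (subst emeasure_density) (auto intro!: nn_integral_cong)
    also have "\<dots> = ennreal (LINT \<omega>|M. w \<omega>)" using w wi by (intro nn_integral_eq_integral) auto
    finally show "emeasure N (space N) \<noteq> \<infinity>" by simp
  qed
  have [simp]: "space N = space M" "sets N = sets M" by (simp_all add: N_def)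
  have XN [measurable]: "X n \<in> borel_measurable N" for n by (simp add: N_def)
  have Nl: "finite_measure (distr N borel (X l))" by (rule finite_measure.finite_measure_distr[OF N]) simp
  have "distr N borel (X (Suc l)) = distr N borel (X l) \<bind> P" (is "?L = ?R")
  proof (rule measure_eqI)
    have sR: "sets ?R = sets borel" by (rule sets_bind) (use kernel_sets[OF P] in auto)
    show "sets ?L = sets ?R" by (simp add: sR)
    fix E assume "E \<in> sets ?L"
    then have E [measurable]: "E \<in> sets borel" by simp
    have [measurable]: "(\<lambda>x. measure (P x) E) \<in> borel_measurable borel"
      using measurable_compose[OF kernel_measurable[OF P] measurable_measure_subprob_algebra[OF E]] .
    have "emeasure ?L E = (\<integral>\<^sup>+x. indicator E x \<partial>?L)" by simp
    also have "\<dots> = (\<integral>\<^sup>+\<omega>. indicator E (X (Suc l) \<omega>) \<partial>N)"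
      by (rule nn_integral_distr) auto
    also have "\<dots> = (\<integral>\<^sup>+\<omega>. ennreal (w \<omega> * indicator E (X (Suc l) \<omega>)) \<partial>M)"
      unfolding N_def using w
      by (subst nn_integral_density) (auto intro!: nn_integral_cong simp: ennreal_mult ennreal_indicator)
    also have "\<dots> = ennreal (LINT \<omega>|M. w \<omega> * indicator E (X (Suc l) \<omega>))"
      by (intro nn_integral_eq_integral integrable_bounded_function[where c=c])
         (use w c in \<open>auto split: split_indicator\<close>)
    also have "(LINT \<omega>|M. w \<omega> * indicator E (X (Suc l) \<omega>))
        = (LINT \<omega>|M. w \<omega> * real_cond_exp M (F l) (\<lambda>\<omega>. indicator E (X (Suc l) \<omega>)) \<omega>)"
      by (rule S.real_cond_exp_intg(2)[symmetric])
         (use w c in \<open>auto intro!: integrable_bounded_function[where c=c] split: split_indicator\<close>)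
    also have "\<dots> = (LINT \<omega>|M. w \<omega> * measure (P (X l \<omega>)) E)"
    proof (rule integral_cong_AE)
      have "AE \<omega> in M. real_cond_exp M (F l) (\<lambda>\<omega>. indicator E (X (Suc l) \<omega>)) \<omega> = measure (P (X l \<omega>)) E"
        using chain E unfolding markov_chain_def by blast
      then show "AE \<omega> in M. w \<omega> * real_cond_exp M (F l) (\<lambda>\<omega>. indicator E (X (Suc l) \<omega>)) \<omega>
          = w \<omega> * measure (P (X l \<omega>)) E" by auto
    qed auto
    also have "ennreal \<dots> = (\<integral>\<^sup>+\<omega>. ennreal (w \<omega> * measure (P (X l \<omega>)) E) \<partial>M)"
    proof (rule nn_integral_eq_integral[symmetric])
      show "integrable M (\<lambda>\<omega>. w \<omega> * measure (P (X l \<omega>)) E)"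
      proof (rule integrable_bounded_function[where c=c])
        fix \<omega>
        have "w \<omega> * measure (P (X l \<omega>)) E \<le> c * 1"
          using w prob_space.prob_le_1[OF kernel_prob[OF P]] by (intro mult_mono) (auto intro: order_trans)
        then show "\<bar>w \<omega> * measure (P (X l \<omega>)) E\<bar> \<le> c" using w by auto
      qed measurable
    qed (use w in auto)
    also have "\<dots> = (\<integral>\<^sup>+\<omega>. emeasure (P (X l \<omega>)) E \<partial>N)"
      unfolding N_def using w
      by (subst nn_integral_density)
         (auto intro!: nn_integral_cong simp: ennreal_mult finite_measure.emeasure_eq_measure[OF prob_space.finite_measure[OF kernel_prob[OF P]]]
            measurable_compose[OF X measurable_compose[OF kernel_measurable[OF P] measurable_emeasure_subprob_algebra[OF E]]])
    also have "\<dots> = (\<integral>\<^sup>+x. emeasure (P x) E \<partial>distr N borel (X l))"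
      by (subst nn_integral_distr)
         (auto intro!: measurable_compose[OF kernel_measurable[OF P] measurable_emeasure_subprob_algebra[OF E]])
    also have "\<dots> = emeasure ?R E"
      by (subst emeasure_bind[where N=borel]) (auto simp: kernel_measurable[OF P] cong: measurable_cong_sets)
    finally show "emeasure ?L E = emeasure ?R E" .
  qed
  then have "(LINT x|?L. \<phi> x) = (LINT x|?R. \<phi> x)" by simp
  moreover have "(LINT x|?R. \<phi> x) = (LINT x|distr N borel (X l). kernel_op P \<phi> x)"
    unfolding kernel_op_def
    by (rule integral_bind[where K=borel and B=B and B'=1])
       (use \<phi> Nl kernel_prob[OF P] in \<open>auto simp: borel_bounded_def prob_space.emeasure_space_1 kernel_measurable[OF P]\<close>)
  ultimately have "(LINT \<omega>|N. \<phi> (X (Suc l) \<omega>)) = (LINT \<omega>|N. kernel_op P \<phi> (X l \<omega>))"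
    by (simp add: integral_distr)
  then show ?thesis unfolding N_def using w by (simp add: integral_density)
qed

lemma integrable_mult_X:
  assumes w: "w \<in> borel_measurable M" "\<And>\<omega>. \<bar>w \<omega>\<bar> \<le> c" and \<phi>: "borel_bounded B \<phi>"
  shows "integrable M (\<lambda>\<omega>. w \<omega> * \<phi> (X n \<omega>))"
proof (rule integrable_bounded_function[where c="c * B"])
  show "(\<lambda>\<omega>. w \<omega> * \<phi> (X n \<omega>)) \<in> borel_measurable M"
    using w borel_bounded_measurable[OF \<phi>] by measurable
  show "\<bar>w \<omega> * \<phi> (X n \<omega>)\<bar> \<le> c * B" for \<omega>
    unfolding abs_mult using w borel_bounded_abs_le[OF \<phi>] by (intro mult_mono) (auto intro: order_trans[OF abs_ge_zero])
qed

lemma markov_one_step: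
  assumes w: "w \<in> borel_measurable (F l)" "\<And>\<omega>. \<bar>w \<omega>\<bar> \<le> c" and \<phi>: "borel_bounded B \<phi>"
  shows "(LINT \<omega>|M. w \<omega> * \<phi> (X (Suc l) \<omega>)) = (LINT \<omega>|M. w \<omega> * kernel_op P \<phi> (X l \<omega>))"
proof -
  have c: "0 \<le> c" using w(2) abs_ge_zero order_trans by blast
  note wM = F_measurable_M[OF w(1)] and P\<phi> = kernel_op_bounded[OF P \<phi>]
  have "(LINT \<omega>|M. (w \<omega> + c) * \<phi> (X (Suc l) \<omega>)) = (LINT \<omega>|M. (w \<omega> + c) * kernel_op P \<phi> (X l \<omega>))"
  proof (rule markov_one_step_nonneg[OF _ _ _ \<phi>, where c="c + c"])
    show "(\<lambda>\<omega>. w \<omega> + c) \<in> borel_measurable (F l)" using w by measurable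
    show "0 \<le> w \<omega> + c" "w \<omega> + c \<le> c + c" for \<omega> using w(2)[of \<omega>] by (auto simp: abs_le_iff)
  qed
  moreover have "(LINT \<omega>|M. c * \<phi> (X (Suc l) \<omega>)) = (LINT \<omega>|M. c * kernel_op P \<phi> (X l \<omega>))"
    by (rule markov_one_step_nonneg[OF _ _ _ \<phi>, where c=c]) (use c in auto)
  moreover have split: "(LINT \<omega>|M. (w \<omega> + c) * \<psi> (X n \<omega>)) = (LINT \<omega>|M. w \<omega> * \<psi> (X n \<omega>)) + (LINT \<omega>|M. c * \<psi> (X n \<omega>))"
    if "borel_bounded B \<psi>" for \<psi> n
    using integrable_mult_X[OF wM w(2) that] integrable_mult_X[of "\<lambda>_. c" "\<bar>c\<bar>", OF _ _ that]
    by (simp add: distrib_right)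
  ultimately show ?thesis using split[OF \<phi>, of "Suc l"] split[OF P\<phi>, of l] by linarith
qed

lemma markov_property:
  assumes w: "w \<in> borel_measurable (F l)" "\<And>\<omega>. \<bar>w \<omega>\<bar> \<le> c" and \<phi>: "borel_bounded B \<phi>"
  shows "(LINT \<omega>|M. w \<omega> * \<phi> (X (l + k) \<omega>)) = (LINT \<omega>|M. w \<omega> * (kernel_op P ^^ k) \<phi> (X l \<omega>))"
  using \<phi>
proof (induction k arbitrary: \<phi>)
  case (Suc k)
  have "(LINT \<omega>|M. w \<omega> * \<phi> (X (l + Suc k) \<omega>)) = (LINT \<omega>|M. w \<omega> * kernel_op P \<phi> (X (l + k) \<omega>))"
    using markov_one_step[OF F_measurable_mono[OF _ w(1)] w(2) Suc(2), of "l + k"] by simp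
  also have "\<dots> = (LINT \<omega>|M. w \<omega> * (kernel_op P ^^ k) (kernel_op P \<phi>) (X l \<omega>))"
    by (rule Suc(1)[OF kernel_op_bounded[OF P Suc(2)]])
  finally show ?case by (simp add: funpow_swap1)
qed simp

lemma expectation_X: assumes \<phi>: "borel_bounded B \<phi>" shows "(LINT \<omega>|M. \<phi> (X n \<omega>)) = (LINT x|\<mu>. \<phi> x)"
proof -
  have pow: "(LINT x|\<mu>. (kernel_op P ^^ n) \<phi> x) = (LINT x|\<mu>. \<phi> x)"
    using \<phi>
  proof (induction n arbitrary: \<phi>)
    case (Suc n)
    show ?case
      using Suc(1)[OF kernel_op_bounded[OF P Suc(2)]] integral_bind_kernel[OF P mu_prob(1,2) Suc(2)] mu_prob(3)
      by (simp add: funpow_swap1)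
  qed simp
  have "(LINT \<omega>|M. \<phi> (X n \<omega>)) = (LINT \<omega>|M. (kernel_op P ^^ n) \<phi> (X 0 \<omega>))"
    using markov_property[of "\<lambda>_. 1" 0 1, OF _ _ \<phi>, of n] by simp
  also have "\<dots> = (LINT x|distr M borel (X 0). (kernel_op P ^^ n) \<phi> x)"
    using borel_bounded_measurable[OF kernel_op_pow_bounded[OF P \<phi>]] by (subst integral_distr) auto
  finally show ?thesis by (simp add: initial pow)
qed

text \<open>
The only form of mixing that is used: a bounded function of the past and a function of a single later
state are nearly uncorrelated.
\<close>

lemma mixing:
  assumes w: "w \<in> borel_measurable (F l)" "\<And>\<omega>. \<bar>w \<omega>\<bar> \<le> c" and \<phi>: "borel_bounded B \<phi>"
  shows "\<bar>(LINT \<omega>|M. w \<omega> * \<phi> (X (l + k) \<omega>)) - (LINT \<omega>|M. w \<omega>) * (LINT x|\<mu>. \<phi> x)\<bar> \<le> c * B * (A * r ^ k)"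
proof -
  define m where "m = (LINT x|\<mu>. \<phi> x)"
  have c: "0 \<le> c" using w(2) abs_ge_zero order_trans by blast
  have B: "0 \<le> B" using borel_bounded_nonneg[OF \<phi>] .
  note wM = F_measurable_M[OF w(1)] and P\<phi> = kernel_op_pow_bounded[OF P \<phi>, of k]
  obtain d where d: "borel_bounded d (b k)" using b_bounded by blast
  note [measurable] = wM borel_bounded_measurable[OF P\<phi>] borel_bounded_measurable[OF d]
  have int: "integrable M (\<lambda>\<omega>. w \<omega> * (kernel_op P ^^ k) \<phi> (X l \<omega>))"
    by (rule integrable_mult_X[OF wM w(2) P\<phi>])
  have intw: "integrable M w" by (rule integrable_bounded_function[OF wM w(2)])
  have intb: "integrable M (\<lambda>\<omega>. b k (X l \<omega>))"
    using integrable_mult_X[of "\<lambda>_. 1" 1, OF _ _ d] by simp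
  have "(LINT \<omega>|M. w \<omega> * \<phi> (X (l + k) \<omega>)) - (LINT \<omega>|M. w \<omega>) * m
      = (LINT \<omega>|M. w \<omega> * ((kernel_op P ^^ k) \<phi> (X l \<omega>) - m))"
    unfolding markov_property[OF w \<phi>] using int intw by (simp add: right_diff_distrib)
  also have "\<bar>\<dots>\<bar> \<le> (LINT \<omega>|M. \<bar>w \<omega> * ((kernel_op P ^^ k) \<phi> (X l \<omega>) - m)\<bar>)"
    using integral_norm_bound[of M "\<lambda>\<omega>. w \<omega> * ((kernel_op P ^^ k) \<phi> (X l \<omega>) - m)"] by simp
  also have "\<dots> \<le> (LINT \<omega>|M. c * B * b k (X l \<omega>))"
  proof (rule integral_mono)
    show "integrable M (\<lambda>\<omega>. \<bar>w \<omega> * ((kernel_op P ^^ k) \<phi> (X l \<omega>) - m)\<bar>)"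
      using int intw by (auto simp: right_diff_distrib)
    show "integrable M (\<lambda>\<omega>. c * B * b k (X l \<omega>))" using intb by simp
    fix \<omega>
    show "\<bar>w \<omega> * ((kernel_op P ^^ k) \<phi> (X l \<omega>) - m)\<bar> \<le> c * B * b k (X l \<omega>)"
      unfolding abs_mult mult.assoc using w(2) ergodic[OF \<phi>] c by (intro mult_mono) (auto simp: m_def)
  qed
  also have "\<dots> = c * B * (LINT x|\<mu>. b k x)" by (simp add: expectation_X[OF d])
  also have "\<dots> \<le> c * B * (A * r ^ k)" using b_mean c B by (intro mult_left_mono) auto
  finally show ?thesis unfolding m_def .
qed

end

section \<open>Quadratic forms of a stationary chain\<close>

definition gap :: "nat \<Rightarrow> nat \<Rightarrow> nat" where "gap i j = (if i \<le> j then j - i else i - j)"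

lemma gap_Suc [simp]: "gap (Suc i) (Suc j) = gap i j"
  by (simp add: gap_def)

lemma sum_geometric_gap_le:
  fixes \<theta> :: real
  assumes I: "finite I" and \<theta>: "0 \<le> \<theta>" "\<theta> < 1"
  shows "(\<Sum>i\<in>I. \<Sum>j\<in>I. \<theta> ^ gap i j) \<le> real (card I) * (2 / (1 - \<theta>))"
proof -
  have fin: "(\<Sum>k\<in>K. \<theta> ^ k) \<le> 1 / (1 - \<theta>)" if "finite K" for K
  proof -
    have "(\<Sum>k\<in>K. \<theta> ^ k) \<le> (\<Sum>k. \<theta> ^ k)"
      using \<theta> that by (intro sum_le_suminf) (auto intro: summable_geometric)
    then show ?thesis using \<theta> by (simp add: suminf_geometric)
  qed
  have "(\<Sum>j\<in>I. \<theta> ^ gap i j) \<le> 2 / (1 - \<theta>)" for i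
  proof -
    have "(\<Sum>j\<in>I. \<theta> ^ gap i j) = (\<Sum>j\<in>{j \<in> I. i \<le> j}. \<theta> ^ gap i j) + (\<Sum>j\<in>{j \<in> I. \<not> i \<le> j}. \<theta> ^ gap i j)"
      using I by (subst sum.union_disjoint[symmetric]) (auto intro: sum.cong)
    also have "(\<Sum>j\<in>{j \<in> I. i \<le> j}. \<theta> ^ gap i j) = (\<Sum>k\<in>(\<lambda>j. j - i) ` {j \<in> I. i \<le> j}. \<theta> ^ k)"
      by (subst sum.reindex) (auto simp: inj_on_def gap_def)
    also have "(\<Sum>j\<in>{j \<in> I. \<not> i \<le> j}. \<theta> ^ gap i j) = (\<Sum>k\<in>(\<lambda>j. i - j) ` {j \<in> I. \<not> i \<le> j}. \<theta> ^ k)"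
      by (subst sum.reindex) (auto simp: inj_on_def gap_def)
    also have "(\<Sum>k\<in>(\<lambda>j. j - i) ` {j \<in> I. i \<le> j}. \<theta> ^ k) + (\<Sum>k\<in>(\<lambda>j. i - j) ` {j \<in> I. \<not> i \<le> j}. \<theta> ^ k)
        \<le> 1 / (1 - \<theta>) + 1 / (1 - \<theta>)"
      using I by (intro add_mono fin) auto
    finally show ?thesis by simp
  qed
  then have "(\<Sum>i\<in>I. \<Sum>j\<in>I. \<theta> ^ gap i j) \<le> (\<Sum>i\<in>I. 2 / (1 - \<theta>))" by (intro sum_mono)
  then show ?thesis by simp
qed

text \<open>
Used for the very first block, which has no past.
\<close>

lemma measurable_trivial_sigma_const:
  fixes w :: "'a \<Rightarrow> real"
  assumes "w \<in> borel_measurable (sigma \<Omega> {})" shows "\<exists>c. \<forall>\<omega>\<in>\<Omega>. w \<omega> = c"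
proof (cases "\<Omega> = {}")
  case False
  then obtain x where x: "x \<in> \<Omega>" by auto
  have "w -` {w x} \<inter> \<Omega> \<in> sets (sigma \<Omega> {})"
    using measurable_sets[OF assms, of "{w x}"] by simp
  then have "w -` {w x} \<inter> \<Omega> = {} \<or> w -` {w x} \<inter> \<Omega> = \<Omega>" by (auto simp: sigma_sets_empty_eq)
  then show ?thesis using x by blast
qed simp

lemma exists_block_length:
  assumes "1 \<le> (n::nat)" obtains q where "1 \<le> q" "q \<le> n" "n \<le> q ^ 6" "q ^ 6 \<le> 64 * n"
proof -
  define q where "q = (LEAST q. n \<le> q ^ 6)"
  have "n \<le> n ^ 6" using assms by (simp add: self_le_power)
  then have q: "n \<le> q ^ 6" unfolding q_def by (rule LeastI)
  then have q1: "1 \<le> q" using assms by (cases q) auto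
  show thesis
  proof (cases "q = 1")
    case True
    then show thesis using that[of 1] q assms by auto
  next
    case False
    define p where "p = q - 1"
    have p: "q = Suc p" "1 \<le> p" using q1 False by (auto simp: p_def)
    have "\<not> n \<le> p ^ 6" using not_less_Least[of p "\<lambda>q. n \<le> q ^ 6"] p by (auto simp: q_def[symmetric])
    then have pn: "p ^ 6 < n" by simp
    have "q \<le> 2 * p" using p by simp
    then have "q ^ 6 \<le> (2 * p) ^ 6" by (rule power_mono) simp
    also have "\<dots> = 64 * p ^ 6" by (simp add: power_mult_distrib)
    finally have "q ^ 6 \<le> 64 * n" using pn by linarith
    moreover have "q \<le> n" using pn self_le_power[of p 6] p by simp
    ultimately show thesis using that q q1 by blast
  qed
qed

lemma sum_even_odd: "(\<Sum>b<2 * N. g b) = (\<Sum>j<N. g (2 * j)) + (\<Sum>j<N. g (2 * j + 1))" for g :: "nat \<Rightarrow> real"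
  by (induction N) (auto simp: algebra_simps)

text \<open>
A fourth root is the compromise between the two bounds for a covariance: \<open>1\<close> without decay in time,
and \<open>D r\<^sup>k\<close> with decay but a factor \<open>D\<close>. Summed over the lag \<open>k\<close> it gives \<open>D\<^sup>1\<^sup>/\<^sup>4\<close> instead of \<open>D\<close>.
\<close>

lemma min_one_le_fourth_root:
  fixes y :: real assumes "0 \<le> y" "x \<le> 1" "x \<le> y" shows "x \<le> sqrt (sqrt y)"
proof (cases "1 \<le> y")
  case True
  then have "1 \<le> sqrt (sqrt y)" by simp
  then show ?thesis using assms by linarith
next
  case False
  then have "y \<le> sqrt y" using assms by (intro real_le_rsqrt) (simp add: power2_eq_square mult_left_le)
  moreover have "sqrt y \<le> sqrt (sqrt y)" using \<open>y \<le> sqrt y\<close> by simp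
  ultimately show ?thesis using assms by linarith
qed

context mean_ergodic_chain
begin

lemma abs_X_bounded: "borel_bounded B \<phi> \<Longrightarrow> \<bar>\<phi> (X n \<omega>)\<bar> \<le> B"
  by (rule borel_bounded_abs_le)

lemma X_past: "borel_bounded B \<phi> \<Longrightarrow> i \<le> n \<Longrightarrow> (\<lambda>\<omega>. \<phi> (X i \<omega>)) \<in> borel_measurable (F n)"
  using measurable_compose[OF X_F borel_bounded_measurable] .

lemma two_time_expectation:
  assumes w: "w \<in> borel_measurable (F i)" "\<And>\<omega>. \<bar>w \<omega>\<bar> \<le> W" and t: "borel_bounded B t" and t': "borel_bounded B' t'"
  shows "(LINT \<omega>|M. w \<omega> * (t (X i \<omega>) * t' (X (i + k) \<omega>)))
    = (LINT \<omega>|M. w \<omega> * (t (X i \<omega>) * (kernel_op P ^^ k) t' (X i \<omega>)))"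
proof -
  have "(LINT \<omega>|M. (w \<omega> * t (X i \<omega>)) * t' (X (i + k) \<omega>))
    = (LINT \<omega>|M. (w \<omega> * t (X i \<omega>)) * (kernel_op P ^^ k) t' (X i \<omega>))"
  proof (rule markov_property[OF _ _ t'])
    show "(\<lambda>\<omega>. w \<omega> * t (X i \<omega>)) \<in> borel_measurable (F i)"
      using w(1) X_past[OF t order_refl, of i] by measurable
    show "\<bar>w \<omega> * t (X i \<omega>)\<bar> \<le> W * B" for \<omega>
      unfolding abs_mult using w(2) abs_X_bounded[OF t] by (intro mult_mono) (auto intro: order_trans[OF abs_ge_zero])
  qed
  then show ?thesis by (simp add: mult.assoc)
qed

lemma two_time_stationary:
  assumes t: "borel_bounded B t" and t': "borel_bounded B' t'"
  shows "(LINT \<omega>|M. t (X i \<omega>) * t' (X (i + k) \<omega>)) = (LINT x|\<mu>. t x * (kernel_op P ^^ k) t' x)"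
  using two_time_expectation[of "\<lambda>_. 1" i 1, OF _ _ t t', of k]
    expectation_X[OF borel_bounded_mult[OF t kernel_op_pow_bounded[OF P t', of k]], of i] by simp

text \<open>
Conditioning on the earlier of the two times replaces the later factor by a power of the kernel, and
leaves a function of a single state.
\<close>

lemma two_time_mixing:
  assumes w: "w \<in> borel_measurable (F l)" "\<And>\<omega>. \<bar>w \<omega>\<bar> \<le> 1" and t: "borel_bounded B t" and t': "borel_bounded B t'"
    and i: "l + q \<le> i" "l + q \<le> j"
  shows "\<bar>(LINT \<omega>|M. w \<omega> * (t (X i \<omega>) * t' (X j \<omega>))) - (LINT \<omega>|M. w \<omega>) * (LINT \<omega>|M. t (X i \<omega>) * t' (X j \<omega>))\<bar>
    \<le> B * B * (A * r ^ q)"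
proof -
  have ordered: "\<bar>(LINT \<omega>|M. w \<omega> * (t (X i \<omega>) * t' (X j \<omega>))) - (LINT \<omega>|M. w \<omega>) * (LINT \<omega>|M. t (X i \<omega>) * t' (X j \<omega>))\<bar>
    \<le> B * B * (A * r ^ q)"
    if t: "borel_bounded B t" and t': "borel_bounded B t'" and i: "l + q \<le> i" "i \<le> j" for t t' i j
  proof -
    define \<phi> where "\<phi> = (\<lambda>x. t x * (kernel_op P ^^ (j - i)) t' x)"
    have \<phi>: "borel_bounded (B * B) \<phi>"
      unfolding \<phi>_def by (rule borel_bounded_mult[OF t kernel_op_pow_bounded[OF P t']])
    have j: "i + (j - i) = j" "l + (i - l) = i" using i by auto
    have wi: "w \<in> borel_measurable (F i)" using F_measurable_mono[OF _ w(1)] i by auto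
    have "(LINT \<omega>|M. w \<omega> * (t (X i \<omega>) * t' (X j \<omega>))) = (LINT \<omega>|M. w \<omega> * \<phi> (X i \<omega>))"
      using two_time_expectation[OF wi w(2) t t', of "j - i"] by (simp add: j \<phi>_def)
    moreover have "(LINT \<omega>|M. t (X i \<omega>) * t' (X j \<omega>)) = (LINT x|\<mu>. \<phi> x)"
      using two_time_stationary[OF t t', of i "j - i"] by (simp add: j \<phi>_def)
    moreover have "\<bar>(LINT \<omega>|M. w \<omega> * \<phi> (X (l + (i - l)) \<omega>)) - (LINT \<omega>|M. w \<omega>) * (LINT x|\<mu>. \<phi> x)\<bar> \<le> 1 * (B * B) * (A * r ^ (i - l))"
      by (rule mixing[OF w \<phi>])
    moreover have "1 * (B * B) * (A * r ^ (i - l)) \<le> B * B * (A * r ^ q)"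
    proof -
      have "r ^ (i - l) \<le> r ^ q" using r i by (intro power_decreasing) auto
      then show ?thesis using A borel_bounded_nonneg[OF t] by (auto intro!: mult_left_mono)
    qed
    ultimately show ?thesis by (simp add: j)
  qed
  show ?thesis
  proof (cases "i \<le> j")
    case True
    then show ?thesis using ordered[OF t t'] i by simp
  next
    case False
    then show ?thesis using ordered[OF t' t, of j i] i by (simp add: mult.commute)
  qed
qed

end

text \<open>
The functions \<open>\<psi> k\<close> stand for the centred elements of an orthonormal basis of a model with
\<open>D = card J\<close> dimensions: their squares add up to at most \<open>R D\<close> at every point, but a unit combination
of them has \<open>\<mu>\<close>-variance at most \<open>Fb\<close>, whatever \<open>D\<close> is.
\<close>

locale centred_features = mean_ergodic_chain +
  fixes \<psi> :: "'i \<Rightarrow> real \<Rightarrow> real" and J :: "'i set" and R Fb :: real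
  assumes J: "finite J" "J \<noteq> {}"
    and \<psi>_measurable: "\<And>k. k \<in> J \<Longrightarrow> \<psi> k \<in> borel_measurable borel"
    and \<psi>_sq: "\<And>x. (\<Sum>k\<in>J. (\<psi> k x)\<^sup>2) \<le> R * real (card J)"
    and \<psi>_centred: "\<And>k. k \<in> J \<Longrightarrow> (LINT x|\<mu>. \<psi> k x) = 0"
    and \<psi>_variance: "\<And>c. (LINT x|\<mu>. (\<Sum>k\<in>J. c k * \<psi> k x)\<^sup>2) \<le> Fb * (\<Sum>k\<in>J. (c k)\<^sup>2)"
    and R: "0 \<le> R" and Fb: "0 \<le> Fb"
begin

abbreviation "D \<equiv> real (card J)"

lemma D1: "1 \<le> D" using J by (simp add: Suc_le_eq card_gt_0_iff)

lemma \<psi>_bounded: "k \<in> J \<Longrightarrow> borel_bounded (sqrt (R * D)) (\<psi> k)"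
proof (rule borel_boundedI)
  fix x assume "k \<in> J"
  then have "(\<psi> k x)\<^sup>2 \<le> R * D"
    using member_le_sum[OF _ _ J(1), of k "\<lambda>k. (\<psi> k x)\<^sup>2"] \<psi>_sq[of x] by simp
  then show "\<bar>\<psi> k x\<bar> \<le> sqrt (R * D)" by (intro real_le_rsqrt) simp
qed (rule \<psi>_measurable)

lemma combination_bounded: "borel_bounded (sqrt (R * D * (\<Sum>k\<in>J. (c k)\<^sup>2))) (\<lambda>x. \<Sum>k\<in>J. c k * \<psi> k x)"
proof (rule borel_boundedI)
  show "(\<lambda>x. \<Sum>k\<in>J. c k * \<psi> k x) \<in> borel_measurable borel"
    using \<psi>_measurable by (intro borel_measurable_sum borel_measurable_times) auto
  fix x
  have "(\<Sum>k\<in>J. c k * \<psi> k x)\<^sup>2 \<le> (\<Sum>k\<in>J. (c k)\<^sup>2) * (\<Sum>k\<in>J. (\<psi> k x)\<^sup>2)" by (rule Cauchy_Schwarz_ineq_sum)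
  also have "\<dots> \<le> (\<Sum>k\<in>J. (c k)\<^sup>2) * (R * D)" by (intro mult_left_mono \<psi>_sq sum_nonneg) auto
  finally show "\<bar>\<Sum>k\<in>J. c k * \<psi> k x\<bar> \<le> sqrt (R * D * (\<Sum>k\<in>J. (c k)\<^sup>2))"
    by (intro real_le_rsqrt) (simp add: mult.commute)
qed

text \<open>
For a fixed \<open>x\<close>, the sum over \<open>k\<close> is \<open>P\<^sup>m\<close> applied to the function \<open>K = (\<Sum>k. \<psi> k x \<psi> k)\<close>, which is
centred and bounded by \<open>R D\<close>. Bounding the summands one at a time would cost another factor \<open>D\<close>.
\<close>

lemma trace_covariance_le:
  "\<bar>\<Sum>k\<in>J. (LINT \<omega>|M. \<psi> k (X i \<omega>) * \<psi> k (X j \<omega>))\<bar> \<le> R * D * (A * r ^ gap i j)"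
proof -
  have ordered: "\<bar>\<Sum>k\<in>J. (LINT \<omega>|M. \<psi> k (X i \<omega>) * \<psi> k (X (i + m) \<omega>))\<bar> \<le> R * D * (A * r ^ m)" for i m
  proof -
    define \<phi> where "\<phi> = (\<lambda>x. \<Sum>k\<in>J. \<psi> k x * (kernel_op P ^^ m) (\<psi> k) x)"
    obtain d where d: "borel_bounded d (b m)" using b_bounded by blast
    have int: "integrable \<mu> (\<lambda>x. \<psi> k x * (kernel_op P ^^ m) (\<psi> k) x)" if "k \<in> J" for k
      by (rule integrable_borel_bounded[OF mu_prob(1,2) borel_bounded_mult[OF \<psi>_bounded[OF that] kernel_op_pow_bounded[OF P \<psi>_bounded[OF that]]]])
    have "\<bar>\<phi> x\<bar> \<le> R * D * b m x" for x
    proof -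
      define K where "K = (\<lambda>y. \<Sum>k\<in>J. \<psi> k x * \<psi> k y)"
      have "\<phi> x = (kernel_op P ^^ m) K x"
        unfolding \<phi>_def K_def using kernel_op_pow_sum[OF P, where J=J and c="\<lambda>_. sqrt (R * D)" and \<phi>=\<psi> and n=m and a="\<lambda>k. \<psi> k x"] \<psi>_bounded by simp
      moreover have K: "borel_bounded (R * D) K"
      proof (rule borel_bounded_mono)
        show "borel_bounded (sqrt (R * D * (\<Sum>k\<in>J. (\<psi> k x)\<^sup>2))) K" unfolding K_def by (rule combination_bounded)
        have "R * D * (\<Sum>k\<in>J. (\<psi> k x)\<^sup>2) \<le> (R * D) * (R * D)" using R by (intro mult_left_mono \<psi>_sq) auto
        then show "sqrt (R * D * (\<Sum>k\<in>J. (\<psi> k x)\<^sup>2)) \<le> R * D" using R by (intro real_le_lsqrt) (auto simp: power2_eq_square)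
      qed
      moreover have "(LINT y|\<mu>. K y) = 0"
        unfolding K_def using integrable_borel_bounded[OF mu_prob(1,2) \<psi>_bounded] \<psi>_centred
        by (subst Bochner_Integration.integral_sum) auto
      ultimately show ?thesis using ergodic[OF K, of m x] by simp
    qed
    then have "\<bar>LINT x|\<mu>. \<phi> x\<bar> \<le> (LINT x|\<mu>. R * D * b m x)"
      using int integrable_borel_bounded[OF mu_prob(1,2) d]
      by (intro order_trans[OF integral_abs_bound] integral_mono) (auto simp: \<phi>_def)
    also have "\<dots> \<le> R * D * (A * r ^ m)" using b_mean R by (auto intro!: mult_left_mono)
    also have "(LINT x|\<mu>. \<phi> x) = (\<Sum>k\<in>J. (LINT \<omega>|M. \<psi> k (X i \<omega>) * \<psi> k (X (i + m) \<omega>)))"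
      unfolding \<phi>_def using int two_time_stationary[OF \<psi>_bounded \<psi>_bounded]
      by (subst Bochner_Integration.integral_sum) auto
    finally show ?thesis .
  qed
  show ?thesis
  proof (cases "i \<le> j")
    case True
    then show ?thesis using ordered[of i "j - i"] by (simp add: gap_def)
  next
    case False
    then show ?thesis using ordered[of j "i - j"] by (simp add: gap_def mult.commute)
  qed
qed

definition "covariance_scale = Fb + R * A"

lemma covariance_scale: "0 \<le> covariance_scale" using R A Fb by (simp add: covariance_scale_def)

text \<open>
Cauchy-Schwarz gives \<open>Fb\<close> and ergodicity gives \<open>R D A r\<^sup>k\<close>, both times the squared length of \<open>c\<close>; the
claim interpolates between the two.
\<close>

lemma combination_covariance_le:
  fixes c :: "'i \<Rightarrow> real" defines "t \<equiv> \<lambda>x. \<Sum>k\<in>J. c k * \<psi> k x"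
  shows "(LINT \<omega>|M. t (X i \<omega>) * t (X j \<omega>)) \<le> covariance_scale * (\<Sum>k\<in>J. (c k)\<^sup>2) * (sqrt (sqrt D) * sqrt (sqrt r) ^ gap i j)"
proof -
  define C where "C = (\<Sum>k\<in>J. (c k)\<^sup>2)"
  have C: "0 \<le> C" by (simp add: C_def sum_nonneg)
  have t: "borel_bounded (sqrt (R * D * C)) t" unfolding t_def C_def by (rule combination_bounded)
  have sq: "sqrt (R * D * C) * sqrt (R * D * C) = R * D * C" using R C by simp
  note tX = integrable_borel_bounded[OF mu_prob(1,2) t]
  have mt: "(LINT x|\<mu>. t x) = 0"
    unfolding t_def using integrable_borel_bounded[OF mu_prob(1,2) \<psi>_bounded] \<psi>_centred
    by (subst Bochner_Integration.integral_sum) auto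
  have t2: "borel_bounded (R * D * C) (\<lambda>x. t x * t x)" using borel_bounded_mult[OF t t] sq by simp
  have int2: "integrable M (\<lambda>\<omega>. t (X n \<omega>) * t (X n \<omega>))" for n
    using integrable_mult_X[of "\<lambda>_. 1" 1, OF _ _ t2, of n] by simp
  have e2: "(LINT \<omega>|M. t (X n \<omega>) * t (X n \<omega>)) \<le> Fb * C" for n
    using expectation_X[OF t2, of n] \<psi>_variance[of c] by (simp add: t_def C_def power2_eq_square)
  have int: "integrable M (\<lambda>\<omega>. t (X i \<omega>) * t (X j \<omega>))"
  proof (rule integrable_bounded_function[where c="sqrt (R * D * C) * sqrt (R * D * C)"])
    show "(\<lambda>\<omega>. t (X i \<omega>) * t (X j \<omega>)) \<in> borel_measurable M" using borel_bounded_measurable[OF t] by measurable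
    show "\<bar>t (X i \<omega>) * t (X j \<omega>)\<bar> \<le> sqrt (R * D * C) * sqrt (R * D * C)" for \<omega>
      unfolding abs_mult by (intro mult_mono abs_X_bounded[OF t]) (use R C in auto)
  qed
  have 1: "(LINT \<omega>|M. t (X i \<omega>) * t (X j \<omega>)) \<le> Fb * C"
  proof -
    have "(LINT \<omega>|M. t (X i \<omega>) * t (X j \<omega>)) \<le> (LINT \<omega>|M. (t (X i \<omega>) * t (X i \<omega>) + t (X j \<omega>) * t (X j \<omega>)) / 2)"
    proof (rule integral_mono)
      fix \<omega>
      show "t (X i \<omega>) * t (X j \<omega>) \<le> (t (X i \<omega>) * t (X i \<omega>) + t (X j \<omega>) * t (X j \<omega>)) / 2"
        using sum_squares_bound[of "t (X i \<omega>)" "t (X j \<omega>)"] by (simp add: power2_eq_square)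
    qed (use int int2 in auto)
    also have "\<dots> = ((LINT \<omega>|M. t (X i \<omega>) * t (X i \<omega>)) + (LINT \<omega>|M. t (X j \<omega>) * t (X j \<omega>))) / 2"
      using int2 by simp
    also have "\<dots> \<le> (Fb * C + Fb * C) / 2" by (intro divide_right_mono add_mono e2) auto
    finally show ?thesis by (simp add: mult.commute)
  qed
  have ordered: "(LINT \<omega>|M. t (X i \<omega>) * t (X (i + m) \<omega>)) \<le> R * D * C * (A * r ^ m)" for i m
  proof -
    obtain d where d: "borel_bounded d (b m)" using b_bounded by blast
    have "(LINT \<omega>|M. t (X i \<omega>) * t (X (i + m) \<omega>)) = (LINT x|\<mu>. t x * (kernel_op P ^^ m) t x)"
      by (rule two_time_stationary[OF t t])
    also have "\<dots> \<le> (LINT x|\<mu>. R * D * C * b m x)"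
    proof (rule integral_mono)
      show "integrable \<mu> (\<lambda>x. t x * (kernel_op P ^^ m) t x)"
        by (rule integrable_borel_bounded[OF mu_prob(1,2) borel_bounded_mult[OF t kernel_op_pow_bounded[OF P t]]])
      show "integrable \<mu> (\<lambda>x. R * D * C * b m x)" using integrable_borel_bounded[OF mu_prob(1,2) d] by simp
      fix x
      have "t x * (kernel_op P ^^ m) t x \<le> \<bar>t x\<bar> * \<bar>(kernel_op P ^^ m) t x\<bar>"
        by (simp add: abs_mult[symmetric])
      also have "\<dots> \<le> sqrt (R * D * C) * (sqrt (R * D * C) * b m x)"
        using ergodic[OF t, of m x] borel_bounded_abs_le[OF t, of x] R C by (intro mult_mono) (auto simp: mt)
      finally show "t x * (kernel_op P ^^ m) t x \<le> R * D * C * b m x" using sq by (simp add: mult.assoc[symmetric])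
    qed
    also have "\<dots> \<le> R * D * C * (A * r ^ m)" using b_mean R C by (auto intro!: mult_left_mono)
    finally show ?thesis .
  qed
  have 2: "(LINT \<omega>|M. t (X i \<omega>) * t (X j \<omega>)) \<le> R * D * C * (A * r ^ gap i j)"
  proof (cases "i \<le> j")
    case True
    then show ?thesis using ordered[of i "j - i"] by (simp add: gap_def)
  next
    case False
    then show ?thesis using ordered[of j "i - j"] by (simp add: gap_def mult.commute)
  qed
  show ?thesis
  proof (cases "covariance_scale * C = 0")
    case True
    have "Fb * C \<le> covariance_scale * C" using R A C by (intro mult_right_mono) (auto simp: covariance_scale_def)
    also note True
    finally have "(LINT \<omega>|M. t (X i \<omega>) * t (X j \<omega>)) \<le> 0" using 1 by (rule order_trans[rotated])
    then show ?thesis unfolding C_def[symmetric] True by simp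
  next
    case False
    then have KC: "0 < covariance_scale * C" using covariance_scale C by (simp add: less_le)
    define x where "x = (LINT \<omega>|M. t (X i \<omega>) * t (X j \<omega>)) / (covariance_scale * C)"
    have "Fb * C \<le> covariance_scale * C" using R A C by (intro mult_right_mono) (auto simp: covariance_scale_def)
    then have "x \<le> 1" using 1 KC by (simp add: x_def)
    moreover have "x \<le> D * r ^ gap i j"
    proof -
      have "R * A \<le> covariance_scale" using Fb by (simp add: covariance_scale_def)
      then have "(R * A) * (C * (D * r ^ gap i j)) \<le> covariance_scale * (C * (D * r ^ gap i j))"
        using C r by (intro mult_right_mono) auto
      then show ?thesis using 2 KC by (simp add: x_def field_simps)
    qed
    ultimately have "x \<le> sqrt (sqrt (D * r ^ gap i j))"
      using r by (intro min_one_le_fourth_root) auto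
    also have "\<dots> = sqrt (sqrt D) * sqrt (sqrt r) ^ gap i j" by (simp add: real_sqrt_mult real_sqrt_power)
    finally show ?thesis using KC by (simp add: x_def C_def[symmetric] field_simps)
  qed
qed

definition block_sum :: "nat set \<Rightarrow> 'i \<Rightarrow> 'a \<Rightarrow> real" where
  "block_sum I k \<omega> = (\<Sum>i\<in>I. \<psi> k (X (Suc i) \<omega>))"

lemma integrable_\<psi>\<psi>: "k \<in> J \<Longrightarrow> k' \<in> J \<Longrightarrow> w \<in> borel_measurable M \<Longrightarrow> (\<And>\<omega>. \<bar>w \<omega>\<bar> \<le> 1) \<Longrightarrow>
    integrable M (\<lambda>\<omega>. w \<omega> * (\<psi> k (X i \<omega>) * \<psi> k' (X j \<omega>)))"
proof (rule integrable_bounded_function[where c="1 * (sqrt (R * D) * sqrt (R * D))"])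
  assume k: "k \<in> J" "k' \<in> J" and w: "w \<in> borel_measurable M" "\<And>\<omega>. \<bar>w \<omega>\<bar> \<le> 1"
  note [measurable] = w(1) \<psi>_measurable[OF k(1)] \<psi>_measurable[OF k(2)]
  show "(\<lambda>\<omega>. w \<omega> * (\<psi> k (X i \<omega>) * \<psi> k' (X j \<omega>))) \<in> borel_measurable M" by measurable
  show "\<bar>w \<omega> * (\<psi> k (X i \<omega>) * \<psi> k' (X j \<omega>))\<bar> \<le> 1 * (sqrt (R * D) * sqrt (R * D))" for \<omega>
    unfolding abs_mult using w(2) abs_X_bounded[OF \<psi>_bounded[OF k(1)]] abs_X_bounded[OF \<psi>_bounded[OF k(2)]] R
    by (intro mult_mono) auto
qed

lemma block_product_expectation:
  assumes "finite I" "k \<in> J" "k' \<in> J" "w \<in> borel_measurable M" "\<And>\<omega>. \<bar>w \<omega>\<bar> \<le> 1"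
  shows "(LINT \<omega>|M. w \<omega> * (block_sum I k \<omega> * block_sum I k' \<omega>))
    = (\<Sum>i\<in>I. \<Sum>j\<in>I. (LINT \<omega>|M. w \<omega> * (\<psi> k (X (Suc i) \<omega>) * \<psi> k' (X (Suc j) \<omega>))))"
proof -
  have "(LINT \<omega>|M. w \<omega> * (block_sum I k \<omega> * block_sum I k' \<omega>))
    = (LINT \<omega>|M. (\<Sum>i\<in>I. \<Sum>j\<in>I. w \<omega> * (\<psi> k (X (Suc i) \<omega>) * \<psi> k' (X (Suc j) \<omega>))))"
    unfolding block_sum_def sum_product by (simp only: sum_distrib_left)
  then show ?thesis using integrable_\<psi>\<psi>[OF assms(2-5)] by (simp add: Bochner_Integration.integral_sum)
qed

lemma block_square_le: assumes "finite I" "card I \<le> q"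
  shows "(\<Sum>k\<in>J. (block_sum I k \<omega>)\<^sup>2) \<le> real q * real q * (R * D)"
proof -
  have "(\<Sum>k\<in>J. (block_sum I k \<omega>)\<^sup>2) \<le> (\<Sum>k\<in>J. real (card I) * (\<Sum>i\<in>I. (\<psi> k (X (Suc i) \<omega>))\<^sup>2))"
  proof (rule sum_mono)
    fix k
    show "(block_sum I k \<omega>)\<^sup>2 \<le> real (card I) * (\<Sum>i\<in>I. (\<psi> k (X (Suc i) \<omega>))\<^sup>2)"
      using Cauchy_Schwarz_ineq_sum[of "\<lambda>_. 1" "\<lambda>i. \<psi> k (X (Suc i) \<omega>)" I] by (simp add: block_sum_def)
  qed
  also have "\<dots> = real (card I) * (\<Sum>i\<in>I. \<Sum>k\<in>J. (\<psi> k (X (Suc i) \<omega>))\<^sup>2)"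
    by (subst sum.swap) (simp add: sum_distrib_left)
  also have "\<dots> \<le> real (card I) * (\<Sum>i\<in>I. R * D)" by (intro mult_left_mono sum_mono \<psi>_sq) auto
  also have "\<dots> = real (card I) * real (card I) * (R * D)" by simp
  also have "\<dots> \<le> real q * real q * (R * D)" using assms R by (intro mult_mono mult_right_mono) auto
  finally show ?thesis .
qed

lemma block_trace_le: assumes "finite I" "card I \<le> q"
  shows "(\<Sum>k\<in>J. (LINT \<omega>|M. block_sum I k \<omega> * block_sum I k \<omega>)) \<le> 2 * R * A / (1 - r) * real q * D"
proof -
  have "(\<Sum>k\<in>J. (LINT \<omega>|M. block_sum I k \<omega> * block_sum I k \<omega>))
      = (\<Sum>k\<in>J. \<Sum>i\<in>I. \<Sum>j\<in>I. (LINT \<omega>|M. \<psi> k (X (Suc i) \<omega>) * \<psi> k (X (Suc j) \<omega>)))"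
    using block_product_expectation[of I _ _ "\<lambda>_. 1"] assms by (intro sum.cong) auto
  also have "\<dots> = (\<Sum>i\<in>I. \<Sum>j\<in>I. \<Sum>k\<in>J. (LINT \<omega>|M. \<psi> k (X (Suc i) \<omega>) * \<psi> k (X (Suc j) \<omega>)))"
    by (subst sum.swap, rule sum.cong[OF refl], rule sum.swap)
  also have "\<dots> \<le> (\<Sum>i\<in>I. \<Sum>j\<in>I. R * D * (A * r ^ gap i j))"
  proof (intro sum_mono)
    fix i j
    show "(\<Sum>k\<in>J. (LINT \<omega>|M. \<psi> k (X (Suc i) \<omega>) * \<psi> k (X (Suc j) \<omega>))) \<le> R * D * (A * r ^ gap i j)"
      using trace_covariance_le[of "Suc i" "Suc j"] by (simp add: abs_le_iff)
  qed
  also have "\<dots> = R * D * A * (\<Sum>i\<in>I. \<Sum>j\<in>I. r ^ gap i j)" by (simp add: sum_distrib_left mult.assoc)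
  also have "\<dots> \<le> R * D * A * (real (card I) * (2 / (1 - r)))"
    using R A r assms by (intro mult_left_mono sum_geometric_gap_le) auto
  also have "\<dots> \<le> R * D * A * (real q * (2 / (1 - r)))"
    using R A r assms by (intro mult_left_mono mult_right_mono) auto
  finally show ?thesis by (simp add: mult_ac)
qed

lemma block_operator_norm_le: assumes "finite I" "card I \<le> q"
  shows "(\<Sum>k\<in>J. \<Sum>k'\<in>J. c k * c k' * (LINT \<omega>|M. block_sum I k \<omega> * block_sum I k' \<omega>))
    \<le> 2 * covariance_scale / (1 - sqrt (sqrt r)) * real q * sqrt (sqrt D) * (\<Sum>k\<in>J. (c k)\<^sup>2)"
proof -
  define t where "t = (\<lambda>x. \<Sum>k\<in>J. c k * \<psi> k x)"
  define C where "C = (\<Sum>k\<in>J. (c k)\<^sup>2)"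
  have C: "0 \<le> C" by (simp add: C_def sum_nonneg)
  have r4: "0 \<le> sqrt (sqrt r)" "sqrt (sqrt r) < 1" using r by auto
  note int = integrable_\<psi>\<psi>[of _ _ "\<lambda>_. 1", simplified]
  have "(\<Sum>k\<in>J. \<Sum>k'\<in>J. c k * c k' * (LINT \<omega>|M. block_sum I k \<omega> * block_sum I k' \<omega>))
      = (\<Sum>k\<in>J. \<Sum>k'\<in>J. \<Sum>i\<in>I. \<Sum>j\<in>I. c k * c k' * (LINT \<omega>|M. \<psi> k (X (Suc i) \<omega>) * \<psi> k' (X (Suc j) \<omega>)))"
    using block_product_expectation[of I _ _ "\<lambda>_. 1"] assms by (intro sum.cong) (auto simp: sum_distrib_left)
  also have "\<dots> = (\<Sum>k\<in>J. \<Sum>i\<in>I. \<Sum>k'\<in>J. \<Sum>j\<in>I. c k * c k' * (LINT \<omega>|M. \<psi> k (X (Suc i) \<omega>) * \<psi> k' (X (Suc j) \<omega>)))"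
    by (rule sum.cong[OF refl], rule sum.swap)
  also have "\<dots> = (\<Sum>i\<in>I. \<Sum>k\<in>J. \<Sum>j\<in>I. \<Sum>k'\<in>J. c k * c k' * (LINT \<omega>|M. \<psi> k (X (Suc i) \<omega>) * \<psi> k' (X (Suc j) \<omega>)))"
    by (subst sum.swap, rule sum.cong[OF refl], rule sum.cong[OF refl], rule sum.swap)
  also have "\<dots> = (\<Sum>i\<in>I. \<Sum>j\<in>I. \<Sum>k\<in>J. \<Sum>k'\<in>J. c k * c k' * (LINT \<omega>|M. \<psi> k (X (Suc i) \<omega>) * \<psi> k' (X (Suc j) \<omega>)))"
    by (rule sum.cong[OF refl], rule sum.swap)
  also have "\<dots> = (\<Sum>i\<in>I. \<Sum>j\<in>I. (LINT \<omega>|M. t (X (Suc i) \<omega>) * t (X (Suc j) \<omega>)))"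
  proof (intro sum.cong refl)
    fix i j
    have "(LINT \<omega>|M. t (X (Suc i) \<omega>) * t (X (Suc j) \<omega>))
        = (LINT \<omega>|M. (\<Sum>k\<in>J. \<Sum>k'\<in>J. c k * c k' * (\<psi> k (X (Suc i) \<omega>) * \<psi> k' (X (Suc j) \<omega>))))"
      by (simp add: t_def sum_product mult_ac)
    also have "\<dots> = (\<Sum>k\<in>J. \<Sum>k'\<in>J. c k * c k' * (LINT \<omega>|M. \<psi> k (X (Suc i) \<omega>) * \<psi> k' (X (Suc j) \<omega>)))"
      using int by (simp add: Bochner_Integration.integral_sum)
    finally show "(\<Sum>k\<in>J. \<Sum>k'\<in>J. c k * c k' * (LINT \<omega>|M. \<psi> k (X (Suc i) \<omega>) * \<psi> k' (X (Suc j) \<omega>)))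
      = (LINT \<omega>|M. t (X (Suc i) \<omega>) * t (X (Suc j) \<omega>))" by simp
  qed
  also have "\<dots> \<le> (\<Sum>i\<in>I. \<Sum>j\<in>I. covariance_scale * C * (sqrt (sqrt D) * sqrt (sqrt r) ^ gap i j))"
  proof (intro sum_mono)
    fix i j
    show "(LINT \<omega>|M. t (X (Suc i) \<omega>) * t (X (Suc j) \<omega>)) \<le> covariance_scale * C * (sqrt (sqrt D) * sqrt (sqrt r) ^ gap i j)"
      using combination_covariance_le[of c "Suc i" "Suc j"] by (simp add: t_def C_def)
  qed
  also have "\<dots> = covariance_scale * C * sqrt (sqrt D) * (\<Sum>i\<in>I. \<Sum>j\<in>I. sqrt (sqrt r) ^ gap i j)"
    by (simp add: sum_distrib_left mult.assoc)
  also have "\<dots> \<le> covariance_scale * C * sqrt (sqrt D) * (real (card I) * (2 / (1 - sqrt (sqrt r))))"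
    using covariance_scale C r4 assms by (intro mult_left_mono sum_geometric_gap_le) auto
  also have "\<dots> \<le> covariance_scale * C * sqrt (sqrt D) * (real q * (2 / (1 - sqrt (sqrt r))))"
    using covariance_scale C r4 assms by (intro mult_left_mono mult_right_mono) auto
  finally show ?thesis by (simp add: C_def mult_ac)
qed

lemma block_centred:
  assumes I: "finite I" "card I \<le> q" "\<And>i. i \<in> I \<Longrightarrow> l + q \<le> Suc i" and k: "k \<in> J"
    and w: "w \<in> borel_measurable (F l)" "\<And>\<omega>. \<bar>w \<omega>\<bar> \<le> 1"
  shows "\<bar>LINT \<omega>|M. w \<omega> * block_sum I k \<omega>\<bar> \<le> real q * (sqrt (R * D) * (A * r ^ q))"
proof -
  have "(LINT \<omega>|M. w \<omega> * block_sum I k \<omega>) = (\<Sum>i\<in>I. (LINT \<omega>|M. w \<omega> * \<psi> k (X (Suc i) \<omega>)))"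
    unfolding block_sum_def sum_distrib_left
    using integrable_mult_X[OF F_measurable_M[OF w(1)] w(2) \<psi>_bounded[OF k]] by (subst Bochner_Integration.integral_sum) auto
  also have "\<bar>\<dots>\<bar> \<le> (\<Sum>i\<in>I. sqrt (R * D) * (A * r ^ q))"
  proof (rule order_trans[OF sum_abs sum_mono])
    fix i assume i: "i \<in> I"
    have "\<bar>LINT \<omega>|M. w \<omega> * \<psi> k (X (Suc i) \<omega>)\<bar> \<le> sqrt (R * D) * (A * r ^ (Suc i - l))"
      using mixing[OF w \<psi>_bounded[OF k], of "Suc i - l"] I(3)[OF i] \<psi>_centred[OF k] by simp
    also have "\<dots> \<le> sqrt (R * D) * (A * r ^ q)"
      using I(3)[OF i] r A R by (intro mult_left_mono power_decreasing) auto
    finally show "\<bar>LINT \<omega>|M. w \<omega> * \<psi> k (X (Suc i) \<omega>)\<bar> \<le> sqrt (R * D) * (A * r ^ q)" .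
  qed
  also have "\<dots> \<le> real q * (sqrt (R * D) * (A * r ^ q))" using I r A R by (simp add: mult_right_mono)
  finally show ?thesis .
qed

lemma block_covariance:
  assumes I: "finite I" "card I \<le> q" "\<And>i. i \<in> I \<Longrightarrow> l + q \<le> Suc i" and k: "k \<in> J" "k' \<in> J"
    and w: "w \<in> borel_measurable (F l)" "\<And>\<omega>. \<bar>w \<omega>\<bar> \<le> 1"
  shows "\<bar>(LINT \<omega>|M. w \<omega> * (block_sum I k \<omega> * block_sum I k' \<omega>))
      - (LINT \<omega>|M. w \<omega>) * (LINT \<omega>|M. block_sum I k \<omega> * block_sum I k' \<omega>)\<bar> \<le> real q * real q * (R * D * (A * r ^ q))"
proof -
  have "(LINT \<omega>|M. w \<omega> * (block_sum I k \<omega> * block_sum I k' \<omega>))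
      - (LINT \<omega>|M. w \<omega>) * (LINT \<omega>|M. block_sum I k \<omega> * block_sum I k' \<omega>)
    = (\<Sum>i\<in>I. \<Sum>j\<in>I. (LINT \<omega>|M. w \<omega> * (\<psi> k (X (Suc i) \<omega>) * \<psi> k' (X (Suc j) \<omega>)))
        - (LINT \<omega>|M. w \<omega>) * (LINT \<omega>|M. \<psi> k (X (Suc i) \<omega>) * \<psi> k' (X (Suc j) \<omega>)))"
    using block_product_expectation[OF I(1) k F_measurable_M[OF w(1)] w(2)]
      block_product_expectation[OF I(1) k, of "\<lambda>_. 1"]
    by (simp add: sum_subtractf sum_distrib_left)
  also have "\<bar>\<dots>\<bar> \<le> (\<Sum>i\<in>I. \<Sum>j\<in>I. R * D * (A * r ^ q))"
  proof (rule order_trans[OF sum_abs sum_mono], rule order_trans[OF sum_abs sum_mono])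
    fix i j assume i: "i \<in> I" "j \<in> I"
    show "\<bar>(LINT \<omega>|M. w \<omega> * (\<psi> k (X (Suc i) \<omega>) * \<psi> k' (X (Suc j) \<omega>)))
        - (LINT \<omega>|M. w \<omega>) * (LINT \<omega>|M. \<psi> k (X (Suc i) \<omega>) * \<psi> k' (X (Suc j) \<omega>))\<bar> \<le> R * D * (A * r ^ q)"
      using two_time_mixing[OF w \<psi>_bounded[OF k(1)] \<psi>_bounded[OF k(2)] I(3)[OF i(1)] I(3)[OF i(2)]] R by simp
  qed
  also have "\<dots> = real (card I) * real (card I) * (R * D * (A * r ^ q))" by simp
  also have "\<dots> \<le> real q * real q * (R * D * (A * r ^ q))"
    using I r A R by (intro mult_right_mono mult_mono) auto
  finally show ?thesis .
qed

end

lemma polynomial_times_geometric_bounded: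
  fixes r :: real assumes "0 < r" "r < 1"
  obtains C where "0 \<le> C" "\<And>q::nat. real q ^ k * r ^ q \<le> C"
proof -
  have "(\<lambda>q. real q ^ k * r ^ q) \<longlonglongrightarrow> 0"
  proof -
    have "((\<lambda>q::nat. real q ^ k * exp (- (- ln r) * real q)) \<longlongrightarrow> 0) at_top"
      using assms by real_asymp
    moreover have "exp (- (- ln r) * real q) = r ^ q" for q
      using assms by (simp add: exp_of_nat_mult mult.commute)
    ultimately show ?thesis by simp
  qed
  then have "Bseq (\<lambda>q. real q ^ k * r ^ q)" by (rule convergent_imp_Bseq[OF convergentI])
  then obtain C where C: "\<And>q. norm (real q ^ k * r ^ q) \<le> C" unfolding Bseq_def by blast
  show thesis
  proof (rule that[of C])
    show "0 \<le> C" using C[of 0] norm_ge_zero order_trans by blast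
    show "real q ^ k * r ^ q \<le> C" for q using C[of q] by simp
  qed
qed

context centred_features
begin

definition block_index :: "nat \<Rightarrow> nat \<Rightarrow> nat \<Rightarrow> nat set" where
  "block_index n q e = {i \<in> {e * q..<e * q + q}. i < n}"

lemma block_index_finite: "finite (block_index n q e)" and block_index_card: "card (block_index n q e) \<le> q"
proof -
  show "finite (block_index n q e)" by (simp add: block_index_def)
  have "card (block_index n q e) \<le> card {e * q..<e * q + q}" unfolding block_index_def by (intro card_mono) auto
  then show "card (block_index n q e) \<le> q" by simp
qed

text \<open>
The past of a block ends one block earlier. The first block gets the trivial past, since there is
no gap before it.
\<close>

definition past :: "nat \<Rightarrow> nat \<Rightarrow> 'a measure" where
  "past q e = (if e = 0 then sigma (space M) {} else F ((e - 1) * q))"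

lemma past_subalgebra: "subalgebra M (past q e)"
  using F_subalgebra by (auto simp: past_def subalgebra_def sets_measure_of_conv space_measure_of_conv sigma_sets_empty_eq)

lemma trivial_past_const: "(w :: 'a \<Rightarrow> real) \<in> borel_measurable (past q 0) \<Longrightarrow> \<exists>c. \<forall>\<omega>\<in>space M. w \<omega> = c"
  using measurable_trivial_sigma_const[of w "space M"] by (simp add: past_def)

lemma block_sum_integrals:
  assumes "finite I" "k \<in> J"
  shows "(LINT \<omega>|M. block_sum I k \<omega>) = 0"
proof -
  have "integrable M (\<lambda>\<omega>. \<psi> k (X (Suc i) \<omega>))" for i
    using integrable_mult_X[of "\<lambda>_. 1" 1, OF _ _ \<psi>_bounded[OF assms(2)]] by simp
  then show ?thesis
    unfolding block_sum_def using expectation_X[OF \<psi>_bounded[OF assms(2)]] \<psi>_centred[OF assms(2)]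
    by (subst Bochner_Integration.integral_sum) auto
qed

lemma weakly_dependent_blocks:
  assumes q: "1 \<le> q" and p: "p \<le> 1"
  shows "weakly_dependent_vectors M (\<lambda>j. past q (2 * j + p)) (\<lambda>j. block_sum (block_index n q (2 * j + p))) J
    (real q * real q * (R * D)) (real q * real q * ((1 + R * D) * (A * r ^ q)))
    (2 * covariance_scale / (1 - sqrt (sqrt r)) * real q * sqrt (sqrt D))"
proof -
  define \<epsilon> where "\<epsilon> = real q * real q * ((1 + R * D) * (A * r ^ q))"
  have RD: "0 \<le> R * D" using R by simp
  have Ar: "0 \<le> A * r ^ q" using A r by simp
  have \<epsilon>0: "0 \<le> \<epsilon>" using RD Ar by (simp add: \<epsilon>_def)
  have q1: "1 \<le> real q" using q by simp
  have sq: "sqrt (R * D) \<le> 1 + R * D"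
  proof (rule real_le_lsqrt)
    have "(1 + R * D)\<^sup>2 = 1 + 2 * (R * D) + (R * D)\<^sup>2" by (simp add: power2_sum)
    then show "R * D \<le> (1 + R * D)\<^sup>2" using RD zero_le_power2[of "R * D"] by linarith
  qed (use RD in auto)
  have \<epsilon>1: "real q * (sqrt (R * D) * (A * r ^ q)) \<le> \<epsilon>"
  proof -
    have "real q * (sqrt (R * D) * (A * r ^ q)) \<le> (real q * real q) * ((1 + R * D) * (A * r ^ q))"
      using sq Ar RD q1 by (intro mult_mono mult_right_mono) auto
    then show ?thesis by (simp add: \<epsilon>_def)
  qed
  have \<epsilon>2: "real q * real q * (R * D * (A * r ^ q)) \<le> \<epsilon>"
    unfolding \<epsilon>_def using Ar by (intro mult_left_mono mult_right_mono) auto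
  show ?thesis
    unfolding \<epsilon>_def[symmetric]
  proof (unfold_locales, goal_cases)
    case (1 j)
    then show ?case by (rule past_subalgebra)
  next
    case 2
    then show ?case by (rule J)
  next
    case (3 i j k)
    have past: "past q (2 * j + p) = F ((2 * j + p - 1) * q)" using 3 by (simp add: past_def)
    show ?case unfolding past block_sum_def
    proof (rule borel_measurable_sum, rule X_past[OF \<psi>_bounded[OF 3(2)]])
      fix i' assume "i' \<in> block_index n q (2 * i + p)"
      then have "Suc i' \<le> (2 * i + p + 1) * q" by (simp add: block_index_def)
      also have "\<dots> \<le> (2 * j + p - 1) * q" using 3(1) by (intro mult_right_mono) auto
      finally show "Suc i' \<le> (2 * j + p - 1) * q" .
    qed
  next
    case (4 j \<omega>)
    then show ?case by (rule block_square_le[OF block_index_finite block_index_card])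
  next
    case 5
    then show ?case using RD by simp
  next
    case 6
    then show ?case by (rule \<epsilon>0)
  next
    case 7
    have "sqrt (sqrt r) < 1" using r by simp
    then show ?case using covariance_scale by simp
  next
    case (8 j w k)
    show ?case
    proof (cases "2 * j + p = 0")
      case True
      then obtain c where c: "\<forall>\<omega>\<in>space M. w \<omega> = c" using trivial_past_const[of w q] 8(2) by auto
      have "(LINT \<omega>|M. w \<omega> * block_sum (block_index n q (2 * j + p)) k \<omega>) = (LINT \<omega>|M. c * block_sum (block_index n q (2 * j + p)) k \<omega>)"
        using c by (intro Bochner_Integration.integral_cong) auto
      then show ?thesis using block_sum_integrals[OF block_index_finite 8(1)] \<epsilon>0 by simp
    next
      case False
      have meas: "w \<in> borel_measurable (F ((2 * j + p - 1) * q))" using 8(2) unfolding past_def if_not_P[OF False] .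
      have gap_le: "(2 * j + p - 1) * q + q \<le> Suc i" if "i \<in> block_index n q (2 * j + p)" for i
      proof -
        have "(2 * j + p - 1) * q + q = (2 * j + p) * q" using False by (cases "2 * j + p") auto
        then show ?thesis using that by (simp add: block_index_def)
      qed
      show ?thesis
        by (rule order_trans[OF block_centred[OF block_index_finite block_index_card gap_le 8(1) meas 8(3)] \<epsilon>1])
    qed
  next
    case (9 j w k k')
    show ?case
    proof (cases "2 * j + p = 0")
      case True
      then obtain c where c: "\<forall>\<omega>\<in>space M. w \<omega> = c" using trivial_past_const[of w q] 9(3) by auto
      have "(LINT \<omega>|M. w \<omega> * (block_sum (block_index n q (2 * j + p)) k \<omega> * block_sum (block_index n q (2 * j + p)) k' \<omega>))
          = (LINT \<omega>|M. c * (block_sum (block_index n q (2 * j + p)) k \<omega> * block_sum (block_index n q (2 * j + p)) k' \<omega>))"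
        using c by (intro Bochner_Integration.integral_cong) auto
      moreover have "(LINT \<omega>|M. w \<omega>) = (LINT \<omega>|M. c)" using c by (intro Bochner_Integration.integral_cong) auto
      ultimately show ?thesis using \<epsilon>0 by (simp add: prob_space)
    next
      case False
      have meas: "w \<in> borel_measurable (F ((2 * j + p - 1) * q))" using 9(3) unfolding past_def if_not_P[OF False] .
      have gap_le: "(2 * j + p - 1) * q + q \<le> Suc i" if "i \<in> block_index n q (2 * j + p)" for i
      proof -
        have "(2 * j + p - 1) * q + q = (2 * j + p) * q" using False by (cases "2 * j + p") auto
        then show ?thesis using that by (simp add: block_index_def)
      qed
      show ?thesis
        by (rule order_trans[OF block_covariance[OF block_index_finite block_index_card gap_le 9(1,2) meas 9(4)] \<epsilon>2])
    qed
  next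
    case (10 j c)
    then show ?case by (rule block_operator_norm_le[OF block_index_finite block_index_card])
  qed
qed

lemma observations_split:
  assumes "n \<le> 2 * N * q"
  shows "(\<Sum>i=1..n. \<psi> k (X i \<omega>)) = (\<Sum>j<N. block_sum (block_index n q (2 * j)) k \<omega>) + (\<Sum>j<N. block_sum (block_index n q (2 * j + 1)) k \<omega>)"
proof -
  define f where "f = (\<lambda>i. if i < n then \<psi> k (X (Suc i) \<omega>) else 0)"
  have block_index_eq: "block_sum (block_index n q e) k \<omega> = sum f {e * q..<e * q + q}" for e
    unfolding block_sum_def block_index_def f_def by (subst sum.inter_filter) auto
  have "(\<Sum>i=1..n. \<psi> k (X i \<omega>)) = (\<Sum>i<n. \<psi> k (X (Suc i) \<omega>))"
    using sum.atLeast1_atMost_eq[of "\<lambda>i. \<psi> k (X i \<omega>)" n] by simp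
  also have "\<dots> = sum f {..<2 * N * q}"
    using assms by (intro sum.mono_neutral_cong_left) (auto simp: f_def)
  also have "\<dots> = (\<Sum>e<2 * N. sum f {e * q..<e * q + q})"
    using sum.nat_group[of f q "2 * N"] by simp
  finally show ?thesis unfolding block_index_eq[symmetric] by (simp only: sum_even_odd)
qed

end

text \<open>
Proportionality constant in the scale \<open>L = c n \<surd>(D D\<^sup>1\<^sup>/\<^sup>4)\<close> of the fluctuations. It is the sum of the
constants required by the separate numerical conditions of the fourth moment bound, so that it
exceeds each of them. The number \<open>B\<close> bounds \<open>q\<^sup>1\<^sup>3\<^sup>2 r\<^sup>q\<close>, by which the mixing error beats every power
of \<open>n\<close> that occurs.
\<close>

definition excess_constant :: "real \<Rightarrow> real \<Rightarrow> real \<Rightarrow> real \<Rightarrow> real \<Rightarrow> real" where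
  "excess_constant R Fb A r B = (let c0 = 2 * R * A / (1 - r); c1 = 2 * (Fb + R * A) / (1 - sqrt (sqrt r));
      d = 632 * (2 + 8 * R) ^ 18 * (1 + R) * A * B
    in 1 + 64 * R + 64 * c1 + 128 * R * c0 + 128 * R\<^sup>2 + 128 * c0 * c1 + d)"

context centred_features
begin

text \<open>
The fourth moment bound for blocks of one parity. With \<open>n \<le> q\<^sup>6 \<le> 64 n\<close> and \<open>D\<^sup>2 \<le> n\<close> the conditions
on \<open>L\<close> come down to \<open>q\<^sup>3 \<le> 8 \<surd>n\<close>: blocks are long enough to make the mixing error negligible, and short
enough for a single block not to matter.
\<close>

lemma half_excess_bound:
  assumes n: "(card J)\<^sup>2 \<le> n" and B: "0 \<le> B" "\<And>q::nat. real q ^ 132 * r ^ q \<le> B"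
    and q: "1 \<le> q" "q \<le> n" "n \<le> q ^ 6" "q ^ 6 \<le> 64 * n" and p: "p \<le> 1" and N: "N = n div (2 * q) + 1"
  defines "c0 \<equiv> 2 * R * A / (1 - r)" and "c \<equiv> excess_constant R Fb A r B"
  defines "E \<equiv> \<lambda>\<omega>. max 0 ((\<Sum>k\<in>J. (\<Sum>j<N. block_sum (block_index n q (2 * j + p)) k \<omega>)\<^sup>2) - (2 * c0 + 1) * (real n * D))"
  shows "integrable M E" "(LINT \<omega>|M. E \<omega>) \<le> exp 15 * c ^ 4 * real n / sqrt D"
proof -
  define c1 where "c1 = 2 * covariance_scale / (1 - sqrt (sqrt r))"
  define d where "d = 632 * (2 + 8 * R) ^ 18 * (1 + R) * A * B"
  have c_eq: "c = 1 + 64 * R + 64 * c1 + 128 * R * c0 + 128 * R\<^sup>2 + 128 * c0 * c1 + d"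
    by (simp add: c_def excess_constant_def Let_def c0_def c1_def covariance_scale_def d_def)
  have r4: "sqrt (sqrt r) < 1" using r by simp
  have c0: "0 \<le> c0" and c1: "0 \<le> c1" and d: "0 \<le> d"
    using R A r covariance_scale r4 B by (simp_all add: c0_def c1_def d_def)
  have nn: "0 \<le> R * c0" "0 \<le> R\<^sup>2" "0 \<le> c0 * c1" using R c0 c1 by auto
  have c_ge: "1 \<le> c" "64 * R \<le> c" "64 * c1 \<le> c" "128 * R * c0 + 128 * R\<^sup>2 \<le> c" "128 * c0 * c1 \<le> c" "128 * R\<^sup>2 \<le> c" "d \<le> c"
    unfolding c_eq using R c0 c1 d nn by (auto simp: mult.assoc)
  have c_sq: "c \<le> c\<^sup>2" using c_ge(1) by (simp add: power2_eq_square)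
  define x where "x = sqrt (real n)"
  define y where "y = real n"
  have n1: "1 \<le> n" using q by simp
  have x: "1 \<le> x" "x * x = y" using n1 by (simp_all add: x_def y_def)
  have y: "1 \<le> y" using n1 by (simp add: y_def)
  have xy: "x \<le> y" using x by (metis mult_left_mono mult.right_neutral order_trans zero_le_one)
  have Dx: "D \<le> x"
  proof -
    have "D\<^sup>2 \<le> real n" using n by (metis of_nat_le_iff of_nat_power)
    then show ?thesis unfolding x_def by (rule real_le_rsqrt)
  qed
  define z where "z = real q"
  have z: "1 \<le> z" using q by (simp add: z_def)
  have z3: "z * z * z \<le> 8 * x"
  proof -
    have "real (q ^ 6) \<le> 64 * real n" using q(4) by (metis of_nat_le_iff of_nat_mult of_nat_numeral)
    then have "(z * z * z)\<^sup>2 \<le> (8 * x)\<^sup>2" using x(2) by (simp add: z_def y_def power2_eq_square eval_nat_numeral mult_ac)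
    then show ?thesis by (rule power2_le_imp_le) (use x in auto)
  qed
  have z2: "z * z \<le> 8 * x" 
  proof -
    have "z * z * 1 \<le> z * z * z" using z by (intro mult_left_mono) auto
    then show ?thesis using z3 by simp
  qed
  have Nz: "real N * z \<le> 2 * y"
  proof -
    have "n div (2 * q) * (2 * q) \<le> n" by simp
    then have "N * q \<le> 2 * n" unfolding N using q by (simp add: algebra_simps)
    then show ?thesis unfolding z_def y_def by (metis of_nat_le_iff of_nat_mult of_nat_numeral)
  qed
  have N2: "real N \<le> 2 * y" using Nz mult_left_mono[OF z, of "real N"] by simp
  define \<delta> where "\<delta> = sqrt (sqrt D)"
  have \<delta>: "1 \<le> \<delta>" "\<delta> * \<delta> = sqrt D" "\<delta> \<le> D"
  proof -
    show "1 \<le> \<delta>" using D1 by (simp add: \<delta>_def)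
    show "\<delta> * \<delta> = sqrt D" by (simp add: \<delta>_def)
    have "sqrt D \<le> D" using D1 by (intro real_le_lsqrt) (auto simp: power2_eq_square)
    moreover have "\<delta> \<le> sqrt D" unfolding \<delta>_def using \<open>sqrt D \<le> D\<close> by simp
    ultimately show "\<delta> \<le> D" by linarith
  qed
  define m where "m = z * z * (R * D)"
  define s where "s = 2 * c0 * (y * D)"
  define \<eta> where "\<eta> = c1 * z * \<delta>"
  define L where "L = c * y * sqrt (D * \<delta>)"
  have Dd: "\<delta> \<le> sqrt (D * \<delta>)" "1 \<le> sqrt (D * \<delta>)"
  proof -
    have "\<delta> * \<delta> \<le> D * \<delta>" using \<delta> by (intro mult_right_mono) auto
    then show "\<delta> \<le> sqrt (D * \<delta>)" by (intro real_le_rsqrt) (simp add: power2_eq_square)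
    then show "1 \<le> sqrt (D * \<delta>)" using \<delta> by linarith
  qed
  have L_lower: "c * y * \<delta> \<le> L" "c * y \<le> L"
  proof -
    show "c * y * \<delta> \<le> L" unfolding L_def using Dd c_ge y by (intro mult_left_mono) auto
    have "c * y * 1 \<le> L" unfolding L_def using Dd(2) c_ge y by (intro mult_left_mono) auto
    then show "c * y \<le> L" by simp
  qed
  have L_sq: "L\<^sup>2 = c\<^sup>2 * (y\<^sup>2 * D * \<delta>)"
    unfolding L_def using D1 \<delta> by (simp add: power_mult_distrib mult_ac)
  have L0: "0 < L" using L_lower(2) c_ge y by (smt (verit) mult_less_0_iff mult_le_cancel_left1)
  have base: "y\<^sup>2 * D \<le> y\<^sup>2 * D * \<delta>" using \<delta> D1 mult_left_mono[of 1 \<delta> "y\<^sup>2 * D"] by simp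
  have sq_le: "a * (y\<^sup>2 * D) \<le> L\<^sup>2" if "0 \<le> a" "a \<le> c" for a
  proof -
    have "a * (y\<^sup>2 * D) \<le> c\<^sup>2 * (y\<^sup>2 * D * \<delta>)"
      by (rule mult_mono[OF _ base]) (use that c_sq in auto)
    then show ?thesis by (simp add: L_sq)
  qed
  have sq_le': "a * (y\<^sup>2 * D * \<delta>) \<le> L\<^sup>2" if "a \<le> c" for a
    unfolding L_sq using that c_sq D1 y \<delta> by (intro mult_right_mono) auto
  have zzD: "z * z * D \<le> 8 * y"
  proof -
    have "z * z * D \<le> (8 * x) * x" by (rule mult_mono[OF z2 Dx]) (use x in auto)
    then show ?thesis using x by simp
  qed
  have m_le: "m \<le> 8 * R * y" using mult_left_mono[OF zzD R] by (simp add: m_def mult_ac)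
  have m0: "0 \<le> m" using R z by (simp add: m_def)
  have s0: "0 \<le> s" using c0 y by (simp add: s_def)
  have \<eta>0: "0 \<le> \<eta>" using c1 z \<delta> by (simp add: \<eta>_def)
  \<comment> \<open>Here \<open>x = \<surd>n\<close>, \<open>y = n\<close> and \<open>z = q\<close>, so that \<open>D \<le> x\<close>, \<open>z\<^sup>3 \<le> 8 x\<close> and \<open>N z \<le> 2 y\<close>.\<close>
  have cond1: "8 * m \<le> L"
  proof -
    have "64 * R * y \<le> c * y" using c_ge y by (intro mult_right_mono) auto
    then show ?thesis using m_le L_lower by linarith
  qed
  have m_sq: "2 * m\<^sup>2 \<le> 128 * R\<^sup>2 * (y\<^sup>2 * D)"
  proof -
    have "m \<le> 8 * R * (y * D)"
    proof -
      have "8 * R * y * 1 \<le> 8 * R * y * D" using R y D1 by (intro mult_left_mono) auto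
      then show ?thesis using m_le by (simp add: mult.assoc)
    qed
    then have "m * m \<le> (8 * R * y) * (8 * R * (y * D))" by (rule mult_mono[OF m_le]) (use m0 R y in auto)
    then show ?thesis by (simp add: power2_eq_square mult_ac)
  qed
  have cond2: "8 * m * s + 2 * m\<^sup>2 \<le> L\<^sup>2"
  proof -
    have "8 * m * s \<le> 8 * (8 * R * y) * s" using m_le s0 by (intro mult_right_mono) auto
    also have "\<dots> = 128 * R * c0 * (y\<^sup>2 * D)" by (simp add: s_def power2_eq_square)
    finally have "8 * m * s + 2 * m\<^sup>2 \<le> (128 * R * c0 + 128 * R\<^sup>2) * (y\<^sup>2 * D)"
      unfolding distrib_right by (rule add_mono[OF _ m_sq])
    also have "\<dots> \<le> L\<^sup>2" using c_ge nn by (intro sq_le) auto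
    finally show ?thesis .
  qed
  have cond3: "real N * (8 * \<eta> * L + (8 * \<eta> * s + 2 * m\<^sup>2)) \<le> L\<^sup>2"
  proof -
    have N\<eta>: "real N * \<eta> \<le> 2 * c1 * y * \<delta>"
    proof -
      have "(real N * z) * (c1 * \<delta>) \<le> (2 * y) * (c1 * \<delta>)" using Nz c1 \<delta> by (intro mult_right_mono) auto
      then show ?thesis by (simp add: \<eta>_def mult_ac)
    qed
    have t1: "4 * (real N * (8 * \<eta> * L)) \<le> L\<^sup>2"
    proof -
      have "4 * (real N * (8 * \<eta> * L)) = 32 * (real N * \<eta>) * L" by simp
      also have "\<dots> \<le> 32 * (2 * c1 * y * \<delta>) * L" using N\<eta> L0 by (intro mult_right_mono mult_left_mono) auto
      also have "\<dots> = (64 * c1 * (y * \<delta>)) * L" by simp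
      also have "\<dots> \<le> (c * (y * \<delta>)) * L" using c_ge y \<delta> L0 by (intro mult_right_mono) auto
      also have "\<dots> \<le> L * L" using L_lower L0 by (intro mult_right_mono) (auto simp: mult.assoc)
      finally show ?thesis by (simp add: power2_eq_square)
    qed
    have t2: "4 * (real N * (8 * \<eta> * s)) \<le> L\<^sup>2"
    proof -
      have "4 * (real N * (8 * \<eta> * s)) = 32 * (real N * \<eta>) * s" by simp
      also have "\<dots> \<le> 32 * (2 * c1 * y * \<delta>) * s" using N\<eta> s0 by (intro mult_right_mono mult_left_mono) auto
      also have "\<dots> = 128 * c0 * c1 * (y\<^sup>2 * D * \<delta>)" by (simp add: s_def power2_eq_square)
      also have "\<dots> \<le> L\<^sup>2" by (rule sq_le'[OF c_ge(5)])
      finally show ?thesis .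
    qed
    have t3: "4 * (real N * (2 * m\<^sup>2)) \<le> 4 * L\<^sup>2 / 2"
    proof -
      have "real N * (2 * m\<^sup>2) = (real N * z) * (2 * (z * z * z) * R\<^sup>2 * (D * D))"
        by (simp add: m_def power2_eq_square)
      also have "\<dots> \<le> (2 * y) * (2 * (8 * x) * R\<^sup>2 * (D * x))"
      proof (rule mult_mono[OF Nz])
        have "2 * (z * z * z) * R\<^sup>2 \<le> 2 * (8 * x) * R\<^sup>2" using z3 by (intro mult_right_mono) auto
        moreover have "D * D \<le> D * x" using Dx by (intro mult_left_mono) auto
        ultimately show "2 * (z * z * z) * R\<^sup>2 * (D * D) \<le> 2 * (8 * x) * R\<^sup>2 * (D * x)"
          by (rule mult_mono) (use x in auto)
      qed (use y z in auto)
      also have "\<dots> = 32 * R\<^sup>2 * (y * (x * x) * D)" by simp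
      also have "\<dots> = 32 * R\<^sup>2 * (y\<^sup>2 * D)" by (simp add: x power2_eq_square)
      finally have "4 * (real N * (2 * m\<^sup>2)) \<le> 128 * R\<^sup>2 * (y\<^sup>2 * D)" by simp
      also have "\<dots> \<le> L\<^sup>2" using c_ge nn by (intro sq_le) auto
      finally show ?thesis using zero_le_power2[of L] by linarith
    qed
    have "real N * (8 * \<eta> * L + (8 * \<eta> * s + 2 * m\<^sup>2)) = real N * (8 * \<eta> * L) + real N * (8 * \<eta> * s) + real N * (2 * m\<^sup>2)"
      by (simp add: distrib_left)
    then show ?thesis using t1 t2 t3 by linarith
  qed
  define H where "H = (2 + 8 * R) * y"
  define \<epsilon> where "\<epsilon> = z * z * ((1 + R * D) * (A * r ^ q))"
  have H: "1 \<le> H" "real N \<le> H" "D \<le> H" "m \<le> H"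
  proof -
    have H_eq: "H = 2 * y + 8 * R * y" by (simp add: H_def algebra_simps)
    have "0 \<le> 8 * R * y" using R y by simp
    then show "1 \<le> H" "real N \<le> H" "D \<le> H" "m \<le> H"
      unfolding H_eq using y N2 Dx xy m_le by linarith+
  qed
  have \<epsilon>_le: "\<epsilon> \<le> (1 + R) * A * (y ^ 3 * r ^ q)"
  proof -
    have zy: "z \<le> y" using q by (simp add: z_def y_def)
    have "1 + R * D \<le> (1 + R) * y" using R y Dx xy D1 mult_left_mono[of D y R] by (simp add: algebra_simps)
    moreover have "z * z \<le> y * y" by (rule mult_mono[OF zy zy]) (use y z in auto)
    ultimately have "z * z * (1 + R * D) \<le> (y * y) * ((1 + R) * y)"
      by (intro mult_mono[of "z * z" "y * y" "1 + R * D"]) (use R in auto)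
    then have "(z * z * (1 + R * D)) * (A * r ^ q) \<le> ((y * y) * ((1 + R) * y)) * (A * r ^ q)"
      using A r by (intro mult_right_mono) auto
    then show ?thesis by (simp add: \<epsilon>_def eval_nat_numeral mult_ac)
  qed
  have cond4: "real N * (316 * H ^ 18 * \<epsilon>) \<le> L ^ 4"
  proof -
    have \<epsilon>0: "0 \<le> \<epsilon>" using z R A r by (simp add: \<epsilon>_def)
    have "real N * (316 * H ^ 18 * \<epsilon>) \<le> (2 * y) * (316 * H ^ 18 * ((1 + R) * A * (y ^ 3 * r ^ q)))"
    proof (rule mult_mono[OF N2])
      show "316 * H ^ 18 * \<epsilon> \<le> 316 * H ^ 18 * ((1 + R) * A * (y ^ 3 * r ^ q))"
        using \<epsilon>_le H by (intro mult_left_mono) auto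
    qed (use y \<epsilon>0 H in auto)
    also have "\<dots> = 632 * (2 + 8 * R) ^ 18 * (1 + R) * A * (y ^ 22 * r ^ q)"
      by (simp add: H_def power_mult_distrib eval_nat_numeral mult_ac)
    \<comment> \<open>Powers of \<open>n\<close> become powers of \<open>q\<close> through \<open>n \<le> q\<^sup>6\<close>, and geometric decay in \<open>q\<close> wins.\<close>
    also have "y ^ 22 * r ^ q \<le> B"
    proof -
      have "y \<le> z ^ 6" using q(3) unfolding y_def z_def by (metis of_nat_le_iff of_nat_power)
      then have "y ^ 22 \<le> (z ^ 6) ^ 22" using y by (intro power_mono) auto
      also have "\<dots> = z ^ 132" by (simp add: power_mult[symmetric])
      finally have "y ^ 22 * r ^ q \<le> z ^ 132 * r ^ q" using r by (intro mult_right_mono) auto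
      then show ?thesis using B(2)[of q] by (simp add: z_def)
    qed
    finally have "real N * (316 * H ^ 18 * \<epsilon>) \<le> d" using R A by (simp add: d_def mult_left_mono)
    also have "d \<le> c" by (rule c_ge)
    also have "c \<le> L"
    proof -
      have "c * 1 \<le> c * y" using y c_ge(1) by (intro mult_left_mono) auto
      then show ?thesis using L_lower(2) by simp
    qed
    also have "L \<le> L ^ 4" using \<open>c \<le> L\<close> c_ge(1) by (intro self_le_power) auto
    finally show ?thesis .
  qed
  interpret W: weakly_dependent_vectors M "\<lambda>j. past q (2 * j + p)" "\<lambda>j. block_sum (block_index n q (2 * j + p))" J m \<epsilon> \<eta>
    unfolding m_def \<epsilon>_def \<eta>_def z_def \<delta>_def c1_def by (rule weakly_dependent_blocks[OF q(1) p])
  have tr: "(\<Sum>j<N. W.trace j) \<le> s"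
  proof -
    have "(\<Sum>j<N. W.trace j) \<le> (\<Sum>j<N. c0 * z * D)"
      unfolding W.trace_def c0_def z_def by (intro sum_mono block_trace_le[OF block_index_finite block_index_card])
    also have "\<dots> = (real N * z) * (c0 * D)" by simp
    also have "\<dots> \<le> (2 * y) * (c0 * D)" using Nz c0 by (intro mult_right_mono) auto
    finally show ?thesis by (simp add: s_def mult_ac)
  qed
  have yD: "0 < y * D" using y D1 by (intro mult_pos_pos) auto
  have N0: "0 < N" by (simp add: N)
  have E_eq: "E = (\<lambda>\<omega>. max 0 (W.Y N \<omega> - s - y * D))"
  proof -
    have "(2 * c0 + 1) * (real n * D) = s + y * D" by (simp add: s_def y_def algebra_simps)
    then show ?thesis unfolding E_def W.Y_def W.T_def by (simp only: diff_diff_eq)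
  qed
  note ex = W.excess_bound[OF N0 H tr L0 cond1 cond2 cond3 cond4 yD]
  show "integrable M E" unfolding E_eq by (rule ex(1))
  have "(LINT \<omega>|M. E \<omega>) \<le> exp 15 * L ^ 4 / (y * D) ^ 3" unfolding E_eq by (rule ex(2))
  also have "\<dots> = exp 15 * c ^ 4 * real n / sqrt D"
  proof -
    have "L ^ 4 = (L\<^sup>2)\<^sup>2" by simp
    also have "\<dots> = c ^ 4 * y ^ 4 * D\<^sup>2 * (\<delta> * \<delta>)"
      unfolding L_sq by (simp add: power2_eq_square eval_nat_numeral mult_ac)
    also have "\<dots> = c ^ 4 * y ^ 4 * D\<^sup>2 * sqrt D" by (simp only: \<delta>)
    finally have "L ^ 4 / (y * D) ^ 3 = c ^ 4 * y * (sqrt D / D)"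
      using y D1 by (simp add: field_simps eval_nat_numeral)
    also have "sqrt D / D = 1 / sqrt D" using D1 by (simp add: real_div_sqrt field_simps)
    finally have eq: "L ^ 4 / (y * D) ^ 3 = c ^ 4 * y * (1 / sqrt D)" .
    have "exp 15 * L ^ 4 / (y * D) ^ 3 = exp 15 * (L ^ 4 / (y * D) ^ 3)" by simp
    then have "exp 15 * L ^ 4 / (y * D) ^ 3 = exp 15 * (c ^ 4 * y * (1 / sqrt D))" unfolding eq .
    then show ?thesis by (simp add: y_def mult.assoc)
  qed
  finally show "(LINT \<omega>|M. E \<omega>) \<le> exp 15 * c ^ 4 * real n / sqrt D" .
qed

text \<open>
The sums over even and over odd blocks are treated separately, using \<open>(u + v)\<^sup>2 \<le> 2 u\<^sup>2 + 2 v\<^sup>2\<close>.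
\<close>

theorem quadratic_excess_bound:
  assumes n: "(card J)\<^sup>2 \<le> n" and B: "0 \<le> B" "\<And>q::nat. real q ^ 132 * r ^ q \<le> B"
  defines "\<kappa> \<equiv> 4 * (2 * (2 * R * A / (1 - r)) + 1)" and "c \<equiv> excess_constant R Fb A r B"
  defines "E \<equiv> \<lambda>\<omega>. max 0 ((\<Sum>k\<in>J. (\<Sum>i=1..n. \<psi> k (X i \<omega>))\<^sup>2) - \<kappa> * (real n * D))"
  shows "integrable M E" "(LINT \<omega>|M. E \<omega>) \<le> 4 * exp 15 * c ^ 4 * real n / sqrt D"
proof -
  have "1 \<le> card J" using J by (simp add: Suc_le_eq card_gt_0_iff)
  then have "1 \<le> (card J)\<^sup>2" by simp
  then have n1: "1 \<le> n" using n by linarith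
  obtain q where q: "1 \<le> q" "q \<le> n" "n \<le> q ^ 6" "q ^ 6 \<le> 64 * n" using exists_block_length[OF n1] by blast
  define N where "N = n div (2 * q) + 1"
  have N: "n \<le> 2 * N * q"
  proof -
    have "n = n div (2 * q) * (2 * q) + n mod (2 * q)" by (rule div_mult_mod_eq[symmetric])
    also have "\<dots> \<le> n div (2 * q) * (2 * q) + 2 * q" using q(1) by (intro add_left_mono less_imp_le mod_less_divisor) auto
    finally show ?thesis by (simp add: N_def algebra_simps)
  qed
  define a where "a = (2 * (2 * R * A / (1 - r)) + 1) * (real n * D)"
  define T where "T = (\<lambda>p k \<omega>. \<Sum>j<N. block_sum (block_index n q (2 * j + p)) k \<omega>)"
  define E' where "E' = (\<lambda>p \<omega>. max 0 ((\<Sum>k\<in>J. (T p k \<omega>)\<^sup>2) - a))"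
  note half = half_excess_bound[OF n B q _ N_def, folded c_def]
  have E': "integrable M (E' p)" "(LINT \<omega>|M. E' p \<omega>) \<le> exp 15 * c ^ 4 * real n / sqrt D" if "p \<le> 1" for p
    using half[OF that] unfolding E'_def T_def a_def by auto
  have le: "E \<omega> \<le> 2 * E' 0 \<omega> + 2 * E' 1 \<omega>" for \<omega>
  proof -
    have "(\<Sum>k\<in>J. (\<Sum>i=1..n. \<psi> k (X i \<omega>))\<^sup>2) \<le> (\<Sum>k\<in>J. 2 * (T 0 k \<omega>)\<^sup>2 + 2 * (T 1 k \<omega>)\<^sup>2)"
    proof (rule sum_mono)
      fix k
      have "(\<Sum>i=1..n. \<psi> k (X i \<omega>)) = T 0 k \<omega> + T 1 k \<omega>"
        unfolding T_def using observations_split[OF N] by simp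
      moreover have "(u + v)\<^sup>2 \<le> 2 * u\<^sup>2 + 2 * v\<^sup>2" for u v :: real
        using sum_squares_bound[of u v] by (simp add: power2_sum)
      ultimately show "(\<Sum>i=1..n. \<psi> k (X i \<omega>))\<^sup>2 \<le> 2 * (T 0 k \<omega>)\<^sup>2 + 2 * (T 1 k \<omega>)\<^sup>2" by simp
    qed
    also have "\<dots> = 2 * (\<Sum>k\<in>J. (T 0 k \<omega>)\<^sup>2) + 2 * (\<Sum>k\<in>J. (T 1 k \<omega>)\<^sup>2)"
      by (simp add: sum.distrib sum_distrib_left)
    finally have "(\<Sum>k\<in>J. (\<Sum>i=1..n. \<psi> k (X i \<omega>))\<^sup>2) \<le> 2 * (\<Sum>k\<in>J. (T 0 k \<omega>)\<^sup>2) + 2 * (\<Sum>k\<in>J. (T 1 k \<omega>)\<^sup>2)" .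
    moreover have "\<kappa> * (real n * D) = 4 * a" by (simp only: \<kappa>_def a_def mult.assoc)
    moreover have "max 0 (s - 4 * a) \<le> 2 * max 0 (u - a) + 2 * max 0 (v - a)" if "s \<le> 2 * u + 2 * v" for s u v :: real
      using that by (auto simp: max_def)
    ultimately show ?thesis unfolding E_def E'_def by simp
  qed
  have E_meas: "E \<in> borel_measurable M"
  proof -
    have "(\<lambda>\<omega>. \<psi> k (X i \<omega>)) \<in> borel_measurable M" if "k \<in> J" for k i
      using measurable_compose[OF X \<psi>_measurable[OF that]] .
    then have "(\<lambda>\<omega>. \<Sum>k\<in>J. (\<Sum>i=1..n. \<psi> k (X i \<omega>))\<^sup>2) \<in> borel_measurable M"
      by (intro borel_measurable_sum borel_measurable_power) auto
    then show ?thesis unfolding E_def by measurable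
  qed
  show int: "integrable M E"
    by (rule Bochner_Integration.integrable_bound[of M "\<lambda>\<omega>. 2 * E' 0 \<omega> + 2 * E' 1 \<omega>"])
       (use E' E_meas le in \<open>auto simp: E_def E'_def intro!: AE_I2 order_trans[OF _ abs_ge_self]\<close>)
  have "(LINT \<omega>|M. E \<omega>) \<le> (LINT \<omega>|M. 2 * E' 0 \<omega> + 2 * E' 1 \<omega>)"
    using int E' le by (intro integral_mono) auto
  also have "\<dots> \<le> 4 * exp 15 * c ^ 4 * real n / sqrt D"
    using E'[of 0] E'[of 1] by simp
  finally show "(LINT \<omega>|M. E \<omega>) \<le> 4 * exp 15 * c ^ 4 * real n / sqrt D" .
qed

end

section \<open>Finite-dimensional models\<close>

definition ip :: "(real \<Rightarrow> real) \<Rightarrow> (real \<Rightarrow> real) \<Rightarrow> real" where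
  "ip s t = (LINT x:{0..1}|lborel. s x * t x)"

lemma l2_norm_nonneg: "0 \<le> l2_norm t"
  unfolding l2_norm_def set_lebesgue_integral_def
  by (intro real_sqrt_ge_zero Bochner_Integration.integral_nonneg) (simp add: indicator_def)

lemma l2_norm_sq: "(l2_norm t)\<^sup>2 = ip t t"
proof -
  have "0 \<le> ip t t" unfolding ip_def set_lebesgue_integral_def by (intro Bochner_Integration.integral_nonneg) (simp add: indicator_def)
  then show ?thesis by (simp add: l2_norm_def ip_def power2_eq_square)
qed

lemma ip_commute: "ip s t = ip t s" by (simp add: ip_def mult.commute)

lemma Linf_borel_bounded: assumes "t \<in> Linf" shows "\<exists>B. borel_bounded B t"
proof -
  have "bdd_above ((\<lambda>x. \<bar>t x\<bar>) ` {0..1})" using assms by (simp add: Linf_def)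
  then obtain B where "\<And>y. y \<in> (\<lambda>x. \<bar>t x\<bar>) ` {0..1} \<Longrightarrow> y \<le> B" unfolding bdd_above_def by blast
  then have B: "\<bar>t x\<bar> \<le> B" if "x \<in> {0..1}" for x using that by blast
  have "0 \<le> B" using B[of 0] by (meson abs_ge_zero atLeastAtMost_iff order_trans zero_le_one order_refl)
  then have "borel_bounded B t"
    using assms B unfolding Linf_def by (intro borel_boundedI) (auto, metis abs_zero atLeastAtMost_iff)
  then show ?thesis by blast
qed

lemma set_integrable_product:
  assumes "borel_bounded B s" "borel_bounded C t" shows "set_integrable lborel {0..1::real} (\<lambda>x. s x * t x)"
  unfolding set_integrable_def
  by (rule integrableI_bounded_set_indicator[where B="B * C"])
     (use borel_bounded_mult[OF assms] in \<open>auto simp: borel_bounded_def\<close>)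

lemma ip_add_left:
  assumes "borel_bounded B s" "borel_bounded B' s'" "borel_bounded C t"
  shows "ip (\<lambda>x. s x + s' x) t = ip s t + ip s' t"
  unfolding ip_def distrib_right using assms by (intro set_integral_add(2) set_integrable_product)

lemma ip_diff_left:
  assumes "borel_bounded B s" "borel_bounded B' s'" "borel_bounded C t"
  shows "ip (\<lambda>x. s x - s' x) t = ip s t - ip s' t"
  unfolding ip_def left_diff_distrib using assms by (intro set_integral_diff(2) set_integrable_product)

lemma ip_cmult_left: "ip (\<lambda>x. a * s x) t = a * ip s t"
  unfolding ip_def by (simp add: mult.assoc)

lemma ip_sum_left:
  assumes "\<And>i. i \<in> J \<Longrightarrow> borel_bounded (B i) (s i)" "borel_bounded C t"
  shows "ip (\<lambda>x. \<Sum>i\<in>J. c i * s i x) t = (\<Sum>i\<in>J. c i * ip (s i) t)"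
  using assms(1)
proof (induction J rule: infinite_finite_induct)
  case (insert j J)
  have "ip (\<lambda>x. c j * s j x + (\<Sum>i\<in>J. c i * s i x)) t = ip (\<lambda>x. c j * s j x) t + ip (\<lambda>x. \<Sum>i\<in>J. c i * s i x) t"
    using insert by (intro ip_add_left[OF borel_bounded_cmult borel_bounded_sum[OF borel_bounded_cmult] assms(2)]) auto
  then show ?case using insert by (simp add: ip_cmult_left)
qed (simp_all add: ip_def set_lebesgue_integral_def)

definition orthonormal_basis :: "(real \<Rightarrow> real) set \<Rightarrow> nat \<Rightarrow> (nat \<Rightarrow> real \<Rightarrow> real) \<Rightarrow> bool" where
  "orthonormal_basis S D e \<longleftrightarrow>
     (\<forall>i<D. e i \<in> S) \<and> (\<forall>i<D. \<forall>j<D. ip (e i) (e j) = (if i = j then 1 else 0)) \<and>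
     (\<forall>t\<in>S. \<exists>c. t = (\<lambda>x. \<Sum>i<D. c i * e i x))"

lemma subspace_combination:
  assumes "fun_vs.subspace S" "\<And>i. i \<in> J \<Longrightarrow> e i \<in> S"
  shows "(\<lambda>x. \<Sum>i\<in>J. c i * e i x) \<in> S"
proof -
  have "(\<Sum>i\<in>J. fun_scale (c i) (e i)) \<in> S"
    using assms by (intro fun_vs.subspace_sum fun_vs.subspace_scale)
  moreover have "(\<Sum>i\<in>J. fun_scale (c i) (e i)) = (\<lambda>x. \<Sum>i\<in>J. c i * e i x)"
    by (induction J rule: infinite_finite_induct) (auto simp: fun_scale_def fun_eq_iff)
  ultimately show ?thesis by simp
qed

lemma ip_combination_basis:
  fixes e :: "nat \<Rightarrow> real \<Rightarrow> real"
  assumes e: "\<And>i. i < D \<Longrightarrow> \<exists>B. borel_bounded B (e i)"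
    and on: "\<And>i j. i < D \<Longrightarrow> j < D \<Longrightarrow> ip (e i) (e j) = (if i = j then 1 else 0)" and j: "j < D"
  shows "ip (\<lambda>x. \<Sum>i<D. c i * e i x) (e j) = c j"
proof -
  obtain B where B: "\<And>i. i < D \<Longrightarrow> borel_bounded (B i) (e i)" using e by metis
  have "ip (\<lambda>x. \<Sum>i<D. c i * e i x) (e j) = (\<Sum>i<D. c i * ip (e i) (e j))"
    using B j by (intro ip_sum_left[of _ B _ "B j"]) auto
  also have "\<dots> = (\<Sum>i<D. if i = j then c i else 0)" using on j by (intro sum.cong) auto
  also have "\<dots> = c j" by (subst sum.delta) (use j in auto)
  finally show ?thesis .
qed

text \<open>
Elements of a model are functions and not classes, so the bilinear form \<open>ip\<close> is positive definite on
it only by hypothesis; for the models at hand this follows from the bound on \<open>phi\<close>.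
\<close>

lemma gram_schmidt:
  assumes "finite B" "fun_vs.independent B" "fun_vs.span B \<subseteq> Linf"
    and pos: "\<And>t. t \<in> fun_vs.span B \<Longrightarrow> t \<noteq> 0 \<Longrightarrow> 0 < ip t t"
  shows "\<exists>e. orthonormal_basis (fun_vs.span B) (card B) e"
  using assms
proof (induction B rule: finite_induct)
  case empty
  then show ?case by (auto simp: orthonormal_basis_def fun_eq_iff)
next
  case (insert a B)
  define D where "D = card B"
  have sub: "fun_vs.span B \<subseteq> fun_vs.span (insert a B)" by (rule fun_vs.span_mono) auto
  have ind: "fun_vs.independent B" "a \<notin> fun_vs.span B"
    using insert.prems(1) insert.hyps fun_vs.independent_insert[of a B] by auto
  obtain e where e: "orthonormal_basis (fun_vs.span B) D e"
    unfolding D_def using insert.IH[OF ind(1)] insert.prems(2,3) sub by blast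
  note e_in = e[unfolded orthonormal_basis_def, THEN conjunct1, rule_format]
    and e_on = e[unfolded orthonormal_basis_def, THEN conjunct2, THEN conjunct1, rule_format]
    and e_span = e[unfolded orthonormal_basis_def, THEN conjunct2, THEN conjunct2, rule_format]
  have e_bdd: "\<exists>C. borel_bounded C (e i)" if "i < D" for i
    using e_in[OF that] sub insert.prems(2) Linf_borel_bounded by blast
  have a_in: "a \<in> fun_vs.span (insert a B)" by (simp add: fun_vs.span_base)
  obtain Ca where Ca: "borel_bounded Ca a" using a_in insert.prems(2) Linf_borel_bounded by blast
  define p where "p = (\<lambda>x. \<Sum>i<D. ip a (e i) * e i x)"
  have p_in: "p \<in> fun_vs.span B" unfolding p_def by (rule subspace_combination) (auto intro: e_in)
  obtain Cp where Cp: "borel_bounded Cp p" using p_in sub insert.prems(2) Linf_borel_bounded by blast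
  define u where "u = a - p"
  have u_eq: "u = (\<lambda>x. a x - p x)" by (simp add: u_def fun_eq_iff)
  have u_in: "u \<in> fun_vs.span (insert a B)"
    unfolding u_def using a_in p_in sub by (intro fun_vs.span_diff) auto
  have "u \<noteq> 0" using ind(2) p_in by (auto simp: u_def)
  then have N: "0 < ip u u" using insert.prems(3) u_in by blast
  have u_orth: "ip u (e j) = 0" if "j < D" for j
  proof -
    obtain C where "borel_bounded C (e j)" using e_bdd[OF \<open>j < D\<close>] by blast
    then have "ip u (e j) = ip a (e j) - ip p (e j)" unfolding u_eq by (rule ip_diff_left[OF Ca Cp])
    then show ?thesis unfolding p_def using ip_combination_basis[OF e_bdd e_on that] by simp
  qed
  define e' where "e' = e(D := (\<lambda>x. (1 / sqrt (ip u u)) * u x))"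
  have e'_less: "e' i = e i" if "i < D" for i using that by (simp add: e'_def)
  have e'_D: "e' D = (\<lambda>x. (1 / sqrt (ip u u)) * u x)" by (simp add: e'_def)
  have "orthonormal_basis (fun_vs.span (insert a B)) (Suc D) e'"
    unfolding orthonormal_basis_def
  proof (intro conjI allI impI ballI)
    fix i assume i: "i < Suc D"
    show "e' i \<in> fun_vs.span (insert a B)"
    proof (cases "i = D")
      case True
      then show ?thesis using fun_vs.span_scale[OF u_in, of "1 / sqrt (ip u u)"] by (simp add: e'_D fun_scale_def)
    next
      case False
      then show ?thesis using i e_in[of i] sub by (auto simp: e'_less)
    qed
    fix j assume j: "j < Suc D"
    have D_less': "ip (e' D) (e' k) = 0" if "k < D" for k
      unfolding e'_less[OF that] e'_D ip_cmult_left u_orth[OF that] by simp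
    have D_less: "ip (e' D) (e' k) = 0" "ip (e' k) (e' D) = 0" if "k < D" for k
      using D_less'[OF that] ip_commute[of "e' k" "e' D"] by auto
    have DD: "ip (e' D) (e' D) = 1"
    proof -
      have "ip (e' D) (e' D) = (1 / sqrt (ip u u)) * ip u (e' D)"
        by (subst (1) e'_D) (rule ip_cmult_left)
      also have "ip u (e' D) = ip (e' D) u" by (rule ip_commute)
      also have "ip (e' D) u = (1 / sqrt (ip u u)) * ip u u" unfolding e'_D by (rule ip_cmult_left)
      finally show ?thesis using N by (simp add: field_simps)
    qed
    show "ip (e' i) (e' j) = (if i = j then 1 else 0)"
      using i j e_on[of i j] D_less DD by (cases "i = D"; cases "j = D") (auto simp: e'_less)
  next
    fix t assume "t \<in> fun_vs.span (insert a B)"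
    then obtain k where "t - fun_scale k a \<in> fun_vs.span B" unfolding fun_vs.span_insert by auto
    then obtain c where c: "t - fun_scale k a = (\<lambda>x. \<Sum>i<D. c i * e i x)" using e_span by blast
    have "t x = (\<Sum>i<Suc D. (if i = D then k * sqrt (ip u u) else c i + k * ip a (e i)) * e' i x)" for x
    proof -
      have "t x = k * a x + (\<Sum>i<D. c i * e i x)"
        using fun_cong[OF c, of x] by (simp add: fun_scale_def)
      also have "a x = u x + p x" by (simp add: u_eq)
      also have "k * (u x + p x) + (\<Sum>i<D. c i * e i x) = k * u x + (\<Sum>i<D. (c i + k * ip a (e i)) * e i x)"
        by (simp add: p_def algebra_simps sum.distrib sum_distrib_left)
      also have "(\<Sum>i<D. (c i + k * ip a (e i)) * e i x)
          = (\<Sum>i<D. (if i = D then k * sqrt (ip u u) else c i + k * ip a (e i)) * e' i x)"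
        by (intro sum.cong) (auto simp: e'_less)
      finally show ?thesis using N by (simp add: e'_D)
    qed
    then have "t = (\<lambda>x. \<Sum>i<Suc D. (if i = D then k * sqrt (ip u u) else c i + k * ip a (e i)) * e' i x)"
      by (rule ext)
    then show "\<exists>c. t = (\<lambda>x. \<Sum>i<Suc D. c i * e' i x)"
      by (rule exI[where x="\<lambda>i. if i = D then k * sqrt (ip u u) else c i + k * ip a (e i)"])
  qed
  then show ?case using insert.hyps by (auto simp: D_def)
qed

lemma sup_norm_upper: "t \<in> Linf \<Longrightarrow> \<bar>t x\<bar> \<le> sup_norm t"
proof (cases "x \<in> {0..1}")
  case True
  assume "t \<in> Linf"
  then show ?thesis unfolding sup_norm_def using True by (intro cSUP_upper) (auto simp: Linf_def)
next
  case False
  assume t: "t \<in> Linf"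
  then have "t x = 0" using False by (auto simp: Linf_def)
  moreover have "\<bar>t 0\<bar> \<le> sup_norm t"
    unfolding sup_norm_def using t by (intro cSUP_upper) (auto simp: Linf_def)
  ultimately show ?thesis by simp
qed

text \<open>
A nonzero function of norm \<open>0\<close> would make the supremum in \<open>phi\<close> infinite. The same happens when the
dimension is \<open>0\<close>, because then the factor in front of the supremum is infinite.
\<close>

lemma phi_bound:
  assumes S: "S \<subseteq> Linf" and phi: "phi S \<le> ereal r0" and t: "t \<in> S" "t \<noteq> 0"
  shows "0 < l2_norm t" "sup_norm t \<le> r0 * sqrt (real (fun_vs.dim S)) * l2_norm t"
proof -
  define Q where "Q = (SUP t\<in>S - {0}. ereal (sup_norm t) / ereal (l2_norm t))"
  define d where "d = sqrt (real (fun_vs.dim S))"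
  obtain x where "t x \<noteq> 0" using t(2) by (auto simp: fun_eq_iff)
  then have sup: "0 < sup_norm t" using sup_norm_upper[of t x] S t(1) by auto
  note l0 = l2_norm_nonneg[of t]
  have le: "ereal (sup_norm t) / ereal (l2_norm t) \<le> Q" unfolding Q_def using t by (intro SUP_upper) auto
  have phi': "1 / ereal d * Q \<le> ereal r0" using phi by (simp add: phi_def Q_def d_def)
  have d0: "0 \<le> d" by (simp add: d_def)
  have pos: "0 < ereal (sup_norm t) / ereal (l2_norm t)"
    using sup l0 by (cases "l2_norm t = 0") (auto simp: divide_ereal_def)
  have d_pos: "0 < d"
  proof (rule ccontr)
    assume "\<not> 0 < d"
    then have inf: "1 / ereal d = \<infinity>" using d0 by (simp add: divide_ereal_def)
    have "0 < Q" by (rule less_le_trans[OF pos le])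
    then have "\<infinity> * Q = \<infinity>" by (cases Q) auto
    then have "1 / ereal d * Q = \<infinity>" unfolding inf .
    then show False using phi' by simp
  qed
  have inv: "1 / ereal d = ereal (1 / d)" using d_pos by (simp add: divide_ereal_def inverse_eq_divide)
  show l: "0 < l2_norm t"
  proof (rule ccontr)
    assume "\<not> 0 < l2_norm t"
    then have "ereal (sup_norm t) / ereal (l2_norm t) = \<infinity>" using l0 sup by (simp add: divide_ereal_def)
    then have "Q = \<infinity>" using le by simp
    then show False using phi' inv d_pos by simp
  qed
  have "ereal (1 / d * (sup_norm t / l2_norm t)) = 1 / ereal d * (ereal (sup_norm t) / ereal (l2_norm t))"
    using inv l by simp
  also have "\<dots> \<le> 1 / ereal d * Q" using le inv d_pos by (intro ereal_mult_left_mono) auto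
  also have "\<dots> \<le> ereal r0" by (rule phi')
  finally have "1 / d * (sup_norm t / l2_norm t) \<le> r0" by simp
  then show "sup_norm t \<le> r0 * sqrt (real (fun_vs.dim S)) * l2_norm t"
    using d_pos l by (simp add: d_def[symmetric] field_simps)
qed

lemma finite_span_basis:
  assumes "fun_vs.subspace S" "finite B0" "fun_vs.span B0 = S"
  obtains B where "finite B" "fun_vs.independent B" "fun_vs.span B = S" "card B = fun_vs.dim S"
proof -
  obtain B where B: "B \<subseteq> S" "fun_vs.independent B" "S \<subseteq> fun_vs.span B" "card B = fun_vs.dim S"
    using fun_vs.basis_exists[of S] by blast
  have "finite B" using fun_vs.independent_span_bound[OF assms(2) B(2)] B(1) assms(3) by auto
  moreover have "fun_vs.span B = S" using B fun_vs.span_minimal[OF B(1) assms(1)] by auto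
  ultimately show thesis using that B by blast
qed

locale linear_model =
  fixes S :: "(real \<Rightarrow> real) set" and e :: "nat \<Rightarrow> real \<Rightarrow> real" and D :: nat and r0 :: real
  assumes subspace: "fun_vs.subspace S" and Linf: "S \<subseteq> Linf" and D: "D = fun_vs.dim S"
    and basis: "orthonormal_basis S D e"
    and sup_le: "\<And>t x. t \<in> S \<Longrightarrow> \<bar>t x\<bar> \<le> r0 * sqrt (real D) * l2_norm t"
begin

lemma e_in: "i < D \<Longrightarrow> e i \<in> S"
  and e_orthonormal: "i < D \<Longrightarrow> j < D \<Longrightarrow> ip (e i) (e j) = (if i = j then 1 else 0)"
  and e_span: "t \<in> S \<Longrightarrow> \<exists>c. t = (\<lambda>x. \<Sum>i<D. c i * e i x)"
  using basis unfolding orthonormal_basis_def by blast+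

lemma bounded_S: "t \<in> S \<Longrightarrow> \<exists>B. borel_bounded B t"
  using Linf Linf_borel_bounded by blast

lemma combination_in: "(\<lambda>x. \<Sum>i<D. c i * e i x) \<in> S"
  by (rule subspace_combination[OF subspace]) (auto intro: e_in)

lemma ip_combination_left: assumes "borel_bounded B t"
  shows "ip (\<lambda>x. \<Sum>i<D. c i * e i x) t = (\<Sum>i<D. c i * ip (e i) t)"
proof -
  have "\<forall>i\<in>{..<D}. \<exists>B. borel_bounded B (e i)" using bounded_S e_in by blast
  from bchoice[OF this] obtain C where C: "\<And>i. i < D \<Longrightarrow> borel_bounded (C i) (e i)" by auto
  show ?thesis using C by (intro ip_sum_left[of _ C, OF _ assms]) auto
qed

lemma norm_combination: "(l2_norm (\<lambda>x. \<Sum>i<D. c i * e i x))\<^sup>2 = (\<Sum>i<D. (c i)\<^sup>2)"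
proof -
  obtain C where C: "borel_bounded C (\<lambda>x. \<Sum>i<D. c i * e i x)" using bounded_S combination_in by blast
  have "(l2_norm (\<lambda>x. \<Sum>i<D. c i * e i x))\<^sup>2 = (\<Sum>i<D. c i * ip (\<lambda>x. \<Sum>i<D. c i * e i x) (e i))"
    unfolding l2_norm_sq ip_combination_left[OF C] by (simp only: ip_commute)
  also have "\<dots> = (\<Sum>i<D. c i * c i)"
    by (intro sum.cong refl, subst ip_combination_basis[of D e]) (use bounded_S e_in e_orthonormal in auto)
  finally show ?thesis by (simp add: power2_eq_square)
qed

text \<open>
Apply the bound on the supremum to the element \<open>(\<Sum>i. e i x e i)\<close>, whose value at \<open>x\<close> and whose
squared norm both equal the left-hand side.
\<close>

lemma basis_sq_sum: "(\<Sum>i<D. (e i x)\<^sup>2) \<le> r0\<^sup>2 * real D"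
proof -
  define v where "v = (\<Sum>i<D. (e i x)\<^sup>2)"
  define t where "t = (\<lambda>y. \<Sum>i<D. e i x * e i y)"
  have v0: "0 \<le> v" by (simp add: v_def sum_nonneg)
  have "(l2_norm t)\<^sup>2 = v" unfolding t_def v_def by (rule norm_combination)
  moreover have "0 \<le> l2_norm t" by (rule l2_norm_nonneg)
  ultimately have l: "l2_norm t = sqrt v" by (metis real_sqrt_unique)
  have "t x = v" by (simp add: t_def v_def power2_eq_square)
  then have "v \<le> r0 * sqrt (real D) * sqrt v"
  proof -
    have "t \<in> S" unfolding t_def by (rule combination_in)
    then show ?thesis using sup_le[of t x] l \<open>t x = v\<close> v0 by simp
  qed
  then have "v\<^sup>2 \<le> (r0 * sqrt (real D) * sqrt v)\<^sup>2" using v0 by (intro power_mono)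
  also have "\<dots> = (r0\<^sup>2 * real D) * v" using v0 by (simp add: power_mult_distrib)
  finally have "v * v \<le> (r0\<^sup>2 * real D) * v" by (simp add: power2_eq_square)
  then show ?thesis unfolding v_def[symmetric] using v0 by (cases "v = 0") auto
qed

definition coefficients :: "nat \<Rightarrow> (nat \<Rightarrow> real) \<Rightarrow> nat \<Rightarrow> real" where
  "coefficients n z i = (\<Sum>j=1..n. e i (z j)) / real n"

text \<open>
Completing the square; the minimiser of the contrast has the empirical means as coordinates.
\<close>

lemma contrast_combination:
  assumes n: "1 \<le> n"
  shows "contrast n z (\<lambda>x. \<Sum>i<D. c i * e i x)
    = (\<Sum>i<D. (c i - coefficients n z i)\<^sup>2) - (\<Sum>i<D. (coefficients n z i)\<^sup>2)"
proof -
  have "contrast n z (\<lambda>x. \<Sum>i<D. c i * e i x) = (\<Sum>i<D. (c i)\<^sup>2) - 2 * ((\<Sum>j=1..n. \<Sum>i<D. c i * e i (z j)) / real n)"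
    using n unfolding contrast_def norm_combination
    by (simp add: sum_subtractf sum_distrib_left[symmetric] field_simps)
  also have "(\<Sum>j=1..n. \<Sum>i<D. c i * e i (z j)) / real n = (\<Sum>i<D. c i * coefficients n z i)"
    by (subst sum.swap) (simp add: coefficients_def sum_distrib_left sum_divide_distrib)
  also have "(\<Sum>i<D. (c i)\<^sup>2) - 2 * (\<Sum>i<D. c i * coefficients n z i)
    = (\<Sum>i<D. (c i - coefficients n z i)\<^sup>2 - (coefficients n z i)\<^sup>2)"
    by (simp add: sum_subtractf[symmetric] sum_distrib_left power2_diff) (simp add: mult.assoc)
  finally show ?thesis by (simp add: sum_subtractf)
qed

lemma min_contrast_est_eq:
  assumes n: "1 \<le> n"
  shows "min_contrast_est n z S = (\<lambda>x. \<Sum>i<D. coefficients n z i * e i x)"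
proof -
  define b where "b = coefficients n z"
  have val: "contrast n z (\<lambda>x. \<Sum>i<D. b i * e i x) = - (\<Sum>i<D. (b i)\<^sup>2)"
    using contrast_combination[OF n, of z b] by (simp add: b_def)
  have lower: "- (\<Sum>i<D. (b i)\<^sup>2) \<le> contrast n z t" if tS: "t \<in> S" for t
  proof -
    obtain c where c: "t = (\<lambda>x. \<Sum>i<D. c i * e i x)" using e_span[OF tS] by blast
    show ?thesis unfolding c contrast_combination[OF n] b_def[symmetric] by (simp add: sum_nonneg)
  qed
  have "is_arg_min (contrast n z) (\<lambda>t. t \<in> S) (\<lambda>x. \<Sum>i<D. b i * e i x)"
    unfolding is_arg_min_def using combination_in lower val by (auto simp: not_less)
  then have min: "is_arg_min (contrast n z) (\<lambda>t. t \<in> S) (min_contrast_est n z S)"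
    unfolding min_contrast_est_def arg_min_def
    by (rule someI[where P="is_arg_min (contrast n z) (\<lambda>t. t \<in> S)"])
  then have mS: "min_contrast_est n z S \<in> S" by (simp add: is_arg_min_def)
  then obtain c where c: "min_contrast_est n z S = (\<lambda>x. \<Sum>i<D. c i * e i x)" using e_span by blast
  have "\<not> contrast n z (\<lambda>x. \<Sum>i<D. b i * e i x) < contrast n z (min_contrast_est n z S)"
    using min combination_in unfolding is_arg_min_def by blast
  then have "(\<Sum>i<D. (c i - b i)\<^sup>2) \<le> 0"
    unfolding val unfolding c contrast_combination[OF n] b_def[symmetric] by simp
  then have "\<forall>i\<in>{..<D}. (c i - b i)\<^sup>2 = 0"
    using sum_nonneg_eq_0_iff[of "{..<D}" "\<lambda>i. (c i - b i)\<^sup>2"] sum_nonneg[of "{..<D}" "\<lambda>i. (c i - b i)\<^sup>2"] by auto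
  then show ?thesis unfolding c b_def by (intro ext sum.cong) auto
qed

lemma min_contrast_est_in: "1 \<le> n \<Longrightarrow> min_contrast_est n z S \<in> S"
  using combination_in by (simp add: min_contrast_est_eq)

lemma min_contrast_est_minimises:
  assumes n: "1 \<le> n" and t: "t \<in> S" shows "contrast n z (min_contrast_est n z S) \<le> contrast n z t"
proof -
  obtain c where c: "t = (\<lambda>x. \<Sum>i<D. c i * e i x)" using e_span[OF t] by blast
  show ?thesis unfolding min_contrast_est_eq[OF n] c contrast_combination[OF n] by (simp add: sum_nonneg)
qed

definition projection :: "(real \<Rightarrow> real) \<Rightarrow> real \<Rightarrow> real" where
  "projection f = (\<lambda>x. \<Sum>i<D. ip (e i) f * e i x)"

lemma distance_combination:
  assumes f: "borel_bounded C f"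
  shows "(l2_norm (\<lambda>x. (\<Sum>i<D. c i * e i x) - f x))\<^sup>2
    = (\<Sum>i<D. (c i - ip (e i) f)\<^sup>2) + (ip f f - (\<Sum>i<D. (ip (e i) f)\<^sup>2))"
proof -
  obtain B where B: "borel_bounded B (\<lambda>x. \<Sum>i<D. c i * e i x)" using bounded_S combination_in by blast
  let ?t = "\<lambda>x. \<Sum>i<D. c i * e i x"
  note diff = borel_bounded_diff[OF B f]
  have "(l2_norm (\<lambda>x. ?t x - f x))\<^sup>2 = ip ?t (\<lambda>x. ?t x - f x) - ip f (\<lambda>x. ?t x - f x)"
    unfolding l2_norm_sq by (rule ip_diff_left[OF B f diff])
  also have "ip ?t (\<lambda>x. ?t x - f x) = ip ?t ?t - ip f ?t"
    unfolding ip_commute[of ?t "\<lambda>x. ?t x - f x"] by (rule ip_diff_left[OF B f B])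
  also have "ip f (\<lambda>x. ?t x - f x) = ip ?t f - ip f f"
    unfolding ip_commute[of f "\<lambda>x. ?t x - f x"] by (rule ip_diff_left[OF B f f])
  also have "ip f ?t = ip ?t f" by (rule ip_commute)
  also have "ip ?t ?t = (\<Sum>i<D. (c i)\<^sup>2)" using norm_combination[of c] by (simp add: l2_norm_sq)
  also have "ip ?t f = (\<Sum>i<D. c i * ip (e i) f)" by (rule ip_combination_left[OF f])
  finally show ?thesis
    by (simp add: power2_diff sum.distrib sum_subtractf sum_distrib_left algebra_simps)
qed

lemma projection_in: "projection f \<in> S"
  unfolding projection_def by (rule combination_in)

lemma projection_le_dist:
  assumes f: "borel_bounded C f"
  shows "(l2_norm (\<lambda>x. projection f x - f x))\<^sup>2 \<le> (l2_dist_set f S)\<^sup>2"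
proof -
  have sym: "l2_norm (\<lambda>x. f x - t x) = l2_norm (\<lambda>x. t x - f x)" for t
    by (simp add: l2_norm_def power2_commute)
  have "l2_norm (\<lambda>x. projection f x - f x) \<le> l2_dist_set f S"
    unfolding l2_dist_set_def
  proof (rule cINF_greatest)
    show "S \<noteq> {}" using projection_in by blast
    fix t assume "t \<in> S"
    then obtain c where c: "t = (\<lambda>x. \<Sum>i<D. c i * e i x)" using e_span by blast
    have "(l2_norm (\<lambda>x. projection f x - f x))\<^sup>2 \<le> (l2_norm (\<lambda>x. t x - f x))\<^sup>2"
      unfolding projection_def c distance_combination[OF f] by (simp add: sum_nonneg)
    then show "l2_norm (\<lambda>x. projection f x - f x) \<le> l2_norm (\<lambda>x. f x - t x)"
      unfolding sym by (rule power2_le_imp_le) (rule l2_norm_nonneg)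
  qed
  then show ?thesis by (intro power_mono l2_norm_nonneg)
qed

end

lemma linear_model_exists:
  assumes "fun_vs.subspace S" "S \<subseteq> Linf" "finite B" "fun_vs.span B = S" "phi S \<le> ereal r0"
  shows "\<exists>e. linear_model S e (fun_vs.dim S) r0"
proof -
  obtain B' where B': "finite B'" "fun_vs.independent B'" "fun_vs.span B' = S" "card B' = fun_vs.dim S"
    using finite_span_basis[OF assms(1,3,4)] by blast
  have "0 < ip t t" if "t \<in> S" "t \<noteq> 0" for t
    using phi_bound(1)[OF assms(2,5) that] by (simp add: l2_norm_sq[symmetric])
  then obtain e where e: "orthonormal_basis S (fun_vs.dim S) e"
    using gram_schmidt[OF B'(1,2)] B'(3,4) assms(2) by auto
  have "linear_model S e (fun_vs.dim S) r0"
  proof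
    fix t x assume t: "t \<in> S"
    show "\<bar>t x\<bar> \<le> r0 * sqrt (real (fun_vs.dim S)) * l2_norm t"
    proof (cases "t = 0")
      case True
      then show ?thesis by (simp add: l2_norm_def)
    next
      case False
      then show ?thesis using phi_bound(2)[OF assms(2,5) t False] sup_norm_upper[of t x] assms(2) t by auto
    qed
  qed (use assms e in auto)
  then show ?thesis by blast
qed

section \<open>Empirical errors and the oracle inequality\<close>

lemma ip_nonneg: "0 \<le> ip t t"
  using l2_norm_sq[of t] by (metis zero_le_power2)

lemma l2_norm_diff_sq:
  assumes "borel_bounded B t" "borel_bounded C f"
  shows "(l2_norm (\<lambda>x. t x - f x))\<^sup>2 = ip t t - 2 * ip t f + ip f f"
proof -
  note d = borel_bounded_diff[OF assms]
  have "(l2_norm (\<lambda>x. t x - f x))\<^sup>2 = ip t (\<lambda>x. t x - f x) - ip f (\<lambda>x. t x - f x)"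
    unfolding l2_norm_sq by (rule ip_diff_left[OF assms d])
  also have "ip t (\<lambda>x. t x - f x) = ip t t - ip f t"
    using ip_diff_left[OF assms assms(1)] by (simp only: ip_commute[of t "\<lambda>x. t x - f x"])
  also have "ip f (\<lambda>x. t x - f x) = ip t f - ip f f"
    using ip_diff_left[OF assms assms(2)] by (simp only: ip_commute[of f "\<lambda>x. t x - f x"])
  finally show ?thesis using ip_commute[of f t] by simp
qed

text \<open>
This is \<open>\<parallel>s + t - 2 f\<parallel>\<^sup>2 \<ge> 0\<close>.
\<close>

lemma l2_norm_diff_le:
  assumes "borel_bounded B s" "borel_bounded B' t" "borel_bounded C f"
  shows "(l2_norm (\<lambda>x. s x - t x))\<^sup>2 \<le> 2 * (l2_norm (\<lambda>x. s x - f x))\<^sup>2 + 2 * (l2_norm (\<lambda>x. t x - f x))\<^sup>2"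
proof -
  have "0 \<le> ip (\<lambda>x. (s x + t x) - 2 * f x) (\<lambda>x. (s x + t x) - 2 * f x)" by (rule ip_nonneg)
  also have "\<dots> = (l2_norm (\<lambda>x. (s x + t x) - 2 * f x))\<^sup>2" by (rule l2_norm_sq[symmetric])
  also have "\<dots> = ip (\<lambda>x. s x + t x) (\<lambda>x. s x + t x) - 2 * ip (\<lambda>x. s x + t x) (\<lambda>x. 2 * f x) + ip (\<lambda>x. 2 * f x) (\<lambda>x. 2 * f x)"
    by (rule l2_norm_diff_sq[OF borel_bounded_add[OF assms(1,2)] borel_bounded_cmult[OF assms(3)]])
  also have "ip (\<lambda>x. s x + t x) (\<lambda>x. 2 * f x) = 2 * (ip s f + ip t f)"
    unfolding ip_commute[of "\<lambda>x. s x + t x" "\<lambda>x. 2 * f x"] ip_cmult_left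
    using ip_add_left[OF assms] by (simp only: ip_commute[of f "\<lambda>x. s x + t x"])
  also have "ip (\<lambda>x. 2 * f x) (\<lambda>x. 2 * f x) = 4 * ip f f"
    unfolding ip_cmult_left ip_commute[of f "\<lambda>x. 2 * f x"] by simp
  also have "ip (\<lambda>x. s x + t x) (\<lambda>x. s x + t x) = ip s s + 2 * ip s t + ip t t"
  proof -
    have "ip (\<lambda>x. s x + t x) (\<lambda>x. s x + t x) = ip s (\<lambda>x. s x + t x) + ip t (\<lambda>x. s x + t x)"
      by (rule ip_add_left[OF assms(1,2) borel_bounded_add[OF assms(1,2)]])
    also have "ip s (\<lambda>x. s x + t x) = ip s s + ip t s"
      using ip_add_left[OF assms(1,2,1)] by (simp only: ip_commute[of s "\<lambda>x. s x + t x"])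
    also have "ip t (\<lambda>x. s x + t x) = ip s t + ip t t"
      using ip_add_left[OF assms(1,2,2)] by (simp only: ip_commute[of t "\<lambda>x. s x + t x"])
    finally show ?thesis using ip_commute[of s t] by simp
  qed
  finally have "0 \<le> ip s s + 2 * ip s t + ip t t - 4 * (ip s f + ip t f) + 4 * ip f f" by simp
  then show ?thesis
    unfolding l2_norm_diff_sq[OF assms(1,3)] l2_norm_diff_sq[OF assms(2,3)] l2_norm_diff_sq[OF assms(1,2)] by simp
qed

definition empirical_error :: "(real \<Rightarrow> real) \<Rightarrow> nat \<Rightarrow> (nat \<Rightarrow> real) \<Rightarrow> (real \<Rightarrow> real) \<Rightarrow> real" where
  "empirical_error f n z t = (\<Sum>j=1..n. t (z j)) / real n - ip t f"

lemma contrast_eq: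
  assumes "1 \<le> n" "borel_bounded B t" "borel_bounded C f"
  shows "contrast n z t = (l2_norm (\<lambda>x. t x - f x))\<^sup>2 - ip f f - 2 * empirical_error f n z t"
proof -
  have "contrast n z t = (l2_norm t)\<^sup>2 - 2 * ((\<Sum>j=1..n. t (z j)) / real n)"
    using assms(1) unfolding contrast_def by (simp add: sum_subtractf sum_distrib_left[symmetric] field_simps)
  then show ?thesis unfolding l2_norm_diff_sq[OF assms(2,3)] empirical_error_def by (simp add: l2_norm_sq)
qed

lemma empirical_error_diff:
  assumes "borel_bounded B s" "borel_bounded B' t" "borel_bounded C f"
  shows "empirical_error f n z (\<lambda>x. s x - t x) = empirical_error f n z s - empirical_error f n z t"
  unfolding empirical_error_def ip_diff_left[OF assms] by (simp add: sum_subtractf diff_divide_distrib)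

context linear_model
begin

text \<open>
The supremum of \<open>(empirical_error f n z t)\<^sup>2\<close> over the unit ball of the model.
\<close>

definition sup_error :: "(real \<Rightarrow> real) \<Rightarrow> nat \<Rightarrow> (nat \<Rightarrow> real) \<Rightarrow> real" where
  "sup_error f n z = (\<Sum>i<D. (coefficients n z i - ip (e i) f)\<^sup>2)"

lemma sup_error_nonneg: "0 \<le> sup_error f n z"
  by (simp add: sup_error_def sum_nonneg)

lemma empirical_error_combination:
  assumes f: "borel_bounded C f"
  shows "empirical_error f n z (\<lambda>x. \<Sum>i<D. c i * e i x) = (\<Sum>i<D. c i * (coefficients n z i - ip (e i) f))"
proof -
  have "(\<Sum>j=1..n. \<Sum>i<D. c i * e i (z j)) / real n = (\<Sum>i<D. c i * coefficients n z i)"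
    by (subst sum.swap) (simp add: coefficients_def sum_distrib_left sum_divide_distrib)
  then show ?thesis
    unfolding empirical_error_def ip_combination_left[OF f] by (simp add: right_diff_distrib sum_subtractf)
qed

lemma empirical_error_sq_le:
  assumes f: "borel_bounded C f" and t: "t \<in> S"
  shows "(empirical_error f n z t)\<^sup>2 \<le> (l2_norm t)\<^sup>2 * sup_error f n z"
proof -
  obtain c where c: "t = (\<lambda>x. \<Sum>i<D. c i * e i x)" using e_span[OF t] by blast
  show ?thesis
    unfolding c empirical_error_combination[OF f] norm_combination sup_error_def by (rule Cauchy_Schwarz_ineq_sum)
qed

text \<open>
The supremum over the smaller unit ball is attained at an element of the larger space.
\<close>

lemma sup_error_mono:
  assumes f: "borel_bounded C f" and bigger: "linear_model S' e' D' r0'" "S \<subseteq> S'"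
  shows "sup_error f n z \<le> linear_model.sup_error e' D' f n z"
proof -
  interpret B: linear_model S' e' D' r0' by fact
  define c where "c = (\<lambda>i. coefficients n z i - ip (e i) f)"
  define t where "t = (\<lambda>x. \<Sum>i<D. c i * e i x)"
  have tS: "t \<in> S'" using combination_in bigger(2) by (auto simp: t_def)
  have "empirical_error f n z t = sup_error f n z"
    unfolding t_def empirical_error_combination[OF f] sup_error_def c_def by (simp add: power2_eq_square)
  moreover have "(l2_norm t)\<^sup>2 = sup_error f n z" unfolding t_def norm_combination sup_error_def c_def ..
  ultimately have "sup_error f n z * sup_error f n z \<le> sup_error f n z * B.sup_error f n z"
    using B.empirical_error_sq_le[OF f tS, of n z] by (simp add: power2_eq_square)
  then show ?thesis
    using sup_error_nonneg[of f n z] B.sup_error_nonneg[of f n z]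
    by (cases "sup_error f n z = 0") (auto simp: mult_le_cancel_left_pos less_le)
qed

text \<open>
By linearity of the empirical error, \<open>2 \<nu>(a - p) \<le> \<parallel>a - p\<parallel>\<^sup>2/4 + 4 W\<close>, and
\<open>\<parallel>a - p\<parallel>\<^sup>2 \<le> 2 \<parallel>a - f\<parallel>\<^sup>2 + 2 \<parallel>p - f\<parallel>\<^sup>2\<close>. Half of the loss is then absorbed on the left, and
doubling gives the constants.
\<close>

lemma oracle_step:
  assumes n: "1 \<le> n" and f: "borel_bounded C f" and a: "a \<in> S" and p: "p \<in> S"
    and opt: "contrast n z a + pa \<le> contrast n z p + pp"
  shows "(l2_norm (\<lambda>x. a x - f x))\<^sup>2 \<le> 3 * (l2_norm (\<lambda>x. p x - f x))\<^sup>2 + 8 * sup_error f n z + 2 * pp - 2 * pa"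
proof -
  obtain Ba where Ba: "borel_bounded Ba a" using bounded_S[OF a] by blast
  obtain Bp where Bp: "borel_bounded Bp p" using bounded_S[OF p] by blast
  define W where "W = sup_error f n z"
  define v where "v = empirical_error f n z (\<lambda>x. a x - p x)"
  define N where "N = (l2_norm (\<lambda>x. a x - p x))\<^sup>2"
  define x where "x = (l2_norm (\<lambda>x. a x - f x))\<^sup>2"
  define y where "y = (l2_norm (\<lambda>x. p x - f x))\<^sup>2"
  have W: "0 \<le> W" by (simp add: W_def sup_error_nonneg)
  have N0: "0 \<le> N" by (simp add: N_def)
  have ap: "(\<lambda>x. a x - p x) \<in> S"
    using fun_vs.subspace_diff[OF subspace a p] by (simp add: fun_diff_def)
  have v: "v\<^sup>2 \<le> N * W" unfolding v_def N_def W_def by (rule empirical_error_sq_le[OF f ap])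
  have v2: "2 * v \<le> N / 4 + 4 * W"
  proof -
    have "N * W \<le> (N / 8 + 2 * W)\<^sup>2"
      using zero_le_power2[of "N / 8 - 2 * W"] by (simp add: power2_eq_square algebra_simps)
    then have "v\<^sup>2 \<le> (N / 8 + 2 * W)\<^sup>2" using v by linarith
    then have "\<bar>v\<bar> \<le> N / 8 + 2 * W" using N0 W by (metis abs_le_square_iff abs_of_nonneg add_nonneg_nonneg divide_nonneg_nonneg mult_nonneg_nonneg zero_le_numeral)
    then show ?thesis by linarith
  qed
  have "x + pa \<le> y + 2 * v + pp"
  proof -
    define va vp F where "va = empirical_error f n z a" and "vp = empirical_error f n z p" and "F = ip f f"
    have "x - F - 2 * va + pa \<le> y - F - 2 * vp + pp"
      using opt unfolding contrast_eq[OF n Ba f] contrast_eq[OF n Bp f] x_def y_def va_def vp_def F_def .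
    moreover have "v = va - vp" unfolding v_def va_def vp_def by (rule empirical_error_diff[OF Ba Bp f])
    ultimately show ?thesis by simp
  qed
  moreover have "N \<le> 2 * x + 2 * y" unfolding N_def x_def y_def by (rule l2_norm_diff_le[OF Ba Bp f])
  ultimately have "x \<le> 3 * y + 8 * W + 2 * pp - 2 * pa" using v2 by linarith
  then show ?thesis by (simp add: x_def y_def W_def)
qed

end

lemma sup_error_empty: "D = 0 \<Longrightarrow> linear_model.sup_error e D f n z = 0" if "linear_model S e D r0"
  using linear_model.sup_error_def[OF that] by simp


locale density_chain = mean_ergodic_chain +
  fixes g f :: "real \<Rightarrow> real" and Fmax :: real
  assumes g: "g \<in> borel_measurable borel" "\<And>x. 0 \<le> g x"
    and mu_density: "\<mu> = density lborel (\<lambda>x. ennreal (g x))"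
    and f_def: "f = (\<lambda>x. g x * indicator {0..1} x)"
    and Fmax: "\<And>x. f x \<le> Fmax"
begin

lemma f_measurable [measurable]: "f \<in> borel_measurable borel"
  unfolding f_def using g by measurable

lemma f_nonneg: "0 \<le> f x" unfolding f_def using g by simp

lemma Fmax_nonneg: "0 \<le> Fmax" using order_trans[OF f_nonneg Fmax] .

lemma f_bounded: "borel_bounded Fmax f"
  using Fmax f_nonneg by (intro borel_boundedI) auto

lemma mu_integral_Linf:
  assumes "t \<in> Linf" shows "(LINT x|\<mu>. t x) = ip t f"
proof -
  have t: "t \<in> borel_measurable borel" "\<And>x. x \<notin> {0..1} \<Longrightarrow> t x = 0" using assms by (auto simp: Linf_def)
  have "(LINT x|\<mu>. t x) = (LINT x|lborel. g x *\<^sub>R t x)"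
    unfolding mu_density using g t by (intro integral_density) auto
  also have "\<dots> = ip t f"
    unfolding ip_def set_lebesgue_integral_def
    by (intro Bochner_Integration.integral_cong refl) (use t(2) in \<open>auto simp: f_def indicator_def\<close>)
  finally show ?thesis .
qed

lemma Linf_mult: "s \<in> Linf \<Longrightarrow> t \<in> Linf \<Longrightarrow> (\<lambda>x. s x * t x) \<in> Linf"
proof -
  assume s: "s \<in> Linf" and t: "t \<in> Linf"
  obtain B C where "borel_bounded B s" "borel_bounded C t" using Linf_borel_bounded s t by blast
  note b = borel_bounded_mult[OF this]
  then show ?thesis using s t
    by (auto simp: Linf_def borel_bounded_def intro!: bdd_aboveI2[where M="B * C"])
qed

lemma mu_square_le:
  assumes "t \<in> Linf" shows "(LINT x|\<mu>. (t x)\<^sup>2) \<le> Fmax * ip t t"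
proof -
  obtain B where B: "borel_bounded B t" using Linf_borel_bounded[OF assms] by blast
  note tt = borel_bounded_mult[OF B B]
  have "(LINT x|\<mu>. (t x)\<^sup>2) = ip (\<lambda>x. t x * t x) f"
    using mu_integral_Linf[OF Linf_mult[OF assms assms]] by (simp add: power2_eq_square)
  also have "\<dots> \<le> (LINT x:{0..1}|lborel. Fmax * (t x * t x))"
    unfolding ip_def
  proof (rule set_integral_mono)
    show "set_integrable lborel {0..1} (\<lambda>x. t x * t x * f x)" by (rule set_integrable_product[OF tt f_bounded])
    show "set_integrable lborel {0..1} (\<lambda>x. Fmax * (t x * t x))"
      using set_integrable_product[OF borel_bounded_const[of Fmax] tt] .
    show "t x * t x * f x \<le> Fmax * (t x * t x)" for x
      using mult_left_mono[OF Fmax, of "t x * t x" x] by (simp add: mult.commute)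
  qed
  finally show ?thesis by (simp add: ip_def)
qed

text \<open>
Centring costs a factor of at most \<open>4\<close> in the sum of squares, and can only decrease the variance,
which is at most \<open>Fmax\<close> times the squared \<open>L\<^sup>2\<close> norm because only the density on the unit interval matters.
\<close>

lemma centred_features_model:
  assumes model: "linear_model S e D r0" and D1: "1 \<le> D"
  shows "centred_features M X P \<mu> b A r (\<lambda>k x. e k x - ip (e k) f) {..<D} (4 * r0\<^sup>2) Fmax"
proof -
  interpret linear_model S e D r0 by fact
  have eL: "e k \<in> Linf" if "k < D" for k using e_in[OF that] Linf by auto
  interpret mu: prob_space \<mu> by (rule mu_prob)
  have e_int: "integrable \<mu> (e k)" "integrable \<mu> (\<lambda>x. (e k x)\<^sup>2)" if k: "k < D" for k
  proof -
    obtain B where B: "borel_bounded B (e k)" using Linf_borel_bounded[OF eL[OF k]] by blast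
    show "integrable \<mu> (e k)" by (rule integrable_borel_bounded[OF mu_prob(1,2) B])
    show "integrable \<mu> (\<lambda>x. (e k x)\<^sup>2)"
      using integrable_borel_bounded[OF mu_prob(1,2) borel_bounded_mult[OF B B]] by (simp add: power2_eq_square)
  qed
  have mean: "(LINT x|\<mu>. e k x) = ip (e k) f" if "k < D" for k by (rule mu_integral_Linf[OF eL[OF that]])
  have jensen: "(LINT x|\<mu>. t x)\<^sup>2 \<le> (LINT x|\<mu>. (t x)\<^sup>2)" "(LINT x|\<mu>. (t x - (LINT x|\<mu>. t x))\<^sup>2) \<le> (LINT x|\<mu>. (t x)\<^sup>2)"
    if "integrable \<mu> t" "integrable \<mu> (\<lambda>x. (t x)\<^sup>2)" for t :: "real \<Rightarrow> real"
  proof -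
    have "(LINT x|\<mu>. (t x - (LINT x|\<mu>. t x))\<^sup>2) = (LINT x|\<mu>. (t x)\<^sup>2) - (LINT x|\<mu>. t x)\<^sup>2"
      by (rule mu.variance_eq[OF that])
    moreover have "0 \<le> (LINT x|\<mu>. (t x - (LINT x|\<mu>. t x))\<^sup>2)" by (rule Bochner_Integration.integral_nonneg) simp
    ultimately show "(LINT x|\<mu>. t x)\<^sup>2 \<le> (LINT x|\<mu>. (t x)\<^sup>2)" "(LINT x|\<mu>. (t x - (LINT x|\<mu>. t x))\<^sup>2) \<le> (LINT x|\<mu>. (t x)\<^sup>2)"
      by auto
  qed
  have means: "(\<Sum>k<D. (ip (e k) f)\<^sup>2) \<le> r0\<^sup>2 * real D"
  proof -
    have "(\<Sum>k<D. (ip (e k) f)\<^sup>2) \<le> (\<Sum>k<D. LINT x|\<mu>. (e k x)\<^sup>2)"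
      using jensen(1)[OF e_int] by (intro sum_mono) (simp add: mean)
    also have "\<dots> = (LINT x|\<mu>. (\<Sum>k<D. (e k x)\<^sup>2))"
      using e_int by (subst Bochner_Integration.integral_sum) auto
    also have "\<dots> \<le> (LINT x|\<mu>. r0\<^sup>2 * real D)"
      using e_int basis_sq_sum by (intro integral_mono Bochner_Integration.integrable_sum) auto
    finally show ?thesis by (simp add: mu.prob_space)
  qed
  show ?thesis
  proof (unfold_locales, goal_cases)
    case 1 then show ?case by simp
  next
    case 2 then show ?case using D1 by (auto simp: lessThan_empty_iff)
  next
    case (3 k)
    then have "e k \<in> borel_measurable borel" using eL[of k] by (simp add: Linf_def)
    then show ?case by measurable
  next
    case (4 x)
    have "(\<Sum>k<D. (e k x - ip (e k) f)\<^sup>2) \<le> (\<Sum>k<D. 2 * (e k x)\<^sup>2 + 2 * (ip (e k) f)\<^sup>2)"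
    proof (rule sum_mono)
      fix k
      show "(e k x - ip (e k) f)\<^sup>2 \<le> 2 * (e k x)\<^sup>2 + 2 * (ip (e k) f)\<^sup>2"
        using zero_le_power2[of "e k x + ip (e k) f"] by (simp add: power2_eq_square algebra_simps)
    qed
    also have "\<dots> = 2 * (\<Sum>k<D. (e k x)\<^sup>2) + 2 * (\<Sum>k<D. (ip (e k) f)\<^sup>2)"
      by (simp add: sum.distrib sum_distrib_left)
    also have "\<dots> \<le> 4 * r0\<^sup>2 * real D" using means basis_sq_sum[of x] by linarith
    finally show ?case by simp
  next
    case (5 k)
    then show ?case using e_int(1)[of k] mean[of k] by (simp add: mu.prob_space)
  next
    case (6 c)
    define t where "t = (\<lambda>x. \<Sum>k<D. c k * e k x)"
    have tS: "t \<in> S" unfolding t_def by (rule combination_in)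
    then have tL: "t \<in> Linf" using Linf by auto
    obtain B where B: "borel_bounded B t" using Linf_borel_bounded[OF tL] by blast
    have mt: "(LINT x|\<mu>. t x) = (\<Sum>k<D. c k * ip (e k) f)"
      unfolding mu_integral_Linf[OF tL] unfolding t_def by (rule ip_combination_left[OF f_bounded])
    have "(\<Sum>k<D. c k * (e k x - ip (e k) f)) = t x - (LINT x|\<mu>. t x)" for x
      unfolding mt by (simp add: t_def right_diff_distrib sum_subtractf)
    then have "(LINT x|\<mu>. (\<Sum>k<D. c k * (e k x - ip (e k) f))\<^sup>2) = (LINT x|\<mu>. (t x - (LINT x|\<mu>. t x))\<^sup>2)"
      by (simp only:)
    also have "\<dots> \<le> (LINT x|\<mu>. (t x)\<^sup>2)"
      using integrable_borel_bounded[OF mu_prob(1,2) B] integrable_borel_bounded[OF mu_prob(1,2) borel_bounded_mult[OF B B]]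
      by (intro jensen(2)) (auto simp: power2_eq_square)
    also have "\<dots> \<le> Fmax * ip t t" by (rule mu_square_le[OF tL])
    also have "ip t t = (\<Sum>k<D. (c k)\<^sup>2)" using norm_combination[of c] by (simp add: t_def l2_norm_sq)
    finally show ?case by simp
  next
    case 7 then show ?case by simp
  next
    case 8 then show ?case by (rule Fmax_nonneg)
  qed
qed

definition \<kappa> :: "real \<Rightarrow> real" where "\<kappa> r0 = 4 * (2 * (2 * (4 * r0\<^sup>2) * A / (1 - r)) + 1)"

lemma \<kappa>_pos: "0 < \<kappa> r0"
  using A r by (auto simp: \<kappa>_def intro!: add_nonneg_pos divide_nonneg_pos mult_nonneg_nonneg)

lemma sup_error_excess:
  obtains C where "0 \<le> C"
    "\<And>S e D n. linear_model S e D r0 \<Longrightarrow> 1 \<le> D \<Longrightarrow> D\<^sup>2 \<le> n \<Longrightarrow>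
      integrable M (\<lambda>\<omega>. max 0 (linear_model.sup_error e D f n (\<lambda>i. X i \<omega>) - \<kappa> r0 * real D / real n))"
    "\<And>S e D n. linear_model S e D r0 \<Longrightarrow> 1 \<le> D \<Longrightarrow> D\<^sup>2 \<le> n \<Longrightarrow>
      (LINT \<omega>|M. max 0 (linear_model.sup_error e D f n (\<lambda>i. X i \<omega>) - \<kappa> r0 * real D / real n)) \<le> C / (real n * sqrt (real D))"
proof -
  obtain B where B: "0 \<le> B" "\<And>q::nat. real q ^ 132 * r ^ q \<le> B"
    using polynomial_times_geometric_bounded[OF r] by blast
  define C where "C = 4 * exp 15 * excess_constant (4 * r0\<^sup>2) Fmax A r B ^ 4"
  have main: "integrable M (\<lambda>\<omega>. max 0 (linear_model.sup_error e D f n (\<lambda>i. X i \<omega>) - \<kappa> r0 * real D / real n))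
    \<and> (LINT \<omega>|M. max 0 (linear_model.sup_error e D f n (\<lambda>i. X i \<omega>) - \<kappa> r0 * real D / real n)) \<le> C / (real n * sqrt (real D))"
    if model: "linear_model S e D r0" and Dn: "1 \<le> D" "D\<^sup>2 \<le> n" for S e D n
  proof -
    interpret linear_model S e D r0 by fact
    interpret F: centred_features M X P \<mu> b A r "\<lambda>k x. e k x - ip (e k) f" "{..<D}" "4 * r0\<^sup>2" Fmax
      by (rule centred_features_model[OF model Dn(1)])
    define E where "E = (\<lambda>\<omega>. max 0 ((\<Sum>k<D. (\<Sum>i=1..n. e k (X i \<omega>) - ip (e k) f)\<^sup>2) - \<kappa> r0 * (real n * real D)))"
    have "(card {..<D})\<^sup>2 \<le> n" using Dn by simp
    note ex = F.quadratic_excess_bound[OF this B]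
    have E: "integrable M E" "(LINT \<omega>|M. E \<omega>) \<le> C * real n / sqrt (real D)"
      using ex by (simp_all add: E_def \<kappa>_def C_def)
    have "1 \<le> D\<^sup>2" using Dn(1) by simp
    then have n: "0 < real n" using Dn(2) by simp
    have eq: "max 0 (sup_error f n (\<lambda>i. X i \<omega>) - \<kappa> r0 * real D / real n) = E \<omega> / (real n)\<^sup>2" for \<omega>
    proof -
      have "(\<Sum>i=1..n. e k (X i \<omega>) - ip (e k) f) = real n * (coefficients n (\<lambda>i. X i \<omega>) k - ip (e k) f)" for k
        using n by (simp add: coefficients_def sum_subtractf field_simps)
      then have "(\<Sum>k<D. (\<Sum>i=1..n. e k (X i \<omega>) - ip (e k) f)\<^sup>2) = (real n)\<^sup>2 * sup_error f n (\<lambda>i. X i \<omega>)"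
        by (simp add: sup_error_def power_mult_distrib sum_distrib_left)
      moreover have "\<kappa> r0 * (real n * real D) = (real n)\<^sup>2 * (\<kappa> r0 * real D / real n)"
        using n by (simp add: power2_eq_square)
      ultimately have "E \<omega> = max 0 ((real n)\<^sup>2 * (sup_error f n (\<lambda>i. X i \<omega>) - \<kappa> r0 * real D / real n))"
        unfolding E_def by (simp only: right_diff_distrib)
      then show ?thesis using n by (simp add: max_def zero_le_mult_iff)
    qed
    have "(LINT \<omega>|M. E \<omega> / (real n)\<^sup>2) = (LINT \<omega>|M. E \<omega>) / (real n)\<^sup>2" by simp
    also have "\<dots> \<le> C * real n / sqrt (real D) / (real n)\<^sup>2" by (rule divide_right_mono[OF E(2)]) simp
    also have "\<dots> = C / (real n * sqrt (real D))" using n by (simp add: field_simps power2_eq_square)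
    finally show ?thesis unfolding eq using E(1) by simp
  qed
  show thesis
    by (rule that[of C]) (use main in \<open>auto simp: C_def\<close>)
qed

end

section \<open>Penalised selection in a nested collection\<close>

context density_chain
begin

lemma estimator_loss_measurable:
  assumes model: "linear_model S e D r0" and n: "1 \<le> n"
  shows "(\<lambda>\<omega>. (l2_norm (\<lambda>x. min_contrast_est n (\<lambda>i. X i \<omega>) S x - f x))\<^sup>2) \<in> borel_measurable M"
proof -
  interpret linear_model S e D r0 by fact
  have [measurable]: "(\<lambda>\<omega>. coefficients n (\<lambda>i. X i \<omega>) i) \<in> borel_measurable M" if "i < D" for i
  proof -
    have [measurable]: "e i \<in> borel_measurable borel" using e_in[OF that] Linf by (auto simp: Linf_def)
    show ?thesis unfolding coefficients_def by measurable
  qed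
  have "(\<lambda>\<omega>. (\<Sum>i<D. (coefficients n (\<lambda>i. X i \<omega>) i - ip (e i) f)\<^sup>2) + (ip f f - (\<Sum>i<D. (ip (e i) f)\<^sup>2))) \<in> borel_measurable M"
    by measurable
  then show ?thesis unfolding min_contrast_est_eq[OF n] distance_combination[OF f_bounded] .
qed

end

locale model_collection = density_chain +
  fixes I :: "'m set" and S :: "'m \<Rightarrow> (real \<Rightarrow> real) set" and r0 :: real
  assumes collection: "models I S r0"
begin

definition dim :: "'m \<Rightarrow> nat" where "dim m = fun_vs.dim (S m)"

definition basis :: "'m \<Rightarrow> nat \<Rightarrow> real \<Rightarrow> real" where
  "basis m = (SOME e. linear_model (S m) e (dim m) r0)"

lemma model: assumes "m \<in> I" shows "linear_model (S m) (basis m) (dim m) r0"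
proof -
  have "fun_vs.subspace (S m)" "S m \<subseteq> Linf" "\<exists>B. finite B \<and> fun_vs.span B = S m" "phi (S m) \<le> ereal r0"
    using collection assms unfolding models_def by auto
  then have "\<exists>e. linear_model (S m) e (dim m) r0"
    unfolding dim_def using linear_model_exists by blast
  then show ?thesis unfolding basis_def by (rule someI_ex)
qed

lemma nested: "m \<in> I \<Longrightarrow> m' \<in> I \<Longrightarrow> dim m \<le> dim m' \<Longrightarrow> S m \<subseteq> S m'"
  using collection unfolding models_def dim_def by blast

definition model_error :: "nat \<Rightarrow> 'm \<Rightarrow> 'a \<Rightarrow> real" where
  "model_error n m \<omega> = linear_model.sup_error (basis m) (dim m) f n (\<lambda>i. X i \<omega>)"

lemma model_error_mono: "m \<in> I \<Longrightarrow> m' \<in> I \<Longrightarrow> dim m \<le> dim m' \<Longrightarrow> model_error n m \<omega> \<le> model_error n m' \<omega>"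
  unfolding model_error_def using linear_model.sup_error_mono[OF model f_bounded model nested] .

lemma dim_sq_le: "m \<in> models_upto I S n \<Longrightarrow> (dim m)\<^sup>2 \<le> n"
proof -
  assume "m \<in> models_upto I S n"
  then have "real (dim m) \<le> sqrt (real n)" by (simp add: models_upto_def dim_def)
  then have "(real (dim m))\<^sup>2 \<le> (sqrt (real n))\<^sup>2" by (rule power_mono) simp
  then have "real ((dim m)\<^sup>2) \<le> real n" by simp
  then show ?thesis by (simp only: of_nat_le_iff)
qed

lemma dim_le: "m \<in> models_upto I S n \<Longrightarrow> dim m \<le> n"
  using dim_sq_le[of m n] self_le_power[of "dim m" 2] by (cases "dim m = 0") (auto intro: order_trans)

lemma models_upto_I: "m \<in> models_upto I S n \<Longrightarrow> m \<in> I"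
  by (simp add: models_upto_def)

definition bucket :: "nat \<Rightarrow> nat \<Rightarrow> 'm set" where
  "bucket n k = {m \<in> models_upto I S n. 2 ^ k \<le> dim m \<and> dim m < 2 ^ Suc k}"

text \<open>
The models of one dyadic range of dimensions all lie in the one of largest dimension, which is at most
twice as large as any of them.
\<close>

definition largest :: "nat \<Rightarrow> nat \<Rightarrow> 'm" where
  "largest n k = (SOME m. m \<in> bucket n k \<and> (\<forall>m'\<in>bucket n k. dim m' \<le> dim m))"

lemma largest:
  assumes "bucket n k \<noteq> {}"
  shows "largest n k \<in> bucket n k" "m' \<in> bucket n k \<Longrightarrow> dim m' \<le> dim (largest n k)"
proof -
  obtain m0 where "m0 \<in> bucket n k" using assms by blast
  moreover have "\<forall>m. m \<in> bucket n k \<longrightarrow> dim m < Suc n" by (auto simp: bucket_def le_imp_less_Suc dim_le)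
  ultimately have "\<exists>m. m \<in> bucket n k \<and> (\<forall>m'. m' \<in> bucket n k \<longrightarrow> dim m' \<le> dim m)"
    by (intro ex_has_greatest_nat[where b="Suc n"]) (auto intro: less_imp_le)
  then have "\<exists>m. m \<in> bucket n k \<and> (\<forall>m'\<in>bucket n k. dim m' \<le> dim m)" by blast
  from someI_ex[OF this]
  show "largest n k \<in> bucket n k" "m' \<in> bucket n k \<Longrightarrow> dim m' \<le> dim (largest n k)"
    unfolding largest_def by blast+
qed

definition excess :: "nat \<Rightarrow> 'a \<Rightarrow> real" where
  "excess n \<omega> = (\<Sum>k | k < n \<and> bucket n k \<noteq> {}.
     max 0 (model_error n (largest n k) \<omega> - \<kappa> r0 * real (dim (largest n k)) / real n))"

lemma excess_nonneg: "0 \<le> excess n \<omega>"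
  unfolding excess_def by (rule sum_nonneg) simp

lemma model_error_le_excess:
  assumes m: "m \<in> models_upto I S n" and n: "1 \<le> n"
  shows "model_error n m \<omega> \<le> 2 * \<kappa> r0 * real (dim m) / real n + excess n \<omega>"
proof (cases "dim m = 0")
  case True
  then have "model_error n m \<omega> = 0"
    unfolding model_error_def by (rule sup_error_empty[OF model[OF models_upto_I[OF m]]])
  then show ?thesis using excess_nonneg[of n \<omega>] True by simp
next
  case False
  then obtain k where k: "2 ^ k \<le> dim m" "dim m < 2 ^ Suc k"
    using ex_power_ivl1[of 2 "dim m"] by auto
  have mb: "m \<in> bucket n k" using m k by (simp add: bucket_def)
  then have ne: "bucket n k \<noteq> {}" by blast
  have "k < 2 ^ k" by simp
  then have kn: "k < n" using k(1) dim_le[OF m] by linarith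
  define m' where "m' = largest n k"
  have m': "m' \<in> bucket n k" "dim m \<le> dim m'" using largest[OF ne] mb by (auto simp: m'_def)
  have m'I: "m' \<in> I" using m'(1) models_upto_I[of m' n] by (simp add: bucket_def)
  have "dim m' \<le> 2 * dim m" using m'(1) k(1) by (simp add: bucket_def)
  then have "real (dim m') \<le> 2 * real (dim m)" by (metis of_nat_le_iff of_nat_mult of_nat_numeral)
  then have "\<kappa> r0 * real (dim m') / real n \<le> \<kappa> r0 * (2 * real (dim m)) / real n"
    using \<kappa>_pos[of r0] by (intro divide_right_mono mult_left_mono) auto
  moreover have "model_error n m \<omega> \<le> model_error n m' \<omega>" by (rule model_error_mono[OF models_upto_I[OF m] m'I m'(2)])
  moreover have "max 0 (model_error n m' \<omega> - \<kappa> r0 * real (dim m') / real n) \<le> excess n \<omega>"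
    unfolding excess_def m'_def
    by (rule member_le_sum[where f="\<lambda>k. max 0 (model_error n (largest n k) \<omega> - \<kappa> r0 * real (dim (largest n k)) / real n)"]) (use kn ne in auto)
  ultimately show ?thesis by (simp add: mult.commute mult.left_commute)
qed

text \<open>
The range of dimensions from \<open>2\<^sup>k\<close> on contributes at most \<open>C 2\<^sup>-\<^sup>k\<^sup>/\<^sup>2 / n\<close>, a convergent geometric
series.
\<close>

lemma excess_expectation:
  assumes C: "0 \<le> C"
    "\<And>S e D n. linear_model S e D r0 \<Longrightarrow> 1 \<le> D \<Longrightarrow> D\<^sup>2 \<le> n \<Longrightarrow>
      integrable M (\<lambda>\<omega>. max 0 (linear_model.sup_error e D f n (\<lambda>i. X i \<omega>) - \<kappa> r0 * real D / real n))"
    "\<And>S e D n. linear_model S e D r0 \<Longrightarrow> 1 \<le> D \<Longrightarrow> D\<^sup>2 \<le> n \<Longrightarrow>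
      (LINT \<omega>|M. max 0 (linear_model.sup_error e D f n (\<lambda>i. X i \<omega>) - \<kappa> r0 * real D / real n)) \<le> C / (real n * sqrt (real D))"
    and n: "1 \<le> n"
  shows "integrable M (excess n)" "(LINT \<omega>|M. excess n \<omega>) \<le> C / (1 - 1 / sqrt 2) / real n"
proof -
  define K where "K = {k. k < n \<and> bucket n k \<noteq> {}}"
  define t where "t = (\<lambda>k \<omega>. max 0 (model_error n (largest n k) \<omega> - \<kappa> r0 * real (dim (largest n k)) / real n))"
  have s2: "0 < 1 / sqrt 2" "1 / sqrt 2 < (1 :: real)" by auto
  have piece: "integrable M (t k)" "(LINT \<omega>|M. t k \<omega>) \<le> C / real n * (1 / sqrt 2) ^ k" if k: "k \<in> K" for k
  proof -
    define m where "m = largest n k"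
    have m: "m \<in> bucket n k" using k largest(1) by (auto simp: K_def m_def)
    have mI: "m \<in> I" and dm: "2 ^ k \<le> dim m" and sq: "(dim m)\<^sup>2 \<le> n"
      using m models_upto_I dim_sq_le by (auto simp: bucket_def)
    have "(1 :: nat) \<le> 2 ^ k" by simp
    then have d1: "1 \<le> dim m" using dm by linarith
    show "integrable M (t k)" unfolding t_def model_error_def m_def[symmetric] by (rule C(2)[OF model[OF mI] d1 sq])
    have "(LINT \<omega>|M. t k \<omega>) \<le> C / (real n * sqrt (real (dim m)))"
      unfolding t_def model_error_def m_def[symmetric] by (rule C(3)[OF model[OF mI] d1 sq])
    also have "\<dots> \<le> C / (real n * sqrt 2 ^ k)"
    proof -
      have "real (2 ^ k) \<le> real (dim m)" using dm by (simp only: of_nat_le_iff)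
      then have "sqrt 2 ^ k \<le> sqrt (real (dim m))" by (simp add: real_sqrt_power[symmetric])
      then show ?thesis using C(1) n d1 by (intro divide_left_mono mult_left_mono mult_pos_pos) auto
    qed
    finally show "(LINT \<omega>|M. t k \<omega>) \<le> C / real n * (1 / sqrt 2) ^ k" by (simp add: power_one_over)
  qed
  have fin: "finite K" by (simp add: K_def)
  have ex: "excess n = (\<lambda>\<omega>. \<Sum>k\<in>K. t k \<omega>)" by (simp add: excess_def K_def t_def fun_eq_iff)
  show "integrable M (excess n)" unfolding ex using piece by (intro Bochner_Integration.integrable_sum) auto
  have "(LINT \<omega>|M. excess n \<omega>) = (\<Sum>k\<in>K. (LINT \<omega>|M. t k \<omega>))" unfolding ex using piece by (intro Bochner_Integration.integral_sum) auto
  also have "\<dots> \<le> (\<Sum>k\<in>K. C / real n * (1 / sqrt 2) ^ k)" using piece by (intro sum_mono) auto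
  also have "\<dots> = C / real n * (\<Sum>k\<in>K. (1 / sqrt 2) ^ k)" by (simp add: sum_distrib_left)
  also have "\<dots> \<le> C / real n * (1 / (1 - 1 / sqrt 2))"
  proof -
    have "(\<Sum>k\<in>K. (1 / sqrt 2) ^ k) \<le> (\<Sum>k. (1 / sqrt 2) ^ k)"
      using fin s2 by (intro sum_le_suminf summable_geometric) auto
    also have "\<dots> = 1 / (1 - 1 / sqrt 2)" using s2 by (intro suminf_geometric) auto
    finally show ?thesis using C(1) n by (intro mult_left_mono) auto
  qed
  finally show "(LINT \<omega>|M. excess n \<omega>) \<le> C / (1 - 1 / sqrt 2) / real n" by (simp add: mult.commute)
qed

definition loss :: "nat \<Rightarrow> ('a \<Rightarrow> 'm) \<Rightarrow> 'a \<Rightarrow> real" where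
  "loss n mhat \<omega> = (l2_norm (\<lambda>x. min_contrast_est n (\<lambda>i. X i \<omega>) (S (mhat \<omega>)) x - f x))\<^sup>2"

text \<open>
The index type may be uncountable, but by nestedness the loss depends on the selected model only
through its dimension, a natural number.
\<close>

lemma loss_measurable:
  assumes sel: "penalized_selection M X I S K n mhat" and n: "1 \<le> n"
  shows "loss n mhat \<in> borel_measurable M"
proof -
  define rep where "rep = (\<lambda>d. SOME m. m \<in> models_upto I S n \<and> dim m = d)"
  define L where "L = (\<lambda>d \<omega>. if \<exists>m\<in>models_upto I S n. dim m = d
      then (l2_norm (\<lambda>x. min_contrast_est n (\<lambda>i. X i \<omega>) (S (rep d)) x - f x))\<^sup>2 else 0)"
  have rep: "rep d \<in> models_upto I S n \<and> dim (rep d) = d" if "\<exists>m\<in>models_upto I S n. dim m = d" for d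
  proof -
    have "\<exists>m. m \<in> models_upto I S n \<and> dim m = d" using that by blast
    then show ?thesis unfolding rep_def by (rule someI_ex)
  qed
  have L: "L d \<in> borel_measurable M" for d
  proof (cases "\<exists>m\<in>models_upto I S n. dim m = d")
    case True
    then show ?thesis
      unfolding L_def if_P[OF True]
      using estimator_loss_measurable[OF model[OF models_upto_I] n] rep[OF True] by blast
  qed (simp add: L_def)
  have mhat: "mhat \<in> M \<rightarrow>\<^sub>M count_space UNIV" and in_models: "\<And>\<omega>. \<omega> \<in> space M \<Longrightarrow> mhat \<omega> \<in> models_upto I S n"
    using sel unfolding penalized_selection_def is_arg_min_def by auto
  have dm: "(\<lambda>\<omega>. dim (mhat \<omega>)) \<in> M \<rightarrow>\<^sub>M count_space UNIV"
    by (rule measurable_compose[OF mhat]) simp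
  have "(\<lambda>\<omega>. L (dim (mhat \<omega>)) \<omega>) \<in> borel_measurable M"
    by (rule measurable_compose_countable[OF L dm])
  moreover have "L (dim (mhat \<omega>)) \<omega> = loss n mhat \<omega>" if w: "\<omega> \<in> space M" for \<omega>
  proof -
    have ex: "\<exists>m\<in>models_upto I S n. dim m = dim (mhat \<omega>)" using in_models[OF w] by blast
    have "S (rep (dim (mhat \<omega>))) = S (mhat \<omega>)"
      using rep[OF ex] in_models[OF w] by (intro equalityI nested models_upto_I) auto
    then show ?thesis unfolding L_def if_P[OF ex] loss_def by simp
  qed
  ultimately show ?thesis by (simp cong: measurable_cong)
qed

text \<open>
The oracle inequality is applied in the larger of the selected and the competing model. Its dimension
is at most the sum of the two dimensions, so the deterministic part of the remainder is paid for by
the two penalties; the penalty of the selected model cancels.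
\<close>

lemma loss_le:
  assumes sel: "penalized_selection M X I S K n mhat" and n: "1 \<le> n" and K: "16 * \<kappa> r0 \<le> K"
    and m: "m \<in> models_upto I S n" and w: "\<omega> \<in> space M"
  shows "loss n mhat \<omega> \<le> 3 * ((l2_dist_set f (S m))\<^sup>2 + pen K n (S m)) + 8 * excess n \<omega>"
proof -
  define z where "z = (\<lambda>i. X i \<omega>)"
  define m' where "m' = mhat \<omega>"
  have arg: "is_arg_min (\<lambda>m. contrast n z (min_contrast_est n z (S m)) + pen K n (S m)) (\<lambda>m. m \<in> models_upto I S n) m'"
    using sel w unfolding penalized_selection_def z_def m'_def by blast
  have m': "m' \<in> models_upto I S n" using arg by (simp add: is_arg_min_def)
  have best: "contrast n z (min_contrast_est n z (S m')) + pen K n (S m') \<le> contrast n z (min_contrast_est n z (S m)) + pen K n (S m)"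
    using arg m unfolding is_arg_min_def by (auto simp: not_less)
  note mI = models_upto_I[OF m] and m'I = models_upto_I[OF m']
  interpret A1: linear_model "S m" "basis m" "dim m" r0 by (rule model[OF mI])
  interpret A2: linear_model "S m'" "basis m'" "dim m'" r0 by (rule model[OF m'I])
  define p where "p = A1.projection f"
  define a where "a = min_contrast_est n z (S m')"
  have pS: "p \<in> S m" unfolding p_def by (rule A1.projection_in)
  have aS: "a \<in> S m'" unfolding a_def by (rule A2.min_contrast_est_in[OF n])
  have opt: "contrast n z a + pen K n (S m') \<le> contrast n z p + pen K n (S m)"
    using best A1.min_contrast_est_minimises[OF n pS, of z] by (simp add: a_def)
  have larger: "\<exists>m''\<in>models_upto I S n. S m \<subseteq> S m'' \<and> S m' \<subseteq> S m'' \<and> dim m'' \<le> dim m + dim m'"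
  proof (cases "dim m \<le> dim m'")
    case True
    then show ?thesis using nested[OF mI m'I] m' by (intro bexI[of _ m']) auto
  next
    case False
    then show ?thesis using nested[OF m'I mI] m by (intro bexI[of _ m]) auto
  qed
  then obtain m'' where m'': "m'' \<in> models_upto I S n" "S m \<subseteq> S m''" "S m' \<subseteq> S m''" "dim m'' \<le> dim m + dim m'" by blast
  interpret A3: linear_model "S m''" "basis m''" "dim m''" r0 by (rule model[OF models_upto_I[OF m''(1)]])
  define d where "d = (l2_dist_set f (S m))\<^sup>2"
  define W where "W = model_error n m'' \<omega>"
  define Z where "Z = excess n \<omega>"
  define pm pm' where "pm = pen K n (S m)" and "pm' = pen K n (S m')"
  define l dp where "l = loss n mhat \<omega>" and "dp = (l2_norm (\<lambda>x. p x - f x))\<^sup>2"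
  have "a \<in> S m''" "p \<in> S m''" using aS pS m'' by auto
  then have "l \<le> 3 * dp + 8 * W + 2 * pm - 2 * pm'"
    using A3.oracle_step[OF n f_bounded _ _ opt]
    by (simp add: l_def dp_def W_def model_error_def pm_def pm'_def loss_def a_def z_def m'_def)
  moreover have "dp \<le> d" unfolding dp_def d_def p_def by (rule A1.projection_le_dist[OF f_bounded])
  moreover have "8 * W \<le> pm + pm' + 8 * Z"
  proof -
    have "W \<le> 2 * \<kappa> r0 * real (dim m'') / real n + Z"
      unfolding W_def Z_def by (rule model_error_le_excess[OF m''(1) n])
    moreover have "8 * (2 * \<kappa> r0 * real (dim m'') / real n) \<le> pm + pm'"
    proof -
      have "real (dim m'') \<le> real (dim m) + real (dim m')" using m''(4) by (simp add: of_nat_add[symmetric] del: of_nat_add)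
      then have "(16 * \<kappa> r0) * real (dim m'') \<le> K * (real (dim m) + real (dim m'))"
        using K \<kappa>_pos[of r0] by (intro mult_mono) auto
      then have "(16 * \<kappa> r0) * real (dim m'') / real n \<le> K * (real (dim m) + real (dim m')) / real n"
        by (rule divide_right_mono) simp
      then show ?thesis by (simp add: pm_def pm'_def pen_def dim_def distrib_left add_divide_distrib)
    qed
    ultimately show ?thesis by linarith
  qed
  moreover have "0 \<le> pm'" using K \<kappa>_pos[of r0] by (simp add: pm'_def pen_def)
  ultimately have "l \<le> 3 * (d + pm) + 8 * Z" by simp
  then show ?thesis by (simp only: l_def d_def pm_def Z_def)
qed

end

theorem theorem3:
  fixes M :: "'a measure" and X :: "nat \<Rightarrow> 'a \<Rightarrow> real"
    and P :: "real \<Rightarrow> real measure" and \<mu> \<nu> :: "real measure"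
    and g f h V :: "real \<Rightarrow> real" and \<rho> r0 :: real
  assumes chain: "markov_chain M X P"
    and A1: "positive_recurrent_with P \<mu>"
      "g \<in> borel_measurable borel" "\<And>x. 0 \<le> g x" "\<mu> = density lborel (\<lambda>x. ennreal (g x))"
      "f = (\<lambda>x. g x * indicator {0..1} x)"
    and A2: "distr M borel (X 0) = \<mu>"
    and A3: "bdd_above ((\<lambda>x. \<bar>f x\<bar>) ` {0..1})"
    and A4: "h \<in> borel_measurable borel" "\<And>x. x \<in> {0..1} \<Longrightarrow> h x \<in> {0..1}"
      "\<And>x. x \<notin> {0..1} \<Longrightarrow> h x = 0" "(LINT x|\<mu>. h x) > 0"
      "prob_space \<nu>" "sets \<nu> = sets borel"
      "\<And>x A. A \<in> sets borel \<Longrightarrow> measure (P x) A \<ge> h x * measure \<nu> A"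
    and A5: "\<And>x. V x > 0" "0 < \<rho>" "\<rho> < 1"
      "\<And>n x. n \<ge> 1 \<Longrightarrow> tv_norm_diff (kernel_pow P n x) \<mu> \<le> V x * \<rho> ^ n"
  shows "\<exists>K0::real. \<forall>(I :: 'm set) (S :: 'm \<Rightarrow> (real \<Rightarrow> real) set). models I S r0 \<longrightarrow>
    (\<forall>K>K0. \<exists>C1::real. \<forall>n\<ge>1. \<forall>mhat. penalized_selection M X I S K n mhat \<longrightarrow>
      (let ftilde = (\<lambda>\<omega>. min_contrast_est n (\<lambda>i. X i \<omega>) (S (mhat \<omega>)));
           loss = (\<lambda>\<omega>. (l2_norm (\<lambda>x. ftilde \<omega> x - f x))\<^sup>2)
       in integrable M loss \<and>
          (LINT \<omega>|M. loss \<omega>)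
            \<le> 3 * (INF m\<in>models_upto I S n. (l2_dist_set f (S m))\<^sup>2 + pen K n (S m)) + C1 / real n))"
proof -
  have P: "markov_kernel P" using chain by (simp add: markov_chain_def)
  have stat: "stationary_distribution P \<mu>" using A1(1) by (simp add: positive_recurrent_with_def)
  have h01: "0 \<le> h x" "h x \<le> 1" for x using A4(2)[of x] A4(3)[of x] by (cases "x \<in> {0..1}"; simp)+
  obtain b A r where erg: "0 \<le> A" "0 < r" "r < 1"
    "\<And>k. \<exists>c. borel_bounded c (b k)" "\<And>k x. 0 \<le> b k x" "\<And>k. (LINT x|\<mu>. b k x) \<le> A * r ^ k"
    "\<And>B \<phi> k x. borel_bounded B \<phi> \<Longrightarrow> \<bar>(kernel_op P ^^ k) \<phi> x - (LINT x|\<mu>. \<phi> x)\<bar> \<le> B * b k x"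
    by (rule geometrically_ergodic_imp_mean_geometric[OF P stat A4(1) h01 A4(4,5,6)])
       (rule A4(7) A5(2,3,4) that; assumption)+
  obtain F where "\<And>y. y \<in> (\<lambda>x. \<bar>f x\<bar>) ` {0..1} \<Longrightarrow> y \<le> F" using A3 unfolding bdd_above_def by blast
  then have F: "\<bar>f x\<bar> \<le> F" if "x \<in> {0..1}" for x using that by blast
  define Fmax where "Fmax = max 0 F"
  have Fmax: "f x \<le> Fmax" for x
  proof (cases "x \<in> {0..1}")
    case True
    then show ?thesis using F[OF True] by (auto simp: Fmax_def)
  qed (simp add: A1(5) Fmax_def)
  have "mean_ergodic_chain M X P \<mu> b A r"
    using chain stat A2 erg by (rule mean_ergodic_chain.intro)
  then interpret density_chain M X P \<mu> b A r g f Fmax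
    by (intro density_chain.intro density_chain_axioms.intro A1(2,3,4,5) Fmax)
  obtain C where C: "0 \<le> C"
    "\<And>S e D n. linear_model S e D r0 \<Longrightarrow> 1 \<le> D \<Longrightarrow> D\<^sup>2 \<le> n \<Longrightarrow>
      integrable M (\<lambda>\<omega>. max 0 (linear_model.sup_error e D f n (\<lambda>i. X i \<omega>) - \<kappa> r0 * real D / real n))"
    "\<And>S e D n. linear_model S e D r0 \<Longrightarrow> 1 \<le> D \<Longrightarrow> D\<^sup>2 \<le> n \<Longrightarrow>
      (LINT \<omega>|M. max 0 (linear_model.sup_error e D f n (\<lambda>i. X i \<omega>) - \<kappa> r0 * real D / real n)) \<le> C / (real n * sqrt (real D))"
    by (rule sup_error_excess[of r0]) blast
  define C1 where "C1 = 8 * (C / (1 - 1 / sqrt 2))"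
  have main: "integrable M (\<lambda>\<omega>. (l2_norm (\<lambda>x. min_contrast_est n (\<lambda>i. X i \<omega>) (S (mhat \<omega>)) x - f x))\<^sup>2) \<and>
      (LINT \<omega>|M. (l2_norm (\<lambda>x. min_contrast_est n (\<lambda>i. X i \<omega>) (S (mhat \<omega>)) x - f x))\<^sup>2)
        \<le> 3 * (INF m\<in>models_upto I S n. (l2_dist_set f (S m))\<^sup>2 + pen K n (S m)) + C1 / real n"
    if coll: "models I S r0" and K: "16 * \<kappa> r0 < K" and n: "1 \<le> n" and sel: "penalized_selection M X I S K n mhat"
    for I :: "'m set" and S K n mhat
  proof -
    interpret model_collection M X P \<mu> b A r g f Fmax I S r0
      by unfold_locales (rule coll)
    have ex: "integrable M (excess n)" "(LINT \<omega>|M. excess n \<omega>) \<le> C / (1 - 1 / sqrt 2) / real n"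
      by (rule excess_expectation[OF C(1) _ _ n]; rule C(2,3); assumption)+
    note le = loss_le[OF sel n less_imp_le[OF K]]
    have "space M \<noteq> {}" by (rule not_empty)
    then have ne: "models_upto I S n \<noteq> {}"
      using sel unfolding penalized_selection_def is_arg_min_def by blast
    then obtain m0 where m0: "m0 \<in> models_upto I S n" by blast
    have loss_nonneg: "0 \<le> loss n mhat \<omega>" for \<omega> by (simp add: loss_def)
    have int: "integrable M (loss n mhat)"
    proof (rule Bochner_Integration.integrable_bound)
      show "integrable M (\<lambda>\<omega>. 3 * ((l2_dist_set f (S m0))\<^sup>2 + pen K n (S m0)) + 8 * excess n \<omega>)" using ex(1) by simp
      show "loss n mhat \<in> borel_measurable M" by (rule loss_measurable[OF sel n])
      show "AE \<omega> in M. norm (loss n mhat \<omega>) \<le> norm (3 * ((l2_dist_set f (S m0))\<^sup>2 + pen K n (S m0)) + 8 * excess n \<omega>)"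
      proof (rule AE_I2)
        fix \<omega> assume "\<omega> \<in> space M"
        then show "norm (loss n mhat \<omega>) \<le> norm (3 * ((l2_dist_set f (S m0))\<^sup>2 + pen K n (S m0)) + 8 * excess n \<omega>)"
          using le[OF m0, of \<omega>] loss_nonneg[of \<omega>] by simp
      qed
    qed
    define E where "E = (LINT \<omega>|M. loss n mhat \<omega>)"
    have each: "(E - C1 / real n) / 3 \<le> (l2_dist_set f (S m))\<^sup>2 + pen K n (S m)" if m: "m \<in> models_upto I S n" for m
    proof -
      define T where "T = (l2_dist_set f (S m))\<^sup>2 + pen K n (S m)"
      have "E \<le> (LINT \<omega>|M. 3 * T + 8 * excess n \<omega>)"
        unfolding E_def T_def using int ex(1) le[OF m] by (intro integral_mono) auto
      also have "\<dots> = 3 * T + 8 * (LINT \<omega>|M. excess n \<omega>)" using ex(1) by (simp add: prob_space)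
      also have "\<dots> \<le> 3 * T + C1 / real n" using mult_left_mono[OF ex(2), of 8] by (simp add: C1_def)
      finally show ?thesis by (simp add: T_def[symmetric])
    qed
    define bound where "bound = (INF m\<in>models_upto I S n. (l2_dist_set f (S m))\<^sup>2 + pen K n (S m))"
    have "(E - C1 / real n) / 3 \<le> bound"
      unfolding bound_def using ne each by (rule cINF_greatest)
    then have "E \<le> 3 * bound + C1 / real n" by simp
    then have "E \<le> 3 * (INF m\<in>models_upto I S n. (l2_dist_set f (S m))\<^sup>2 + pen K n (S m)) + C1 / real n"
      unfolding bound_def .
    then show ?thesis using int unfolding E_def loss_def by blast
  qed
  show ?thesis
    unfolding Let_def
    by (intro exI[of _ "16 * \<kappa> r0"] allI impI exI[of _ C1]) (rule main)
qed

end
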